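(* Let $\Omega\subset\mathbb R^N$ be Lebesgue measurable and $a\in\mathbb R$. If $1\le r<\infty$, $1<p<\infty$ and $1<q<\infty$, then $$\left(HL^{(p,r)}_{a,q}\right)^*=\left(HL^{(p,r)}_{a,q}\right)'=HL^{(p',r')}_{-a,q'}$$ with equivalent norms. Moreover, if $1\le r\le p<\infty$ and $1<q<\infty$, then (up to equivalence of norms) $$\left(HL^{p,r}_{a,q}\right)^*=\left(HL^{p,r}_{a,q}\right)'=HL^{p',r'}_{-a,q'}.$$ Furthermore, in these cases the Hölder inequality holds: writing $E=l_q(w_a)$ and $\mathcal X=(X_k)_{k\in I}$ with $X_k=L^{(p,r)}(\Omega_k)$ (resp. $X_k=L^{p,r}(\Omega_k)$), for all $f\in E(\mathcal X)=HL^{(p,r)}_{a,q}$ (resp. $HL^{p,r}_{a,q}$) and $g\in E'(\mathcal X')$, $\mathcal X'=(X_k')_{k\in I}$, one has $fg\in L^1(\Omega)$ and $\int_\Omega|fg|\,d\mu\le\|f\|_{E(\mathcal X)}\|g\|_{E'(\mathcal X')}$.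
   Context: $p',q',r'$ are the conjugate exponents of $p,q,r$; $\mu$ is Lebesgue measure. For measurable $f$ let $f^*(t)=\inf\{\lambda>0:\mu(\{|f|>\lambda\})\le t\}$ and $f^{**}(t)=\frac1t\int_0^tf^*(s)\,ds$. Put $\|f\|_{p,r}=\left(\int_0^\infty(t^{1/p}f^*(t))^r\frac{dt}t\right)^{1/r}$ for $p,r<\infty$ and $\|f\|_{p,\infty}=\sup_{t>0}t^{1/p}f^*(t)$ for $p\le\infty$; $\|f\|_{(p,r)}$ is defined by the same formulas with $f^{**}$ in place of $f^*$. $L^{p,r}(A)$, $L^{(p,r)}(A)$ are the corresponding spaces of measurable functions on $A$. Let $I=\{-1,0,1,2,\dots\}$, $\Omega_{-1}=\{\omega\in\Omega:|\omega|<1/2\}$, $\Omega_k=\{\omega\in\Omega:2^{k-1}\le|\omega|<2^k\}$ for $k\ge0$; the local spaces over $\Omega_k$ are assumed non-trivial. $l_q(w_a)$ is the space of sequences on $I$ with norm $\left(\sum_k2^{kaq}|x_k|^q\right)^{1/q}$. For a Banach ideal sequence space $E$ on $I$ and ideal spaces $X_k$ over $\Omega_k$, $E(\mathcal X)=\{f\in L^0(\Omega):f\chi_{\Omega_k}\in X_k\ \forall k,\ (\|f\chi_{\Omega_k}\|_{X_k})_k\in E\}$ with $\|f\|_{E(\mathcal X)}=\|(\|f\chi_{\Omega_k}\|_{X_k})_k\|_E$. $HL^{p,r}_{a,q}$ is $E(\mathcal X)$ for $E=l_q(w_a)$, $X_k=L^{p,r}(\Omega_k)$; $HL^{(p,r)}_{a,q}$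 is $E(\mathcal X)$ for $E=l_q(w_a)$, $X_k=L^{(p,r)}(\Omega_k)$. $X^*$ is the topological dual; the Köthe dual of an ideal space $X$ is $X'=\{g\in L^0:\|g\|_{X'}=\sup_{\|f\|_X\le1}\int|fg|\,d\mu<\infty\}$. The equality of $X^*$ with a function space is understood through $f\mapsto\int fg\,d\mu$. *)

theory Defs
  imports "HOL-Analysis.Analysis"
begin

section \<open>Ideal spaces, their duals and Koethe duals\<close>

text \<open>
  Scalars are real.  A (quasi-)normed ideal space over a measure space \<open>M\<close> is given by its norm,
  extended by the value \<open>\<infinity>\<close> to all of \<open>L\<^sup>0(M)\<close>; the space itself consists of the measurable
  functions of finite norm.  Functions are not identified when they agree almost everywhere, and
  their values outside \<open>space M\<close> play no role.
\<close>

definition ideal_space :: "'a measure \<Rightarrow> (('a \<Rightarrow> real) \<Rightarrow> ennreal) \<Rightarrow> ('a \<Rightarrow> real) set" where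
  "ideal_space M N = {f \<in> borel_measurable M. N f < \<infinity>}"

definition nontrivial_space :: "'a measure \<Rightarrow> (('a \<Rightarrow> real) \<Rightarrow> ennreal) \<Rightarrow> bool" where
  "nontrivial_space M N \<longleftrightarrow> (\<exists>f\<in>ideal_space M N. \<not> (AE x in M. f x = 0))"

definition koethe_norm ::
    "'a measure \<Rightarrow> (('a \<Rightarrow> real) \<Rightarrow> ennreal) \<Rightarrow> ('a \<Rightarrow> real) \<Rightarrow> ennreal" where
  "koethe_norm M N g =
     (SUP f\<in>{f\<in>ideal_space M N. N f \<le> 1}. \<integral>\<^sup>+x. ennreal \<bar>f x * g x\<bar> \<partial>M)"

text \<open>
  The topological dual: linear functionals that are continuous for the norm topology.  Only the
  values on \<open>ideal_space M N\<close> matter.  Continuity forces a functional to agree on functions that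
  are equal almost everywhere whenever their difference has norm zero.
\<close>

definition topological_dual ::
    "'a measure \<Rightarrow> (('a \<Rightarrow> real) \<Rightarrow> ennreal) \<Rightarrow> (('a \<Rightarrow> real) \<Rightarrow> real) set" where
  "topological_dual M N = {\<phi>.
     (\<forall>f\<in>ideal_space M N. \<forall>h\<in>ideal_space M N. \<phi> (\<lambda>x. f x + h x) = \<phi> f + \<phi> h) \<and>
     (\<forall>c. \<forall>f\<in>ideal_space M N. \<phi> (\<lambda>x. c * f x) = c * \<phi> f) \<and>
     (\<forall>f\<in>ideal_space M N. \<forall>\<epsilon>>0. \<exists>\<delta>>0. \<forall>h\<in>ideal_space M N.
        N (\<lambda>x. h x - f x) < ennreal \<delta> \<longrightarrow> \<bar>\<phi> h - \<phi> f\<bar> < \<epsilon>)}"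

definition dual_norm ::
    "'a measure \<Rightarrow> (('a \<Rightarrow> real) \<Rightarrow> ennreal) \<Rightarrow> (('a \<Rightarrow> real) \<Rightarrow> real) \<Rightarrow> ennreal" where
  "dual_norm M N \<phi> = (SUP f\<in>{f\<in>ideal_space M N. N f \<le> 1}. ennreal \<bar>\<phi> f\<bar>)"

definition pairing :: "'a measure \<Rightarrow> ('a \<Rightarrow> real) \<Rightarrow> ('a \<Rightarrow> real) \<Rightarrow> real" where
  "pairing M g f = (\<integral>x. f x * g x \<partial>M)"

text \<open>
  \<open>X\<^sup>* = Y\<close> with equivalent norms: \<open>g \<mapsto> (f \<mapsto> \<integral>fg)\<close> is a well-defined bijection from \<open>Y\<close>
  (modulo equality almost everywhere) onto \<open>X\<^sup>*\<close>, with two-sided norm bounds.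
\<close>

definition dual_equals ::
    "'a measure \<Rightarrow> (('a \<Rightarrow> real) \<Rightarrow> ennreal) \<Rightarrow> (('a \<Rightarrow> real) \<Rightarrow> ennreal) \<Rightarrow> bool" where
  "dual_equals M X Y \<longleftrightarrow>
     (\<forall>g\<in>ideal_space M Y.
        (\<forall>f\<in>ideal_space M X. integrable M (\<lambda>x. f x * g x)) \<and>
        pairing M g \<in> topological_dual M X) \<and>
     (\<forall>g\<in>ideal_space M Y. \<forall>h\<in>ideal_space M Y.
        (\<forall>f\<in>ideal_space M X. pairing M g f = pairing M h f) \<longrightarrow> (AE x in M. g x = h x)) \<and>
     (\<forall>\<phi>\<in>topological_dual M X. \<exists>g\<in>ideal_space M Y.
        \<forall>f\<in>ideal_space M X. \<phi> f = pairing M g f) \<and>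
     (\<exists>c C :: real. c > 0 \<and> C > 0 \<and> (\<forall>g\<in>ideal_space M Y.
        ennreal c * Y g \<le> dual_norm M X (pairing M g) \<and>
        dual_norm M X (pairing M g) \<le> ennreal C * Y g))"

definition equal_spaces_equiv_norms ::
    "'a measure \<Rightarrow> (('a \<Rightarrow> real) \<Rightarrow> ennreal) \<Rightarrow> (('a \<Rightarrow> real) \<Rightarrow> ennreal) \<Rightarrow> bool" where
  "equal_spaces_equiv_norms M X Y \<longleftrightarrow>
     ideal_space M X = ideal_space M Y \<and>
     (\<exists>c C :: real. c > 0 \<and> C > 0 \<and>
        (\<forall>g\<in>ideal_space M Y. ennreal c * Y g \<le> X g \<and> X g \<le> ennreal C * Y g))"


section \<open>Lorentz spaces\<close>

text \<open>\<open>x\<^sup>r\<close> for \<open>x \<in> [0, \<infinity>]\<close>; only used with \<open>0 < r < \<infinity>\<close>.\<close>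

definition epowr :: "ennreal \<Rightarrow> real \<Rightarrow> ennreal" where
  "epowr x r = (if x = \<infinity> then \<infinity> else ennreal (enn2real x powr r))"

definition rearrangement :: "'a measure \<Rightarrow> ('a \<Rightarrow> real) \<Rightarrow> real \<Rightarrow> ennreal" where
  "rearrangement M f t =
     Inf {ennreal l |l. l > 0 \<and> emeasure M {x \<in> space M. \<bar>f x\<bar> > l} \<le> ennreal t}"

definition averaged_rearrangement :: "'a measure \<Rightarrow> ('a \<Rightarrow> real) \<Rightarrow> real \<Rightarrow> ennreal" where
  "averaged_rearrangement M f t =
     ennreal (1 / t) * (\<integral>\<^sup>+s\<in>{0<..<t}. rearrangement M f s \<partial>lborel)"

text \<open>
  The common formula for both kinds of Lorentz norm, applied to \<open>h = f\<^sup>*\<close> or \<open>h = f\<^sup>*\<^sup>*\<close>.  The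
  exponents lie in \<open>[1, \<infinity>]\<close>, where \<open>1 / \<infinity> = 0\<close>.  The combination \<open>p = \<infinity>\<close>, \<open>r < \<infinity>\<close> has no
  mathematical meaning here and is never used.
\<close>

definition lorentz_functional :: "ennreal \<Rightarrow> ennreal \<Rightarrow> (real \<Rightarrow> ennreal) \<Rightarrow> ennreal" where
  "lorentz_functional p r h =
     (if r = \<infinity> then SUP t\<in>{0<..}. ennreal (t powr enn2real (1 / p)) * h t
      else epowr
        (\<integral>\<^sup>+t\<in>{0<..}. epowr (ennreal (t powr enn2real (1 / p)) * h t) (enn2real r)
                          * ennreal (1 / t) \<partial>lborel)
        (1 / enn2real r))"

text \<open>\<open>lorentz_norm\<close> is the norm of \<open>L\<^bsup>p,r\<^esup>(A)\<close>, \<open>lorentz_avg_norm\<close> that of \<open>L\<^bsup>(p,r)\<^esup>(A)\<close>.\<close>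

definition lorentz_norm ::
    "ennreal \<Rightarrow> ennreal \<Rightarrow> 'a::euclidean_space set \<Rightarrow> ('a \<Rightarrow> real) \<Rightarrow> ennreal" where
  "lorentz_norm p r A f = lorentz_functional p r (rearrangement (lebesgue_on A) f)"

definition lorentz_avg_norm ::
    "ennreal \<Rightarrow> ennreal \<Rightarrow> 'a::euclidean_space set \<Rightarrow> ('a \<Rightarrow> real) \<Rightarrow> ennreal" where
  "lorentz_avg_norm p r A f = lorentz_functional p r (averaged_rearrangement (lebesgue_on A) f)"


section \<open>Spaces built from local components\<close>

definition idx :: "int set" where
  "idx = {-1..}"

definition piece :: "'a::euclidean_space set \<Rightarrow> int \<Rightarrow> 'a set" where
  "piece \<Omega> k =
     (if k = -1 then {\<omega>\<in>\<Omega>. norm \<omega> < 1 / 2}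
      else {\<omega>\<in>\<Omega>. 2 powi (k - 1) \<le> norm \<omega> \<and> norm \<omega> < 2 powi k})"

text \<open>Sequences on \<open>idx\<close> are functions on \<^typ>\<open>int\<close> considered over \<open>count_space idx\<close>.\<close>

definition weighted_lq_norm :: "real \<Rightarrow> real \<Rightarrow> (int \<Rightarrow> real) \<Rightarrow> ennreal" where
  "weighted_lq_norm a q x =
     epowr (\<integral>\<^sup>+k. ennreal (2 powr (real_of_int k * a * q) * \<bar>x k\<bar> powr q) \<partial>count_space idx) (1 / q)"

text \<open>The norm of \<open>E(X)\<close>, for \<open>E\<close> a sequence space on \<open>idx\<close> and \<open>X k\<close> a space over \<open>piece \<Omega> k\<close>.\<close>

definition composite_norm ::
    "((int \<Rightarrow> real) \<Rightarrow> ennreal) \<Rightarrow> (int \<Rightarrow> ('a \<Rightarrow> real) \<Rightarrow> ennreal) \<Rightarrow>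
     'a::euclidean_space set \<Rightarrow> ('a \<Rightarrow> real) \<Rightarrow> ennreal" where
  "composite_norm E X \<Omega> f =
     (if \<forall>k\<in>idx. (\<lambda>x. f x * indicator (piece \<Omega> k) x)
                   \<in> ideal_space (lebesgue_on (piece \<Omega> k)) (X k)
      then E (\<lambda>k. enn2real (X k (\<lambda>x. f x * indicator (piece \<Omega> k) x)))
      else \<infinity>)"

definition HL_norm ::
    "ennreal \<Rightarrow> ennreal \<Rightarrow> real \<Rightarrow> real \<Rightarrow> 'a::euclidean_space set \<Rightarrow> ('a \<Rightarrow> real) \<Rightarrow> ennreal" where
  "HL_norm p r a q \<Omega> =
     composite_norm (weighted_lq_norm a q) (\<lambda>k. lorentz_norm p r (piece \<Omega> k)) \<Omega>"

definition HL_avg_norm ::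
    "ennreal \<Rightarrow> ennreal \<Rightarrow> real \<Rightarrow> real \<Rightarrow> 'a::euclidean_space set \<Rightarrow> ('a \<Rightarrow> real) \<Rightarrow> ennreal" where
  "HL_avg_norm p r a q \<Omega> =
     composite_norm (weighted_lq_norm a q) (\<lambda>k. lorentz_avg_norm p r (piece \<Omega> k)) \<Omega>"

text \<open>The norm of \<open>E'(X')\<close>, with \<open>E'\<close> and each \<open>X\<^sub>k'\<close> the Koethe duals.\<close>

definition composite_koethe_norm ::
    "((int \<Rightarrow> real) \<Rightarrow> ennreal) \<Rightarrow> (int \<Rightarrow> ('a \<Rightarrow> real) \<Rightarrow> ennreal) \<Rightarrow>
     'a::euclidean_space set \<Rightarrow> ('a \<Rightarrow> real) \<Rightarrow> ennreal" where
  "composite_koethe_norm E X \<Omega> =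
     composite_norm (koethe_norm (count_space idx) E)
       (\<lambda>k. koethe_norm (lebesgue_on (piece \<Omega> k)) (X k)) \<Omega>"

definition hoelder_inequality ::
    "((int \<Rightarrow> real) \<Rightarrow> ennreal) \<Rightarrow> (int \<Rightarrow> ('a \<Rightarrow> real) \<Rightarrow> ennreal) \<Rightarrow>
     'a::euclidean_space set \<Rightarrow> bool" where
  "hoelder_inequality E X \<Omega> \<longleftrightarrow>
     (\<forall>f\<in>ideal_space (lebesgue_on \<Omega>) (composite_norm E X \<Omega>).
      \<forall>g\<in>ideal_space (lebesgue_on \<Omega>) (composite_koethe_norm E X \<Omega>).
        integrable (lebesgue_on \<Omega>) (\<lambda>x. f x * g x) \<and>
        ennreal (\<integral>x. \<bar>f x * g x\<bar> \<partial>lebesgue_on \<Omega>)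
          \<le> composite_norm E X \<Omega> f * composite_koethe_norm E X \<Omega> g)"

end

theory Submission
  imports Defs "HOL-Probability.Distribution_Functions"
begin

text \<open>
  The theorem combines a soft fact about duals with a computation of Koethe norms up to constants.

  The soft fact: suppose that a norm is homogeneous, monotone almost everywhere and order continuous
  (dominated sequences that tend to \<open>0\<close> pointwise tend to \<open>0\<close> in norm), and that some strictly
  positive \<open>w\<close> has finite norm.  Then for a continuous functional \<open>\<phi>\<close> the set function
  \<open>A \<mapsto> \<phi> (\<chi>\<^sub>A w)\<close> is a signed measure that vanishes on null sets; its Radon--Nikodym density,
  divided by \<open>w\<close>, represents \<open>\<phi>\<close> on bounded multiples of \<open>w\<close> and, by order continuity, everywhere
  (\<open>dual_representation\<close>, \<open>dual_equals_koethe\<close>).  So the dual is the Koethe dual.  The norms at hand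
  are order continuous because \<open>r\<close> and \<open>q\<close> are finite.

  The computation starts on a single piece, a set of finite Lebesgue measure.  The inequality of Hardy
  and Littlewood and Hoelder's inequality for \<open>dt/t\<close> show that the Koethe norm is at most the norm
  with the conjugate exponents.  For the converse, every \<open>t\<close> admits a set \<open>F\<close> of measure at most \<open>t\<close>
  with \<open>\<integral>\<^sub>F |g| \<ge> t g\<^sup>*\<^sup>*(t)\<close> (\<open>ex_set_rearrangement\<close>; this is where atoms would be an obstacle).  One
  tests \<open>g\<close> against \<open>f = \<Sum>\<^sub>j c\<^sub>j \<chi>(F\<^sub>j)\<close>, where \<open>F\<^sub>j\<close> belongs to \<open>t = 2\<^sup>j\<close>.  A discrete Hardy inequality
  (\<open>lorentz_avg_sum_le\<close>) bounds the norm of \<open>f\<close> by the \<open>l\<^sub>r\<close> norm of the sequence \<open>2\<^bsup>j/p\<^esup> c\<^sub>j\<close>, and the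
  choice of \<open>c\<close> that gives equality in Hoelder's inequality for sequences produces the \<open>l\<^sub>r'\<close> norm of
  the values \<open>2\<^bsup>j/p'\<^esup> g\<^sup>*\<^sup>*(2\<^sup>j)\<close>, which is comparable to the dual norm of \<open>g\<close>
  (\<open>koethe_lorentz_avg_lower\<close>).  For the norms built from \<open>f\<^sup>*\<close> and \<open>p > 1\<close> the lower bound is inherited,
  since \<open>f\<^sup>* \<le> f\<^sup>*\<^sup>*\<close>; the case \<open>p = r = 1\<close> is the duality of \<open>L\<^sup>1\<close> and \<open>L\<^sup>\<infinity>\<close>.

  All these constants depend on \<open>p\<close> and \<open>r\<close> only and hence are the same for all pieces.  That
  uniformity allows the same test, now with functions glued from nearly extremal local ones and with
  the sequence space \<open>l\<^sub>q\<close> in the place of \<open>l\<^sub>r\<close>, to identify the Koethe dual of the composite norm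
  (\<open>composite_koethe_lower\<close>).
\<close>

section \<open>Powers of extended nonnegative reals and Hoelder's inequality\<close>

lemma epowr_top [simp]: "epowr top r = top"
  by (simp add: epowr_def)

lemma epowr_ennreal: "0 \<le> x \<Longrightarrow> epowr (ennreal x) r = ennreal (x powr r)"
  by (simp add: epowr_def)

lemma epowr_0 [simp]: "epowr 0 r = 0"
  by (simp add: epowr_def)

lemma epowr_one [simp]: "epowr 1 r = 1"
  using epowr_ennreal[of 1 r] by simp

lemma epowr_1 [simp]: "epowr x 1 = x"
  by (cases x) (auto simp: epowr_ennreal)

lemma epowr_eq_0_iff [simp]: "epowr x r = 0 \<longleftrightarrow> x = 0"
  by (cases x) (auto simp: epowr_ennreal ennreal_eq_0_iff)

lemma epowr_eq_top_iff [simp]: "epowr x r = top \<longleftrightarrow> x = top"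
  by (cases x) (auto simp: epowr_ennreal)

lemma epowr_mono: "x \<le> y \<Longrightarrow> 0 \<le> r \<Longrightarrow> epowr x r \<le> epowr y r"
  by (cases x; cases y) (auto simp: epowr_ennreal powr_mono2 ennreal_leI top_unique)

lemma epowr_mult: "epowr (x * y) r = epowr x r * epowr y r"
  by (cases x; cases y)
     (auto simp: epowr_ennreal powr_mult ennreal_mult_eq_top_iff ennreal_mult_top ennreal_top_mult
       simp flip: ennreal_mult)

lemma epowr_epowr: "epowr (epowr x r) s = epowr x (r * s)"
  by (cases x) (auto simp: epowr_ennreal powr_powr)

lemma epowr_add: "epowr x r * epowr x s = epowr x (r + s)"
  by (cases x) (auto simp: epowr_ennreal powr_add simp flip: ennreal_mult)

lemma epowr_le_iff: "0 < r \<Longrightarrow> epowr x r \<le> y \<longleftrightarrow> x \<le> epowr y (1 / r)"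
  using epowr_mono[of "epowr x r" y "1 / r"] epowr_mono[of x "epowr y (1 / r)" r]
  by (auto simp: epowr_epowr)

lemma le_epowr_iff: "0 < r \<Longrightarrow> y \<le> epowr x r \<longleftrightarrow> epowr y (1 / r) \<le> x"
  using epowr_le_iff[of "1 / r" y x] by simp

lemma borel_measurable_epowr [measurable]:
  assumes [measurable]: "f \<in> borel_measurable M"
  shows "(\<lambda>x. epowr (f x) r) \<in> borel_measurable M"
  unfolding epowr_def by measurable

lemma epowr_tendsto_0:
  assumes "(f \<longlongrightarrow> 0) F" "0 < r"
  shows "((\<lambda>x. epowr (f x) r) \<longlongrightarrow> 0) F"
proof (rule order_tendstoI)
  fix y :: ennreal assume "0 < y"
  then have "0 < epowr y (1 / r)"
    by (simp add: zero_less_iff_neq_zero)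
  with assms(1) have "\<forall>\<^sub>F x in F. f x < epowr y (1 / r)"
    by (rule order_tendstoD(2))
  then show "\<forall>\<^sub>F x in F. epowr (f x) r < y"
    by eventually_elim (use le_epowr_iff[OF assms(2)] in \<open>simp flip: not_le\<close>)
qed simp

lemma Young_ennreal:
  assumes "1 < p" "1 < q" "1 / p + 1 / q = 1"
  shows "x * y \<le> ennreal (1 / p) * epowr x p + ennreal (1 / q) * epowr y q"
proof (cases "x = top \<or> y = top")
  case True
  have "0 < ennreal (1 / p)" "0 < ennreal (1 / q)"
    using assms by auto
  with True show ?thesis
    by (auto simp: ennreal_mult_top)
next
  case False
  then obtain a b where "x = ennreal a" "0 \<le> a" "y = ennreal b" "0 \<le> b"
    by (metis ennreal_cases)
  then show ?thesis
    using Youngs_inequality[of p q a b] assms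
    by (auto simp: epowr_ennreal simp flip: ennreal_mult ennreal_plus intro!: ennreal_leI)
qed

text \<open>
  Both integrals are normalised to \<open>1\<close> before Young's inequality is integrated.  If one of them is
  \<open>0\<close>, then the integrand on the left vanishes almost everywhere, which is needed because
  \<open>0 * \<infinity> = 0\<close>.
\<close>

lemma Hoelder_nn_integral:
  assumes pq: "1 < p" "1 < q" "1 / p + 1 / q = 1"
    and [measurable]: "F \<in> borel_measurable M" "G \<in> borel_measurable M"
  shows "(\<integral>\<^sup>+x. F x * G x \<partial>M)
      \<le> epowr (\<integral>\<^sup>+x. epowr (F x) p \<partial>M) (1 / p) * epowr (\<integral>\<^sup>+x. epowr (G x) q \<partial>M) (1 / q)"
    (is "_ \<le> epowr ?A _ * epowr ?B _")
proof -
  consider "?A = 0 \<or> ?B = 0" | "?A \<noteq> 0" "?B \<noteq> 0" "?A = top \<or> ?B = top"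
    | "?A \<noteq> 0" "?B \<noteq> 0" "?A \<noteq> top" "?B \<noteq> top" by blast
  then show ?thesis
  proof cases
    case 1
    then have "AE x in M. F x * G x = 0"
      by (auto simp: nn_integral_0_iff_AE)
    then have "(\<integral>\<^sup>+x. F x * G x \<partial>M) = 0"
      by (simp add: nn_integral_0_iff_AE)
    then show ?thesis by simp
  next
    case 2
    then show ?thesis
      by (auto simp: ennreal_mult_top ennreal_top_mult)
  next
    case 3
    define a b where "a = epowr ?A (1 / p)" and "b = epowr ?B (1 / q)"
    have ab: "a \<noteq> 0" "b \<noteq> 0" "a \<noteq> top" "b \<noteq> top"
      using 3 by (auto simp: a_def b_def)
    have ap: "epowr a p = ?A" "epowr b q = ?B"
      using pq by (simp_all add: a_def b_def epowr_epowr)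
    have inv: "epowr (inverse z) s * epowr z s = 1" if "z \<noteq> 0" "z \<noteq> top" for z s
      using that by (simp flip: epowr_mult add: ennreal_inverse_mult less_top mult.commute[of "inverse z"]
          divide_ennreal_def[symmetric])
    have "(\<integral>\<^sup>+x. (inverse a * F x) * (inverse b * G x) \<partial>M)
      \<le> (\<integral>\<^sup>+x. ennreal (1 / p) * epowr (inverse a * F x) p + ennreal (1 / q) * epowr (inverse b * G x) q \<partial>M)"
      by (intro nn_integral_mono Young_ennreal pq)
    also have "\<dots> = ennreal (1 / p) * (epowr (inverse a) p * ?A) + ennreal (1 / q) * (epowr (inverse b) q * ?B)"
      by (simp add: nn_integral_add nn_integral_cmult epowr_mult)
    also have "\<dots> = ennreal (1 / p) + ennreal (1 / q)"
      using inv[of a p] inv[of b q] ab by (simp add: ap)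
    also have "\<dots> = 1"
      using pq by (simp flip: ennreal_plus)
    finally have *: "(\<integral>\<^sup>+x. (inverse a * F x) * (inverse b * G x) \<partial>M) \<le> 1" .
    have aa: "a * inverse a = 1" "b * inverse b = 1"
      using ab by (simp_all add: divide_ennreal_def[symmetric] less_top)
    have "(\<integral>\<^sup>+x. F x * G x \<partial>M) = (\<integral>\<^sup>+x. (a * inverse a) * (b * inverse b) * (F x * G x) \<partial>M)"
      by (simp add: aa)
    also have "\<dots> = (\<integral>\<^sup>+x. (a * b) * ((inverse a * F x) * (inverse b * G x)) \<partial>M)"
      by (simp add: mult_ac)
    also have "\<dots> = (a * b) * (\<integral>\<^sup>+x. (inverse a * F x) * (inverse b * G x) \<partial>M)"
      by (simp add: nn_integral_cmult)
    also have "\<dots> \<le> (a * b) * 1"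
      by (intro mult_left_mono *) simp
    finally show ?thesis by (simp add: a_def b_def)
  qed
qed

section \<open>Ideal norms and the Koethe dual\<close>

text \<open>
  The properties on which Hoelder's inequality for the Koethe dual rests.  Monotonicity almost
  everywhere implies that the norm does not distinguish functions that agree almost everywhere.
\<close>

locale ideal_norm =
  fixes M :: "'a measure" and N :: "('a \<Rightarrow> real) \<Rightarrow> ennreal"
  assumes homogeneous: "f \<in> borel_measurable M \<Longrightarrow> N (\<lambda>x. c * f x) = ennreal \<bar>c\<bar> * N f"
    and monotone: "f \<in> borel_measurable M \<Longrightarrow> h \<in> borel_measurable M \<Longrightarrow>
      AE x in M. \<bar>f x\<bar> \<le> \<bar>h x\<bar> \<Longrightarrow> N f \<le> N h"
begin

abbreviation K where "K \<equiv> koethe_norm M N"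

lemma ideal_space_measurable [measurable_dest]:
  "f \<in> ideal_space M N \<Longrightarrow> f \<in> borel_measurable M"
  by (simp add: ideal_space_def)

lemma N_zero [simp]: "N (\<lambda>x. 0) = 0"
  using homogeneous[of "\<lambda>x. 0" 0] by simp

lemma zero_in_space [simp]: "(\<lambda>x. 0) \<in> ideal_space M N"
  by (simp add: ideal_space_def)

lemma N_eq_0_AE: "f \<in> borel_measurable M \<Longrightarrow> AE x in M. f x = 0 \<Longrightarrow> N f = 0"
  using monotone[of f "\<lambda>x. 0"] by simp

lemma dominated_in_space:
  assumes "h \<in> ideal_space M N" "f \<in> borel_measurable M" "\<And>x. x \<in> space M \<Longrightarrow> \<bar>f x\<bar> \<le> c * \<bar>h x\<bar>"
  shows "f \<in> ideal_space M N"
proof -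
  have [measurable]: "h \<in> borel_measurable M"
    using assms(1) by (rule ideal_space_measurable)
  have "N f \<le> N (\<lambda>x. \<bar>c\<bar> * h x)"
  proof (intro monotone AE_I2)
    fix x assume "x \<in> space M"
    from assms(3)[OF this] show "\<bar>f x\<bar> \<le> \<bar>\<bar>c\<bar> * h x\<bar>"
      using mult_right_mono[OF abs_ge_self, of "\<bar>h x\<bar>" c] by (simp add: abs_mult)
  qed (use assms in auto)
  also have "\<dots> < \<infinity>"
    using assms(1) by (simp add: homogeneous ideal_space_def ennreal_mult_less_top)
  finally show ?thesis
    using assms(2) by (simp add: ideal_space_def)
qed

lemma K_bound: "f \<in> ideal_space M N \<Longrightarrow> N f \<le> 1 \<Longrightarrow> (\<integral>\<^sup>+x. ennreal \<bar>f x * g x\<bar> \<partial>M) \<le> K g"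
  unfolding koethe_norm_def by (rule SUP_upper) simp

text \<open>
  If \<open>N f > 0\<close>, rescale \<open>f\<close> to norm \<open>1\<close>.  If \<open>N f = 0\<close>, then all multiples of \<open>f\<close> lie in the unit
  ball, so the integral has to vanish.  Finiteness of \<open>K g\<close> excludes the product \<open>0 * \<infinity>\<close>.
\<close>

lemma koethe_Hoelder:
  assumes f: "f \<in> ideal_space M N" and [measurable]: "g \<in> borel_measurable M" and fin: "K g < \<infinity>"
  shows "(\<integral>\<^sup>+x. ennreal \<bar>f x * g x\<bar> \<partial>M) \<le> N f * K g"
proof -
  have [measurable]: "f \<in> borel_measurable M" using f by (rule ideal_space_measurable)
  let ?I = "\<integral>\<^sup>+x. ennreal \<bar>f x * g x\<bar> \<partial>M"
  have scale: "ennreal c * ?I \<le> K g" if "0 \<le> c" "ennreal c * N f \<le> 1" for c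
  proof -
    have "ennreal c * ?I = (\<integral>\<^sup>+x. ennreal \<bar>(c * f x) * g x\<bar> \<partial>M)"
      using that by (simp flip: nn_integral_cmult ennreal_mult add: abs_mult mult_ac)
    also have "\<dots> \<le> K g"
      using that f by (intro K_bound dominated_in_space[OF f, of _ c])
        (auto simp: homogeneous abs_mult)
    finally show ?thesis .
  qed
  obtain s where s: "N f = ennreal s" "0 \<le> s"
    using f by (cases "N f") (auto simp: ideal_space_def)
  obtain k where k: "K g = ennreal k" "0 \<le> k"
    using fin by (cases "K g") auto
  show ?thesis
  proof (cases "s = 0")
    case True
    then have *: "ennreal (real n) * ?I \<le> ennreal k" for n
      using scale[of "real n"] s k by simp
    then obtain i where i: "?I = ennreal i" "0 \<le> i"
      using *[of 1] by (cases ?I) (auto simp: top_unique)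
    have "i = 0"
    proof (rule ccontr)
      assume "i \<noteq> 0"
      then obtain n where "k < real n * i"
        using reals_Archimedean3[of i] i by auto
      with *[of n] i k show False by (simp flip: ennreal_mult)
    qed
    with i show ?thesis by simp
  next
    case False
    then have "ennreal (1 / s) * ?I \<le> K g"
      using scale[of "1 / s"] s by (simp flip: ennreal_mult)
    then have "ennreal s * (ennreal (1 / s) * ?I) \<le> ennreal s * K g"
      by (rule mult_left_mono) simp
    also have "ennreal s * (ennreal (1 / s) * ?I) = ?I"
      using False s by (simp add: mult.assoc[symmetric] flip: ennreal_mult)
    finally show ?thesis using s by simp
  qed
qed

lemma koethe_integrable:
  assumes "f \<in> ideal_space M N" "g \<in> ideal_space M K"
  shows "integrable M (\<lambda>x. f x * g x)"
proof -
  have [measurable]: "f \<in> borel_measurable M" "g \<in> borel_measurable M"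
    using assms by (auto simp: ideal_space_def)
  have "(\<integral>\<^sup>+x. ennreal \<bar>f x * g x\<bar> \<partial>M) \<le> N f * K g"
    using assms by (intro koethe_Hoelder) (auto simp: ideal_space_def)
  also have "\<dots> < \<infinity>"
    using assms by (auto simp: ideal_space_def ennreal_mult_less_top)
  finally show ?thesis
    by (simp add: integrable_iff_bounded)
qed

lemma pairing_bound:
  assumes "f \<in> ideal_space M N" "g \<in> ideal_space M K"
  shows "ennreal \<bar>pairing M g f\<bar> \<le> N f * K g"
proof -
  have "ennreal \<bar>pairing M g f\<bar> \<le> (\<integral>\<^sup>+x. ennreal \<bar>f x * g x\<bar> \<partial>M)"
    using integral_norm_bound_ennreal[OF koethe_integrable[OF assms]] by (simp add: pairing_def)
  also have "\<dots> \<le> N f * K g"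
    using assms by (intro koethe_Hoelder) (auto simp: ideal_space_def)
  finally show ?thesis .
qed

lemma pairing_in_dual:
  assumes g: "g \<in> ideal_space M K"
  shows "pairing M g \<in> topological_dual M N"
  unfolding topological_dual_def
proof (intro CollectI conjI ballI allI impI)
  fix f h assume fh: "f \<in> ideal_space M N" "h \<in> ideal_space M N"
  show "pairing M g (\<lambda>x. f x + h x) = pairing M g f + pairing M g h"
    using koethe_integrable[OF fh(1) g] koethe_integrable[OF fh(2) g]
    by (simp add: pairing_def algebra_simps)
next
  fix c f assume "f \<in> ideal_space M N"
  show "pairing M g (\<lambda>x. c * f x) = c * pairing M g f"
    by (simp add: pairing_def mult.assoc)
next
  fix f and e :: real assume f: "f \<in> ideal_space M N" and e: "e > 0"
  obtain k where k: "K g = ennreal k" "0 \<le> k"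
    using g by (cases "K g") (auto simp: ideal_space_def)
  show "\<exists>\<delta>>0. \<forall>h\<in>ideal_space M N. N (\<lambda>x. h x - f x) < ennreal \<delta> \<longrightarrow> \<bar>pairing M g h - pairing M g f\<bar> < e"
  proof (intro exI[of _ "e / (k + 1)"] conjI ballI impI)
    show "0 < e / (k + 1)" using e k by simp
    fix h assume h: "h \<in> ideal_space M N" and lt: "N (\<lambda>x. h x - f x) < ennreal (e / (k + 1))"
    have [measurable]: "f \<in> borel_measurable M" "h \<in> borel_measurable M"
      using f h by (auto simp: ideal_space_def)
    obtain s where s: "N (\<lambda>x. h x - f x) = ennreal s" "0 \<le> s"
      using lt by (cases "N (\<lambda>x. h x - f x)") auto
    have d: "(\<lambda>x. h x - f x) \<in> ideal_space M N"
      using s by (simp add: ideal_space_def)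
    have "pairing M g h - pairing M g f = pairing M g (\<lambda>x. h x - f x)"
      using koethe_integrable[OF f g] koethe_integrable[OF h g] by (simp add: pairing_def algebra_simps)
    then have "\<bar>pairing M g h - pairing M g f\<bar> \<le> s * k"
      using pairing_bound[OF d g] s k by (simp flip: ennreal_mult)
    also have "\<dots> \<le> s * (k + 1)"
      using s by (intro mult_left_mono) auto
    also have "\<dots> < e"
      using lt s k e by (auto simp: ennreal_less_iff field_simps)
    finally show "\<bar>pairing M g h - pairing M g f\<bar> < e" .
  qed
qed

text \<open>
  Replacing \<open>f\<close> by \<open>|f| sgn g\<close> makes the integrand nonnegative without increasing the norm.
\<close>

lemma dual_norm_pairing:
  assumes g: "g \<in> ideal_space M K"
  shows "dual_norm M N (pairing M g) = K g"
proof (rule antisym)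
  show "dual_norm M N (pairing M g) \<le> K g"
    unfolding dual_norm_def
  proof (rule SUP_least)
    fix f assume f: "f \<in> {f \<in> ideal_space M N. N f \<le> 1}"
    then have "ennreal \<bar>pairing M g f\<bar> \<le> N f * K g"
      using pairing_bound g by simp
    also have "\<dots> \<le> 1 * K g" using f by (intro mult_right_mono) auto
    finally show "ennreal \<bar>pairing M g f\<bar> \<le> K g" by simp
  qed
  show "K g \<le> dual_norm M N (pairing M g)"
    unfolding koethe_norm_def
  proof (rule SUP_least)
    fix f assume f: "f \<in> {f \<in> ideal_space M N. N f \<le> 1}"
    have [measurable]: "f \<in> borel_measurable M" "g \<in> borel_measurable M"
      using f g by (auto simp: ideal_space_def)
    define h where "h = (\<lambda>x. \<bar>f x\<bar> * sgn (g x))"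
    have [measurable]: "h \<in> borel_measurable M" by (simp add: h_def)
    have le: "\<bar>h x\<bar> \<le> \<bar>f x\<bar>" for x by (simp add: h_def abs_mult abs_sgn_eq)
    have hX: "h \<in> ideal_space M N"
      using f le by (intro dominated_in_space[of f h 1]) auto
    have "N h \<le> N f" using le by (intro monotone) auto
    then have h1: "N h \<le> 1" using f by auto
    have hg: "h x * g x = \<bar>f x * g x\<bar>" for x
      unfolding h_def by (metis abs_mult linordered_idom_class.abs_sgn mult.assoc mult.commute)
    have "(\<integral>\<^sup>+x. ennreal \<bar>f x * g x\<bar> \<partial>M) = ennreal (pairing M g h)"
      using koethe_integrable[OF hX g] by (simp add: pairing_def hg nn_integral_eq_integral)
    also have "\<dots> \<le> ennreal \<bar>pairing M g h\<bar>"
      by (rule ennreal_leI) simp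
    also have "\<dots> \<le> dual_norm M N (pairing M g)"
      unfolding dual_norm_def using hX h1 by (intro SUP_upper) auto
    finally show "(\<integral>\<^sup>+x. ennreal \<bar>f x * g x\<bar> \<partial>M) \<le> dual_norm M N (pairing M g)" .
  qed
qed

end

lemma dual_equals_equiv_norms:
  assumes dual: "dual_equals M X Y" and eq: "equal_spaces_equiv_norms M Y Z"
  shows "dual_equals M X Z"
proof -
  have sp: "ideal_space M Y = ideal_space M Z"
    using eq by (simp add: equal_spaces_equiv_norms_def)
  obtain c C :: real where c: "c > 0" "C > 0"
    "\<And>g. g \<in> ideal_space M Z \<Longrightarrow> ennreal c * Z g \<le> Y g \<and> Y g \<le> ennreal C * Z g"
    using eq by (auto simp: equal_spaces_equiv_norms_def)
  obtain d D :: real where d: "d > 0" "D > 0"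
    "\<And>g. g \<in> ideal_space M Y \<Longrightarrow> ennreal d * Y g \<le> dual_norm M X (pairing M g) \<and>
        dual_norm M X (pairing M g) \<le> ennreal D * Y g"
    using dual by (auto simp: dual_equals_def)
  have "ennreal (d * c) * Z g \<le> dual_norm M X (pairing M g) \<and>
      dual_norm M X (pairing M g) \<le> ennreal (D * C) * Z g" if g: "g \<in> ideal_space M Z" for g
  proof
    have "ennreal (d * c) * Z g = ennreal d * (ennreal c * Z g)"
      using c d by (simp add: ennreal_mult mult.assoc)
    also have "\<dots> \<le> ennreal d * Y g" using c(3)[OF g] by (intro mult_left_mono) auto
    also have "\<dots> \<le> dual_norm M X (pairing M g)" using d(3) g sp by auto
    finally show "ennreal (d * c) * Z g \<le> dual_norm M X (pairing M g)" .
    have "dual_norm M X (pairing M g) \<le> ennreal D * Y g" using d(3) g sp by auto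
    also have "\<dots> \<le> ennreal D * (ennreal C * Z g)" using c(3)[OF g] by (intro mult_left_mono) auto
    also have "\<dots> = ennreal (D * C) * Z g" using c d by (simp add: ennreal_mult mult.assoc)
    finally show "dual_norm M X (pairing M g) \<le> ennreal (D * C) * Z g" .
  qed
  moreover have "d * c > 0" "D * C > 0" using c d by auto
  ultimately show ?thesis
    using dual unfolding dual_equals_def sp by blast
qed

text \<open>
  Order continuity turns continuous functionals into countably additive ones.  The weak unit takes
  the part that the constant \<open>1\<close> has for a finite measure.
\<close>

locale order_continuous_ideal_norm = ideal_norm M N + sigma_finite_measure M
  for M :: "'a measure" and N :: "('a \<Rightarrow> real) \<Rightarrow> ennreal" +
  assumes order_continuous: "\<lbrakk>\<And>n. u n \<in> borel_measurable M; h \<in> ideal_space M N;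
      \<And>n x. x \<in> space M \<Longrightarrow> \<bar>u n x\<bar> \<le> h x; \<And>x. x \<in> space M \<Longrightarrow> (\<lambda>n. u n x) \<longlonglongrightarrow> 0\<rbrakk>
      \<Longrightarrow> (\<lambda>n::nat. N (u n)) \<longlonglongrightarrow> 0"
    and weak_unit: "\<exists>w\<in>ideal_space M N. \<forall>x\<in>space M. 0 < w x"
begin

text \<open>
  The bound by the norm and order continuity make \<open>m\<close> continuous at the empty set, hence a
  measure; the bound also makes it vanish on null sets, so that it has a Radon--Nikodym density.
\<close>

lemma continuous_set_function_density:
  fixes m :: "'a set \<Rightarrow> real"
  assumes w: "w \<in> ideal_space M N"
    and wpos: "\<And>x. x \<in> space M \<Longrightarrow> 0 < w x"
    and nonneg: "\<And>A. A \<in> sets M \<Longrightarrow> 0 \<le> m A"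
    and add: "\<And>A B. A \<in> sets M \<Longrightarrow> B \<in> sets M \<Longrightarrow> A \<inter> B = {} \<Longrightarrow> m (A \<union> B) = m A + m B"
    and C: "0 \<le> C" and bound: "\<And>A. A \<in> sets M \<Longrightarrow> ennreal (m A) \<le> ennreal C * N (\<lambda>x. indicator A x * w x)"
  shows "\<exists>d. integrable M d \<and> (\<forall>A\<in>sets M. (\<integral>x. indicator A x * d x \<partial>M) = m A)"
proof -
  have [measurable]: "w \<in> borel_measurable M" using w by (rule ideal_space_measurable)
  have m0: "m {} = 0" using add[of "{}" "{}"] by simp
  define Q where "Q = measure_of (space M) (sets M) (\<lambda>A. ennreal (m A))"
  have cont: "(\<lambda>i. ennreal (m (A i))) \<longlonglongrightarrow> 0"
    if A: "range A \<subseteq> sets M" "decseq A" "(\<Inter>i. A i) = {}" for A :: "nat \<Rightarrow> 'a set"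
  proof -
    have [measurable]: "A i \<in> sets M" for i using A by auto
    have "(\<lambda>i. N (\<lambda>x. indicator (A i) x * w x)) \<longlonglongrightarrow> 0"
    proof (rule order_continuous[OF _ w])
      fix n x assume "x \<in> space M"
      with wpos[OF this] show "\<bar>indicator (A n) x * w x\<bar> \<le> w x"
        by (auto simp: indicator_def)
    next
      fix x assume "x \<in> space M"
      obtain k where k: "x \<notin> A k" using A(3) by auto
      have "\<forall>\<^sub>F n in sequentially. indicator (A n) x * w x = 0"
        using eventually_ge_at_top[of k]
      proof eventually_elim
        case (elim n)
        then have "x \<notin> A n" using A(2) k by (auto simp: decseq_def)
        then show ?case by simp
      qed
      then show "(\<lambda>n. indicator (A n) x * w x) \<longlonglongrightarrow> 0"
        by (rule tendsto_eventually)
    qed auto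
    then have "(\<lambda>i. ennreal C * N (\<lambda>x. indicator (A i) x * w x)) \<longlonglongrightarrow> ennreal C * 0"
      by (intro ennreal_tendsto_cmult) auto
    then have lim: "(\<lambda>i. ennreal C * N (\<lambda>x. indicator (A i) x * w x)) \<longlonglongrightarrow> 0"
      by simp
    show ?thesis
      by (rule tendsto_sandwich[OF _ _ tendsto_const lim])
         (intro always_eventually allI bound zero_le \<open>A _ \<in> sets M\<close>)+
  qed
  have ca: "countably_additive (sets M) (\<lambda>A. ennreal (m A))"
    by (rule sets.empty_continuous_imp_countably_additive)
       (auto simp: positive_def additive_def m0 add nonneg cont)
  have Q: "emeasure Q A = ennreal (m A)" if "A \<in> sets M" for A
    unfolding Q_def using that ca
    by (subst emeasure_measure_of_sigma) (auto simp: positive_def m0 sets.sigma_algebra_axioms)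
  have setsQ: "sets Q = sets M" by (simp add: Q_def)
  have "absolutely_continuous M Q"
    unfolding absolutely_continuous_def
  proof
    fix A assume A: "A \<in> null_sets M"
    then have "N (\<lambda>x. indicator A x * w x) = 0"
      by (intro N_eq_0_AE) (auto dest: AE_not_in)
    then have "ennreal (m A) = 0" using bound[of A] A by auto
    then show "A \<in> null_sets Q" using A Q[of A] setsQ by (auto simp: null_sets_def)
  qed
  from Radon_Nikodym[OF this setsQ] obtain d
    where d[measurable]: "d \<in> borel_measurable M" and dQ: "density M d = Q" by auto
  have int: "(\<integral>\<^sup>+x. d x * indicator A x \<partial>M) = ennreal (m A)" if [measurable]: "A \<in> sets M" for A
    using Q[of A] by (simp flip: dQ add: emeasure_density)
  have "(\<integral>\<^sup>+x. d x \<partial>M) = (\<integral>\<^sup>+x. d x * indicator (space M) x \<partial>M)"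
    by (intro nn_integral_cong) auto
  then have tot: "(\<integral>\<^sup>+x. d x \<partial>M) < \<infinity>" using int[of "space M"] by simp
  then have fin: "AE x in M. d x \<noteq> \<infinity>"
    by (intro nn_integral_noteq_infinite) auto
  show ?thesis
  proof (intro exI[of _ "\<lambda>x. enn2real (d x)"] conjI ballI)
    have "(\<integral>\<^sup>+x. ennreal (norm (enn2real (d x))) \<partial>M) = (\<integral>\<^sup>+x. d x \<partial>M)"
      using fin by (intro nn_integral_cong_AE) (auto simp: less_top)
    with tot show "integrable M (\<lambda>x. enn2real (d x))"
      by (simp add: integrable_iff_bounded)
    fix A assume [measurable]: "A \<in> sets M"
    have "(\<integral>x. indicator A x * enn2real (d x) \<partial>M) = enn2real (\<integral>\<^sup>+x. ennreal (indicator A x * enn2real (d x)) \<partial>M)"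
      by (intro integral_eq_nn_integral) auto
    also have "(\<integral>\<^sup>+x. ennreal (indicator A x * enn2real (d x)) \<partial>M) = (\<integral>\<^sup>+x. d x * indicator A x \<partial>M)"
      using fin by (intro nn_integral_cong_AE) (auto simp: less_top indicator_def)
    finally show "(\<integral>x. indicator A x * enn2real (d x) \<partial>M) = m A"
      using int[of A] nonneg[of A] by simp
  qed
qed

end

section \<open>Representation of continuous functionals\<close>

context ideal_norm begin

lemma dual_bounded:
  assumes "\<phi> \<in> topological_dual M N"
  shows "\<exists>B\<ge>0. \<forall>f\<in>ideal_space M N. ennreal \<bar>\<phi> f\<bar> \<le> ennreal B * N f"
proof -
  have scale: "\<phi> (\<lambda>x. c * f x) = c * \<phi> f" if "f \<in> ideal_space M N" for c f
    using assms that by (auto simp: topological_dual_def)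
  have phi0: "\<phi> (\<lambda>x. 0) = 0"
    using scale[OF zero_in_space, of 0] by simp
  have "\<forall>f\<in>ideal_space M N. \<forall>\<epsilon>>0. \<exists>\<delta>>0. \<forall>h\<in>ideal_space M N.
        N (\<lambda>x. h x - f x) < ennreal \<delta> \<longrightarrow> \<bar>\<phi> h - \<phi> f\<bar> < \<epsilon>"
    using assms by (simp add: topological_dual_def)
  from bspec[OF this zero_in_space, rule_format, of 1]
  obtain d where d: "d > 0" "\<And>h. h \<in> ideal_space M N \<Longrightarrow> N h < ennreal d \<Longrightarrow> \<bar>\<phi> h\<bar> < 1"
    using phi0 by auto
  have "ennreal \<bar>\<phi> f\<bar> \<le> ennreal (1 / d) * N f" if f: "f \<in> ideal_space M N" for f
  proof -
    obtain s where s: "N f = ennreal s" "0 \<le> s"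
      using f by (cases "N f") (auto simp: ideal_space_def)
    have [measurable]: "f \<in> borel_measurable M" using f by (rule ideal_space_measurable)
    have "\<bar>\<phi> f\<bar> * d \<le> s + e" if e: "e > 0" for e
    proof -
      \<comment> \<open>The summand \<open>e\<close> covers functions of norm \<open>0\<close>.\<close>
      define c where "c = d / (s + e)"
      have c: "0 < c" "c * (s + e) = d" using s d(1) e by (simp_all add: c_def)
      have "0 < c * e" using c(1) e by simp
      then have lt: "c * s < d" using c(2) by (simp add: distrib_left)
      have "N (\<lambda>x. c * f x) = ennreal (c * s)"
        using c s by (simp add: homogeneous ennreal_mult)
      also have "\<dots> < ennreal d"
        using d(1) lt by (rule ennreal_lessI)
      finally have "N (\<lambda>x. c * f x) < ennreal d" .
      moreover have "(\<lambda>x. c * f x) \<in> ideal_space M N"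
        using c by (intro dominated_in_space[OF f, of _ c]) (auto simp: abs_mult)
      ultimately have "\<bar>c * \<phi> f\<bar> < 1"
        using d(2) scale[OF f, of c] by metis
      then have "c * \<bar>\<phi> f\<bar> < 1"
        using c by (simp add: abs_mult)
      then have "(s + e) * (c * \<bar>\<phi> f\<bar>) \<le> (s + e) * 1"
        using s e by (intro mult_left_mono) auto
      also have "(s + e) * (c * \<bar>\<phi> f\<bar>) = \<bar>\<phi> f\<bar> * d"
        unfolding c(2)[symmetric] by (simp only: mult_ac)
      finally show ?thesis by simp
    qed
    then have "\<bar>\<phi> f\<bar> * d \<le> s" by (rule field_le_epsilon)
    then show ?thesis
      using s d(1) by (simp add: field_simps flip: ennreal_mult)
  qed
  then show ?thesis using d(1) by (intro exI[of _ "1 / d"]) auto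
qed

end

context order_continuous_ideal_norm begin

text \<open>
  The set function \<open>\<nu> A = \<phi> (\<chi>\<^sub>A w)\<close> is additive and bounded in terms of the norm of \<open>\<chi>\<^sub>A w\<close>.  Its
  upper variation \<open>\<nu>p\<close> and \<open>\<nu>m = \<nu>p - \<nu>\<close> are nonnegative with a bound of the same kind, so both have
  densities, whose difference \<open>k\<close> represents \<open>\<phi>\<close> on the functions \<open>\<chi>\<^sub>A w\<close>.  Put \<open>g = k / w\<close>.
  Linearity and order continuity extend the formula to bounded multiples of \<open>w\<close>.  Testing it on
  truncations of \<open>|f| sgn g\<close> bounds \<open>\<integral> |f g|\<close> by the norm of \<open>f\<close>, so \<open>g\<close> lies in the Koethe dual and
  the formula passes to all \<open>f\<close>.
\<close>

lemma dual_representation: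
  assumes phi: "\<phi> \<in> topological_dual M N"
  shows "\<exists>g\<in>ideal_space M K. \<forall>f\<in>ideal_space M N. \<phi> f = pairing M g f"
proof -
  let ?X = "ideal_space M N"
  have scale: "\<phi> (\<lambda>x. c * f x) = c * \<phi> f" if "f \<in> ?X" for c f
    using phi that by (auto simp: topological_dual_def)
  have plus: "\<phi> (\<lambda>x. f x + h x) = \<phi> f + \<phi> h" if "f \<in> ?X" "h \<in> ?X" for f h
    using phi that by (auto simp: topological_dual_def)
  have phi0: "\<phi> (\<lambda>x. 0) = 0"
    using scale[OF zero_in_space, of 0] by simp
  obtain B where B: "0 \<le> B" "\<And>f. f \<in> ?X \<Longrightarrow> ennreal \<bar>\<phi> f\<bar> \<le> ennreal B * N f"
    using dual_bounded[OF phi] by auto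
  obtain w where w: "w \<in> ?X" and wpos: "\<And>x. x \<in> space M \<Longrightarrow> 0 < w x"
    using weak_unit by auto
  have [measurable]: "w \<in> borel_measurable M" using w by (rule ideal_space_measurable)

  have phi_lim: "(\<lambda>n. \<phi> (u n)) \<longlonglongrightarrow> \<phi> f"
    if f: "f \<in> ?X" and h: "h \<in> ?X" and u: "\<And>n. u n \<in> ?X"
      and bd: "\<And>n x. x \<in> space M \<Longrightarrow> \<bar>f x - u n x\<bar> \<le> h x"
      and lim: "\<And>x. x \<in> space M \<Longrightarrow> (\<lambda>n. u n x) \<longlonglongrightarrow> f x" for u f h
  proof -
    have [measurable]: "f \<in> borel_measurable M" "\<And>n. u n \<in> borel_measurable M" "h \<in> borel_measurable M"
      using f u h by (auto simp: ideal_space_def)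
    have dX: "(\<lambda>x. f x - u n x) \<in> ?X" for n
      using bd order_trans[OF bd abs_ge_self] by (intro dominated_in_space[OF h, of _ 1]) auto
    have "(\<lambda>n. N (\<lambda>x. f x - u n x)) \<longlonglongrightarrow> 0"
    proof (rule order_continuous[OF _ h bd])
      fix x assume "x \<in> space M"
      from tendsto_diff[OF tendsto_const lim[OF this], of "f x"]
      show "(\<lambda>n. f x - u n x) \<longlonglongrightarrow> 0" by simp
    qed auto
    then have "(\<lambda>n. ennreal B * N (\<lambda>x. f x - u n x)) \<longlonglongrightarrow> ennreal B * 0"
      by (intro ennreal_tendsto_cmult) auto
    then have l0: "(\<lambda>n. ennreal B * N (\<lambda>x. f x - u n x)) \<longlonglongrightarrow> 0" by simp
    have "(\<lambda>n. ennreal \<bar>\<phi> f - \<phi> (u n)\<bar>) \<longlonglongrightarrow> 0"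
    proof (rule tendsto_sandwich[OF _ _ tendsto_const l0])
      have "\<phi> f - \<phi> (u n) = \<phi> (\<lambda>x. f x - u n x)" for n
        using plus[OF u[of n] dX[of n]] by simp
      then show "\<forall>\<^sub>F n in sequentially. ennreal \<bar>\<phi> f - \<phi> (u n)\<bar> \<le> ennreal B * N (\<lambda>x. f x - u n x)"
        using B(2)[OF dX] by (intro always_eventually) simp
    qed simp
    then have "(\<lambda>n. \<bar>\<phi> f - \<phi> (u n)\<bar>) \<longlonglongrightarrow> 0"
      by (subst (asm) ennreal_0[symmetric], subst (asm) tendsto_ennreal_iff) auto
    then have "(\<lambda>n. \<phi> f - \<phi> (u n)) \<longlonglongrightarrow> 0"
      by (rule tendsto_rabs_zero_cancel)
    from tendsto_diff[OF tendsto_const this, of "\<phi> f"] show ?thesis by simp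
  qed

  have phi_cong: "\<phi> f = \<phi> h" if "f \<in> ?X" "h \<in> ?X" "\<And>x. x \<in> space M \<Longrightarrow> f x = h x" for f h
    using phi_lim[of f "\<lambda>x. 0" "\<lambda>n. h"] that LIMSEQ_const_iff[of "\<phi> h" "\<phi> f"] by auto

  have bdX: "(\<lambda>x. u x * w x) \<in> ?X"
    if "u \<in> borel_measurable M" "\<And>x. x \<in> space M \<Longrightarrow> \<bar>u x\<bar> \<le> c" for u c
    using that wpos by (intro dominated_in_space[OF w, of _ c]) (auto simp: abs_mult intro!: mult_right_mono)

  define \<nu> where "\<nu> A = \<phi> (\<lambda>x. indicator A x * w x)" for A :: "'a set"
  have indX: "(\<lambda>x. indicator A x * w x) \<in> ?X" if [measurable]: "A \<in> sets M" for A
    by (rule bdX[of _ 1]) (auto simp: indicator_def)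
  have nu_add: "\<nu> (A \<union> C) = \<nu> A + \<nu> C" if "A \<in> sets M" "C \<in> sets M" "A \<inter> C = {}" for A C
  proof -
    have "(\<lambda>x. indicator (A \<union> C) x * w x) = (\<lambda>x. indicator A x * w x + indicator C x * w x)"
      using that(3) by (auto simp: indicator_def fun_eq_iff)
    then show ?thesis
      unfolding \<nu>_def using plus[OF indX[OF that(1)] indX[OF that(2)]] by simp
  qed
  have nu_le: "ennreal \<bar>\<nu> C\<bar> \<le> ennreal B * N (\<lambda>x. indicator A x * w x)"
    if AC: "A \<in> sets M" "C \<in> sets M" "C \<subseteq> A" for A C
  proof -
    have "ennreal \<bar>\<nu> C\<bar> \<le> ennreal B * N (\<lambda>x. indicator C x * w x)"
      unfolding \<nu>_def by (rule B(2)[OF indX[OF AC(2)]])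
    also have "\<dots> \<le> ennreal B * N (\<lambda>x. indicator A x * w x)"
      using indX[OF AC(1)] indX[OF AC(2)] AC(3)
      by (intro mult_left_mono monotone) (auto simp: ideal_space_def indicator_def)
    finally show ?thesis .
  qed
  define \<nu>p where "\<nu>p A = (SUP C\<in>{C\<in>sets M. C \<subseteq> A}. \<nu> C)" for A
  have bdd: "bdd_above (\<nu> ` {C\<in>sets M. C \<subseteq> A})" if "A \<in> sets M" for A
  proof -
    have fin: "ennreal B * N (\<lambda>x. indicator A x * w x) < \<infinity>"
      using indX[OF that] by (auto simp: ideal_space_def ennreal_mult_less_top)
    show ?thesis
    proof (rule bdd_aboveI2)
      fix C assume C: "C \<in> {C\<in>sets M. C \<subseteq> A}"
      have "ennreal \<bar>\<nu> C\<bar> \<le> ennreal (enn2real (ennreal B * N (\<lambda>x. indicator A x * w x)))"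
        using nu_le[of A C] C that fin by simp
      then show "\<nu> C \<le> enn2real (ennreal B * N (\<lambda>x. indicator A x * w x))"
        by (subst (asm) ennreal_le_iff) auto
    qed
  qed
  have nup_upper: "\<nu> C \<le> \<nu>p A" if "A \<in> sets M" "C \<in> sets M" "C \<subseteq> A" for A C
    unfolding \<nu>p_def using that by (intro cSUP_upper bdd) auto
  have nup_least: "\<nu>p A \<le> z" if "\<And>C. C \<in> sets M \<Longrightarrow> C \<subseteq> A \<Longrightarrow> \<nu> C \<le> z" for A z
    unfolding \<nu>p_def using that by (intro cSUP_least) auto
  have nu0: "\<nu> {} = 0" by (simp add: \<nu>_def phi0)
  have nup_nonneg: "0 \<le> \<nu>p A" if "A \<in> sets M" for A
    using nup_upper[OF that, of "{}"] nu0 by simp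
  have nup_add: "\<nu>p (A \<union> C) = \<nu>p A + \<nu>p C"
    if AC: "A \<in> sets M" "C \<in> sets M" "A \<inter> C = {}" for A C
  proof (rule antisym)
    show "\<nu>p (A \<union> C) \<le> \<nu>p A + \<nu>p C"
    proof (rule nup_least)
      fix D assume D: "D \<in> sets M" "D \<subseteq> A \<union> C"
      have "\<nu> D = \<nu> ((D \<inter> A) \<union> (D \<inter> C))"
        using D(2) by (intro arg_cong[where f = \<nu>]) auto
      also have "\<dots> = \<nu> (D \<inter> A) + \<nu> (D \<inter> C)"
        using AC D by (intro nu_add) auto
      also have "\<dots> \<le> \<nu>p A + \<nu>p C"
        using AC D by (intro add_mono nup_upper) auto
      finally show "\<nu> D \<le> \<nu>p A + \<nu>p C" .
    qed
    have "\<nu> D + \<nu> E \<le> \<nu>p (A \<union> C)" if "D \<in> sets M" "D \<subseteq> A" "E \<in> sets M" "E \<subseteq> C" for D E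
    proof -
      have "\<nu> (D \<union> E) = \<nu> D + \<nu> E" using that AC by (intro nu_add) auto
      moreover have "\<nu> (D \<union> E) \<le> \<nu>p (A \<union> C)" using that AC by (intro nup_upper) auto
      ultimately show ?thesis by simp
    qed
    then have "\<nu> D \<le> \<nu>p (A \<union> C) - \<nu> E" if "D \<in> sets M" "D \<subseteq> A" "E \<in> sets M" "E \<subseteq> C" for D E
      using that by (simp add: algebra_simps)
    then have "\<nu>p A \<le> \<nu>p (A \<union> C) - \<nu> E" if "E \<in> sets M" "E \<subseteq> C" for E
      using that by (intro nup_least) auto
    then have "\<nu>p C \<le> \<nu>p (A \<union> C) - \<nu>p A"
      by (intro nup_least) (simp add: algebra_simps)
    then show "\<nu>p A + \<nu>p C \<le> \<nu>p (A \<union> C)" by simp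
  qed
  have nup_le: "ennreal (\<nu>p A) \<le> ennreal B * N (\<lambda>x. indicator A x * w x)" if A: "A \<in> sets M" for A
  proof -
    have fin: "ennreal B * N (\<lambda>x. indicator A x * w x) < \<infinity>"
      using indX[OF A] by (auto simp: ideal_space_def ennreal_mult_less_top)
    have "\<nu>p A \<le> enn2real (ennreal B * N (\<lambda>x. indicator A x * w x))"
    proof (rule nup_least)
      fix C assume "C \<in> sets M" "C \<subseteq> A"
      then have "ennreal \<bar>\<nu> C\<bar> \<le> ennreal (enn2real (ennreal B * N (\<lambda>x. indicator A x * w x)))"
        using nu_le[of A C] A fin by simp
      then show "\<nu> C \<le> enn2real (ennreal B * N (\<lambda>x. indicator A x * w x))"
        by (subst (asm) ennreal_le_iff) auto
    qed
    then have "ennreal (\<nu>p A) \<le> ennreal (enn2real (ennreal B * N (\<lambda>x. indicator A x * w x)))"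
      by (rule ennreal_leI)
    also have "\<dots> = ennreal B * N (\<lambda>x. indicator A x * w x)" using fin by simp
    finally show ?thesis .
  qed
  have "\<exists>d. integrable M d \<and> (\<forall>A\<in>sets M. (\<integral>x. indicator A x * d x \<partial>M) = \<nu>p A)"
    by (rule continuous_set_function_density[OF w wpos nup_nonneg nup_add B(1) nup_le])
  then obtain dp where dp: "integrable M dp" "\<And>A. A \<in> sets M \<Longrightarrow> (\<integral>x. indicator A x * dp x \<partial>M) = \<nu>p A"
    by blast
  define \<nu>m where "\<nu>m A = \<nu>p A - \<nu> A" for A
  have num_le: "ennreal (\<nu>m A) \<le> ennreal (2 * B) * N (\<lambda>x. indicator A x * w x)" if A: "A \<in> sets M" for A
  proof -
    have "ennreal (\<nu>m A) \<le> ennreal (\<nu>p A + \<bar>\<nu> A\<bar>)"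
      by (rule ennreal_leI) (simp add: \<nu>m_def)
    also have "\<dots> = ennreal (\<nu>p A) + ennreal \<bar>\<nu> A\<bar>"
      using nup_nonneg[OF A] by simp
    also have "\<dots> \<le> ennreal B * N (\<lambda>x. indicator A x * w x) + ennreal B * N (\<lambda>x. indicator A x * w x)"
      using A by (intro add_mono nup_le nu_le) auto
    also have "\<dots> = ennreal (2 * B) * N (\<lambda>x. indicator A x * w x)"
      using ennreal_plus[OF B(1) B(1)] by (simp only: distrib_right mult_2)
    finally show ?thesis .
  qed
  have "\<exists>d. integrable M d \<and> (\<forall>A\<in>sets M. (\<integral>x. indicator A x * d x \<partial>M) = \<nu>m A)"
  proof (rule continuous_set_function_density[OF w wpos _ _ _ num_le])
    show "0 \<le> \<nu>m A" if "A \<in> sets M" for A using nup_upper[OF that that] by (simp add: \<nu>m_def)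
    show "\<nu>m (A \<union> C) = \<nu>m A + \<nu>m C" if "A \<in> sets M" "C \<in> sets M" "A \<inter> C = {}" for A C
      using that by (simp add: \<nu>m_def nup_add nu_add)
    show "0 \<le> 2 * B" using B(1) by simp
  qed
  then obtain dm where dm: "integrable M dm" "\<And>A. A \<in> sets M \<Longrightarrow> (\<integral>x. indicator A x * dm x \<partial>M) = \<nu>m A"
    by blast
  define k where "k x = dp x - dm x" for x
  have k_int: "integrable M k" using dp dm by (simp add: k_def[abs_def])
  then have [measurable]: "k \<in> borel_measurable M" by (rule borel_measurable_integrable)
  have bd_int: "integrable M (\<lambda>x. u x * k x)"
    if "u \<in> borel_measurable M" "\<And>x. x \<in> space M \<Longrightarrow> \<bar>u x\<bar> \<le> c" for u c
  proof (rule Bochner_Integration.integrable_bound[OF integrable_mult_right[OF k_int, of c]])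
    show "AE x in M. norm (u x * k x) \<le> norm (c * k x)"
    proof (rule AE_I2)
      fix x assume x: "x \<in> space M"
      have "\<bar>u x\<bar> * \<bar>k x\<bar> \<le> \<bar>c\<bar> * \<bar>k x\<bar>"
        using that(2)[OF x] by (intro mult_right_mono) auto
      then show "norm (u x * k x) \<le> norm (c * k x)" by (simp add: abs_mult)
    qed
  qed (use that in measurable)
  have ind_int: "integrable M (\<lambda>x. indicator A x * d x)" if "A \<in> sets M" "integrable M d"
    for A and d :: "'a \<Rightarrow> real"
    using integrable_mult_indicator[OF that] by simp
  have nu_k: "\<nu> A = (\<integral>x. indicator A x * k x \<partial>M)" if "A \<in> sets M" for A
    using dp(2)[OF that] dm(2)[OF that] ind_int[OF that dp(1)] ind_int[OF that dm(1)]
    by (simp add: k_def \<nu>m_def right_diff_distrib)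

  have phi_simple: "\<phi> (\<lambda>x. s x * w x) = (\<integral>x. s x * k x \<partial>M)" if s: "simple_function M s" for s :: "'a \<Rightarrow> real"
  proof -
    define S where "S y = s -` {y} \<inter> space M" for y
    have A: "S y \<in> sets M" for y unfolding S_def using s by (rule simple_functionD)
    have fin: "finite (s ` space M)" using s by (rule simple_functionD)
    have sum_in: "(\<lambda>x. (\<Sum>y\<in>F. y * indicator (S y) x) * w x) \<in> ?X" if "finite F" for F
    proof (rule bdX)
      show "\<bar>\<Sum>y\<in>F. y * indicator (S y) x\<bar> \<le> (\<Sum>y\<in>F. \<bar>y\<bar>)" for x
        by (rule order_trans[OF sum_abs]) (intro sum_mono, auto simp: indicator_def)
      show "(\<lambda>x. \<Sum>y\<in>F. y * indicator (S y) x) \<in> borel_measurable M"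
        using A by measurable
    qed
    have sums: "\<phi> (\<lambda>x. (\<Sum>y\<in>F. y * indicator (S y) x) * w x) = (\<Sum>y\<in>F. y * \<nu> (S y))" if "finite F" for F
      using that
    proof (induction F)
      case empty
      show ?case by (simp add: phi0)
    next
      case (insert z F)
      have zX: "(\<lambda>x. z * (indicator (S z) x * w x)) \<in> ?X"
        by (rule dominated_in_space[OF indX[OF A[of z]], of _ "\<bar>z\<bar>"])
           (use A in \<open>simp_all add: abs_mult\<close>)
      have "(\<lambda>x. (\<Sum>y\<in>insert z F. y * indicator (S y) x) * w x)
        = (\<lambda>x. z * (indicator (S z) x * w x) + (\<Sum>y\<in>F. y * indicator (S y) x) * w x)"
        by (simp only: sum.insert[OF insert.hyps] distrib_right mult.assoc)
      then have "\<phi> (\<lambda>x. (\<Sum>y\<in>insert z F. y * indicator (S y) x) * w x)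
        = z * \<nu> (S z) + (\<Sum>y\<in>F. y * \<nu> (S y))"
        using plus[OF zX sum_in[OF insert.hyps(1)]] scale[OF indX[OF A[of z]], of z] insert.IH
        by (simp add: \<nu>_def)
      then show ?case using insert.hyps by simp
    qed
    have rep: "s x = (\<Sum>y\<in>s ` space M. y * indicator (S y) x)" if "x \<in> space M" for x
    proof -
      have "(\<Sum>y\<in>s ` space M. y * indicator (S y) x) = (\<Sum>y\<in>s ` space M. if y = s x then y else 0)"
        using that by (intro sum.cong) (auto simp: indicator_def S_def)
      then show ?thesis using that fin by simp
    qed
    have sX: "(\<lambda>x. s x * w x) \<in> ?X"
    proof (rule bdX)
      show "\<bar>s x\<bar> \<le> (\<Sum>y\<in>s ` space M. \<bar>y\<bar>)" if "x \<in> space M" for x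
        using that fin by (intro member_le_sum) auto
    qed (use s in \<open>rule borel_measurable_simple_function\<close>)
    have "\<phi> (\<lambda>x. s x * w x) = (\<Sum>y\<in>s ` space M. y * \<nu> (S y))"
      unfolding sums[OF fin, symmetric] by (rule phi_cong[OF sX sum_in[OF fin]]) (metis rep)
    also have "\<dots> = (\<Sum>y\<in>s ` space M. \<integral>x. y * (indicator (S y) x * k x) \<partial>M)"
      by (simp add: nu_k[OF A])
    also have "\<dots> = (\<integral>x. (\<Sum>y\<in>s ` space M. y * (indicator (S y) x * k x)) \<partial>M)"
      using ind_int[OF A k_int] by (intro Bochner_Integration.integral_sum[symmetric]) auto
    also have "\<dots> = (\<integral>x. s x * k x \<partial>M)"
      by (intro Bochner_Integration.integral_cong refl, subst rep) (simp_all add: sum_distrib_right mult.assoc)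
    finally show ?thesis .
  qed

  have phi_bounded: "\<phi> (\<lambda>x. u x * w x) = (\<integral>x. u x * k x \<partial>M)"
    if u[measurable]: "u \<in> borel_measurable M" and uc: "\<And>x. x \<in> space M \<Longrightarrow> \<bar>u x\<bar> \<le> c" for u c
  proof -
    obtain F where F: "\<And>i. simple_function M (F i)" "\<And>x. x \<in> space M \<Longrightarrow> (\<lambda>i. F i x) \<longlonglongrightarrow> u x"
      "\<And>i x. x \<in> space M \<Longrightarrow> dist (F i x) 0 \<le> 2 * dist (u x) 0"
      using borel_measurable_implies_sequence_metric[OF u, of 0] by blast
    have [measurable]: "F i \<in> borel_measurable M" for i
      using F(1) by (rule borel_measurable_simple_function)
    have Fc: "\<bar>F i x\<bar> \<le> 2 * c" if "x \<in> space M" for i x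
      using F(3)[OF that, of i] uc[OF that] by simp
    have "(\<lambda>i. \<phi> (\<lambda>x. F i x * w x)) \<longlonglongrightarrow> \<phi> (\<lambda>x. u x * w x)"
    proof (rule phi_lim[where h = "\<lambda>x. 3 * c * w x"])
      show "(\<lambda>x. u x * w x) \<in> ?X" by (rule bdX[OF u]) (rule uc)
      show "(\<lambda>x. F i x * w x) \<in> ?X" for i by (rule bdX) (auto intro: Fc)
      show "(\<lambda>x. (3 * c) * w x) \<in> ?X" by (rule bdX[of _ "\<bar>3 * c\<bar>"]) auto
      fix x assume x: "x \<in> space M"
      show "(\<lambda>i. F i x * w x) \<longlonglongrightarrow> u x * w x"
        by (rule tendsto_mult_right[OF F(2)[OF x]])
      fix i
      have "\<bar>u x - F i x\<bar> * w x \<le> (3 * c) * w x"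
        using Fc[OF x, of i] uc[OF x] wpos[OF x] by (intro mult_right_mono) auto
      then show "\<bar>u x * w x - F i x * w x\<bar> \<le> 3 * c * w x"
        using wpos[OF x] by (simp add: left_diff_distrib[symmetric] abs_mult)
    qed
    moreover have "(\<lambda>i. \<integral>x. F i x * k x \<partial>M) \<longlonglongrightarrow> (\<integral>x. u x * k x \<partial>M)"
    proof (rule integral_dominated_convergence[where w = "\<lambda>x. (2 * c) * \<bar>k x\<bar>"])
      show "integrable M (\<lambda>x. 2 * c * \<bar>k x\<bar>)"
        using k_int by auto
      show "AE x in M. (\<lambda>i. F i x * k x) \<longlonglongrightarrow> u x * k x"
        by (intro AE_I2 tendsto_mult_right F)
      show "AE x in M. norm (F i x * k x) \<le> 2 * c * \<bar>k x\<bar>" for i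
        using Fc by (intro AE_I2) (auto simp: abs_mult intro!: mult_right_mono)
    qed auto
    ultimately show ?thesis
      using phi_simple[OF F(1)] by (simp add: LIMSEQ_unique)
  qed

  define g where "g x = k x / w x" for x
  have [measurable]: "g \<in> borel_measurable M" by (simp add: g_def[abs_def])
  have gw: "g x * w x = k x" if "x \<in> space M" for x
    using wpos[OF that] by (simp add: g_def)
  \<comment> \<open>Truncations are bounded multiples of \<open>w\<close>, for which the representation is already known.\<close>
  define T where "T f n x = (if \<bar>f x\<bar> \<le> real n * w x then f x else 0)" for f n x
  have T_meas[measurable]: "T f n \<in> borel_measurable M" if [measurable]: "f \<in> borel_measurable M" for f n
    unfolding T_def[abs_def] by measurable
  have T_bd: "\<bar>T f n x / w x\<bar> \<le> real n" if "x \<in> space M" for f n x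
    using wpos[OF that] by (auto simp: T_def field_simps)
  have phi_T: "T f n \<in> ?X" "\<phi> (T f n) = (\<integral>x. T f n x * g x \<partial>M)" "integrable M (\<lambda>x. T f n x * g x)"
    if f: "f \<in> ?X" for f n
  proof -
    have [measurable]: "f \<in> borel_measurable M" using f by (rule ideal_space_measurable)
    show TX: "T f n \<in> ?X"
      by (rule dominated_in_space[OF f, of _ 1]) (auto simp: T_def)
    have uX: "(\<lambda>x. T f n x / w x * w x) \<in> ?X"
      by (rule bdX[OF _ T_bd]) auto
    have "\<phi> (T f n) = \<phi> (\<lambda>x. T f n x / w x * w x)"
      using wpos by (intro phi_cong TX uX) (auto dest!: wpos)
    also have "\<dots> = (\<integral>x. T f n x / w x * k x \<partial>M)"
      by (rule phi_bounded[OF _ T_bd]) auto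
    finally show "\<phi> (T f n) = (\<integral>x. T f n x * g x \<partial>M)"
      by (simp add: g_def)
    have "integrable M (\<lambda>x. T f n x / w x * k x)"
      by (rule bd_int[OF _ T_bd]) auto
    then show "integrable M (\<lambda>x. T f n x * g x)" by (simp add: g_def)
  qed
  have T_lim: "(\<lambda>n. T f n x) \<longlonglongrightarrow> f x" if x: "x \<in> space M" for f x
  proof -
    obtain n0 where n0: "\<bar>f x\<bar> < real n0 * w x"
      using reals_Archimedean3[OF wpos[OF x]] by blast
    have "\<forall>\<^sub>F n in sequentially. T f n x = f x"
      using eventually_ge_at_top[of n0]
    proof eventually_elim
      case (elim n)
      then have "real n0 * w x \<le> real n * w x"
        using wpos[OF x] by (intro mult_right_mono) auto
      with n0 show ?case by (simp add: T_def)
    qed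
    then show ?thesis by (rule tendsto_eventually)
  qed

  have bound: "(\<integral>\<^sup>+x. ennreal \<bar>f x * g x\<bar> \<partial>M) \<le> ennreal B * N f" if f: "f \<in> ?X" for f
  proof -
    have [measurable]: "f \<in> borel_measurable M" using f by (rule ideal_space_measurable)
    define h where "h = (\<lambda>x. \<bar>f x\<bar> * sgn (g x))"
    have [measurable]: "h \<in> borel_measurable M" by (simp add: h_def)
    have hle: "\<bar>h x\<bar> \<le> \<bar>f x\<bar>" for x by (simp add: h_def abs_mult abs_sgn_eq)
    have hX: "h \<in> ?X" using f hle by (intro dominated_in_space[of f h 1]) auto
    have hg: "h x * g x = \<bar>f x * g x\<bar>" for x
      unfolding h_def by (metis abs_mult linordered_idom_class.abs_sgn mult.assoc mult.commute)
    have Tg: "0 \<le> T h n x * g x" for n x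
      using hg[of x] by (auto simp: T_def)
    have "(\<integral>\<^sup>+x. ennreal (h x * g x) \<partial>M) = (\<integral>\<^sup>+x. liminf (\<lambda>n. ennreal (T h n x * g x)) \<partial>M)"
    proof (intro nn_integral_cong)
      fix x assume "x \<in> space M"
      then have "(\<lambda>n. ennreal (T h n x * g x)) \<longlonglongrightarrow> ennreal (h x * g x)"
        by (intro tendsto_ennrealI tendsto_mult_right T_lim)
      then show "ennreal (h x * g x) = liminf (\<lambda>n. ennreal (T h n x * g x))"
        by (intro lim_imp_Liminf[symmetric]) auto
    qed
    also have "\<dots> \<le> liminf (\<lambda>n. \<integral>\<^sup>+x. ennreal (T h n x * g x) \<partial>M)"
      by (intro nn_integral_liminf) auto
    also have "\<dots> \<le> liminf (\<lambda>n::nat. ennreal B * N f)"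
    proof (intro Liminf_mono always_eventually allI)
      fix n
      have "(\<integral>\<^sup>+x. ennreal (T h n x * g x) \<partial>M) = ennreal (\<phi> (T h n))"
        using phi_T[OF hX, of n] Tg by (simp add: nn_integral_eq_integral)
      also have "\<dots> \<le> ennreal \<bar>\<phi> (T h n)\<bar>" by (rule ennreal_leI) simp
      also have "\<dots> \<le> ennreal B * N (T h n)" by (rule B(2)[OF phi_T(1)[OF hX]])
      also have "\<dots> \<le> ennreal B * N f"
        using hle by (intro mult_left_mono monotone) (auto simp: T_def)
      finally show "(\<integral>\<^sup>+x. ennreal (T h n x * g x) \<partial>M) \<le> ennreal B * N f" .
    qed
    also have "\<dots> = ennreal B * N f"
      by (intro lim_imp_Liminf) auto
    finally show ?thesis by (simp add: hg)
  qed
  have "K g \<le> ennreal B"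
    unfolding koethe_norm_def
  proof (rule SUP_least)
    fix f assume f: "f \<in> {f \<in> ideal_space M N. N f \<le> 1}"
    then have "(\<integral>\<^sup>+x. ennreal \<bar>f x * g x\<bar> \<partial>M) \<le> ennreal B * N f" using bound by auto
    also have "\<dots> \<le> ennreal B * 1" using f by (intro mult_left_mono) auto
    finally show "(\<integral>\<^sup>+x. ennreal \<bar>f x * g x\<bar> \<partial>M) \<le> ennreal B" by simp
  qed
  then have "K g < \<infinity>" by (rule order.strict_trans1) simp
  then have gK: "g \<in> ideal_space M K" by (simp add: ideal_space_def)
  have "\<phi> f = pairing M g f" if f: "f \<in> ?X" for f
  proof -
    have [measurable]: "f \<in> borel_measurable M" using f by (rule ideal_space_measurable)
    have "(\<lambda>n. \<phi> (T f n)) \<longlonglongrightarrow> \<phi> f"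
    proof (rule phi_lim[where h = "\<lambda>x. \<bar>f x\<bar>", OF f _ phi_T(1)[OF f] _ T_lim])
      show "(\<lambda>x. \<bar>f x\<bar>) \<in> ?X" by (rule dominated_in_space[OF f, of _ 1]) auto
    qed (auto simp: T_def)
    moreover have "(\<lambda>n. \<integral>x. T f n x * g x \<partial>M) \<longlonglongrightarrow> (\<integral>x. f x * g x \<partial>M)"
    proof (rule integral_dominated_convergence[where w = "\<lambda>x. \<bar>f x * g x\<bar>"])
      show "integrable M (\<lambda>x. \<bar>f x * g x\<bar>)"
        using koethe_integrable[OF f gK] by (rule integrable_abs)
      show "AE x in M. (\<lambda>n. T f n x * g x) \<longlonglongrightarrow> f x * g x"
        by (intro AE_I2 tendsto_mult_right T_lim)
      show "AE x in M. norm (T f n x * g x) \<le> \<bar>f x * g x\<bar>" for n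
        by (intro AE_I2) (auto simp: T_def)
    qed auto
    ultimately show ?thesis
      using phi_T(2)[OF f] by (simp add: pairing_def LIMSEQ_unique)
  qed
  with gK show ?thesis by blast
qed

text \<open>
  By \<open>dual_norm_pairing\<close> both constants can be taken to be \<open>1\<close>.  The function \<open>g\<close> is determined by its
  functional because \<open>sgn (g - h) w\<close> is an admissible test function.
\<close>

theorem dual_equals_koethe: "dual_equals M N K"
  unfolding dual_equals_def
proof (intro conjI ballI impI)
  fix g assume g: "g \<in> ideal_space M K"
  show "pairing M g \<in> topological_dual M N" by (rule pairing_in_dual[OF g])
  show "integrable M (\<lambda>x. f x * g x)" if "f \<in> ideal_space M N" for f
    by (rule koethe_integrable[OF that g])
next
  fix g h assume gh: "g \<in> ideal_space M K" "h \<in> ideal_space M K"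
    and eq: "\<forall>f\<in>ideal_space M N. pairing M g f = pairing M h f"
  have [measurable]: "g \<in> borel_measurable M" "h \<in> borel_measurable M"
    using gh by (auto simp: ideal_space_def)
  obtain w where w: "w \<in> ideal_space M N" and wpos: "\<And>x. x \<in> space M \<Longrightarrow> 0 < w x"
    using weak_unit by auto
  have [measurable]: "w \<in> borel_measurable M" using w by (rule ideal_space_measurable)
  define f where "f = (\<lambda>x. sgn (g x - h x) * w x)"
  have f: "f \<in> ideal_space M N"
    by (rule dominated_in_space[OF w, of _ 1]) (auto simp: f_def abs_mult abs_sgn_eq)
  have e: "f x * g x - f x * h x = \<bar>g x - h x\<bar> * w x" for x
    by (simp only: f_def linordered_idom_class.abs_sgn left_diff_distrib right_diff_distrib mult_ac)
  have int: "integrable M (\<lambda>x. \<bar>g x - h x\<bar> * w x)"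
    using Bochner_Integration.integrable_diff[OF koethe_integrable[OF f gh(1)] koethe_integrable[OF f gh(2)]]
    by (simp add: e)
  have "(\<integral>x. \<bar>g x - h x\<bar> * w x \<partial>M) = pairing M g f - pairing M h f"
    using koethe_integrable[OF f gh(1)] koethe_integrable[OF f gh(2)]
    by (simp add: pairing_def flip: e)
  then have "(\<integral>x. \<bar>g x - h x\<bar> * w x \<partial>M) = 0"
    using eq f by simp
  moreover have "AE x in M. 0 \<le> \<bar>g x - h x\<bar> * w x"
    by (intro AE_I2 mult_nonneg_nonneg) (auto simp: less_imp_le wpos)
  ultimately have "AE x in M. \<bar>g x - h x\<bar> * w x = 0"
    using integral_nonneg_eq_0_iff_AE[OF int] by blast
  then show "AE x in M. g x = h x"
    by (rule AE_mp) (auto intro!: AE_I2 dest: wpos)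
next
  fix \<phi> assume "\<phi> \<in> topological_dual M N"
  then show "\<exists>g\<in>ideal_space M K. \<forall>f\<in>ideal_space M N. \<phi> f = pairing M g f"
    by (rule dual_representation)
next
  show "\<exists>c C :: real. c > 0 \<and> C > 0 \<and> (\<forall>g\<in>ideal_space M K.
        ennreal c * K g \<le> dual_norm M N (pairing M g) \<and>
        dual_norm M N (pairing M g) \<le> ennreal C * K g)"
    by (intro exI[of _ 1]) (auto simp: dual_norm_pairing)
qed

end

section \<open>Decreasing rearrangements\<close>

definition distribution :: "'a measure \<Rightarrow> ('a \<Rightarrow> real) \<Rightarrow> real \<Rightarrow> ennreal" where
  "distribution M f l = emeasure M {x \<in> space M. l < \<bar>f x\<bar>}"

lemma ennreal_layer: "(\<integral>\<^sup>+l\<in>{0..}. indicator {l. ennreal l < x} l \<partial>lborel) = x"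
proof (cases x)
  case (real r)
  have "(\<integral>\<^sup>+l\<in>{0..}. indicator {l. ennreal l < x} l \<partial>lborel) = (\<integral>\<^sup>+l. indicator {0..<r} l \<partial>lborel)"
    using real by (intro nn_integral_cong) (auto simp: indicator_def ennreal_less_iff)
  then show ?thesis using real by simp
next
  case top
  have "(\<integral>\<^sup>+l\<in>{0..}. indicator {l. ennreal l < x} l \<partial>lborel) = (\<integral>\<^sup>+l. indicator {0::real..} l \<partial>lborel)"
    using top by (intro nn_integral_cong) (auto simp: indicator_def)
  moreover have "emeasure lborel {0::real..} = top"
  proof (rule ccontr)
    assume "emeasure lborel {0::real..} \<noteq> top"
    then obtain n :: nat where "emeasure lborel {0::real..} < of_nat n"
      using ennreal_Ex_less_of_nat by (auto simp: less_top)
    moreover have "emeasure lborel {0..real n} \<le> emeasure lborel {0::real..}"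
      by (intro emeasure_mono) auto
    ultimately show False by (simp add: ennreal_of_nat_eq_real_of_nat)
  qed
  ultimately show ?thesis using top by simp
qed

lemma ennreal_eq_of_less_iff:
  assumes "\<And>l. 0 \<le> l \<Longrightarrow> ennreal l < x \<longleftrightarrow> ennreal l < y"
  shows "x = y"
proof -
  have "(\<integral>\<^sup>+l\<in>{0..}. indicator {l. ennreal l < x} l \<partial>lborel) = (\<integral>\<^sup>+l\<in>{0..}. indicator {l. ennreal l < y} l \<partial>lborel)"
    using assms by (intro nn_integral_cong) (auto simp: indicator_def)
  then show ?thesis by (simp only: ennreal_layer)
qed

lemma ennreal_le_of_less:
  assumes "\<And>l. 0 \<le> l \<Longrightarrow> ennreal l < x \<Longrightarrow> ennreal l \<le> y"
  shows "x \<le> y"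
proof (rule dense_le)
  fix z assume "z < x"
  then have "z < top" using less_le_trans top_greatest by blast
  then obtain l where "z = ennreal l" "0 \<le> l" by (cases z) auto
  with assms \<open>z < x\<close> show "z \<le> y" by auto
qed

lemma borel_measurable_antimono_ennreal:
  fixes f :: "real \<Rightarrow> ennreal"
  assumes "antimono f"
  shows "f \<in> borel_measurable borel"
proof (rule borel_measurableI_greater)
  fix y
  have "is_interval {x \<in> space borel. y < f x}"
    using assms by (auto simp: is_interval_def antimono_def dest: order.strict_trans2)
  then show "{x \<in> space borel. y < f x} \<in> sets borel"
    by (rule real_interval_borel_measurable)
qed

lemma antimono_distribution: "f \<in> borel_measurable M \<Longrightarrow> antimono (distribution M f)"
  unfolding distribution_def by (intro antimonoI emeasure_mono) auto

lemma borel_measurable_distribution [measurable]: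
  assumes [measurable]: "f \<in> borel_measurable M" "h \<in> borel_measurable N"
  shows "(\<lambda>x. distribution M f (h x)) \<in> borel_measurable N"
  by (rule measurable_compose[OF assms(2)], rule borel_measurable_antimono_ennreal)
     (rule antimono_distribution[OF assms(1)])

text \<open>
  This Galois connection reduces statements on \<open>f\<^sup>*\<close> to statements on level sets.  From right to
  left it expresses right continuity of the distribution function, that is, continuity of the measure
  from below.
\<close>

lemma rearrangement_greater_iff:
  assumes [measurable]: "f \<in> borel_measurable M" and l: "0 \<le> l"
  shows "ennreal l < rearrangement M f t \<longleftrightarrow> ennreal t < distribution M f l"
proof
  assume less: "ennreal l < rearrangement M f t"
  show "ennreal t < distribution M f l"
  proof (rule ccontr)
    assume "\<not> ?thesis"
    then have le: "distribution M f l \<le> ennreal t" by simp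
    have "rearrangement M f t \<le> ennreal m" if "l < m" for m
    proof -
      have "distribution M f m \<le> ennreal t"
        using antimonoD[OF antimono_distribution[OF assms(1)], of l m] that le by simp
      then show ?thesis
        unfolding rearrangement_def using that l
        by (intro Inf_lower) (auto simp: distribution_def)
    qed
    moreover obtain m where "l < m" "ennreal m < rearrangement M f t"
    proof -
      obtain z where z: "ennreal l < z" "z < rearrangement M f t"
        using dense[OF less] by auto
      then have "z < top" using less_le_trans top_greatest by blast
      then obtain m where "z = ennreal m" "0 \<le> m" by (cases z) auto
      then show ?thesis using z that[of m] l by (auto simp: ennreal_less_iff)
    qed
    ultimately show False by (simp add: leD)
  qed
next
  assume less: "ennreal t < distribution M f l"
  let ?A = "\<lambda>n::nat. {x \<in> space M. l + 1 / Suc n < \<bar>f x\<bar>}"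
  have "(\<Union>n. ?A n) = {x \<in> space M. l < \<bar>f x\<bar>}"
  proof (intro set_eqI iffI)
    fix x assume "x \<in> {x \<in> space M. l < \<bar>f x\<bar>}"
    then show "x \<in> (\<Union>n. ?A n)"
      using nat_approx_posE[of "\<bar>f x\<bar> - l"] by (auto simp: algebra_simps)
  next
    fix x assume "x \<in> (\<Union>n. ?A n)"
    then obtain n where "x \<in> space M" "l + 1 / Suc n < \<bar>f x\<bar>" by auto
    moreover have "0 < 1 / real (Suc n)" by simp
    ultimately have "x \<in> space M" "l < \<bar>f x\<bar>" by linarith+
    then show "x \<in> {x \<in> space M. l < \<bar>f x\<bar>}" by simp
  qed
  moreover have "(SUP n. emeasure M (?A n)) = emeasure M (\<Union>n. ?A n)"
  proof (rule SUP_emeasure_incseq)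
    show "incseq ?A"
    proof (intro incseq_SucI subsetI)
      fix n x assume "x \<in> ?A n"
      moreover have "1 / real (Suc (Suc n)) \<le> 1 / real (Suc n)"
        by (simp add: field_simps)
      ultimately show "x \<in> ?A (Suc n)" by (auto simp del: of_nat_Suc)
    qed
  qed auto
  ultimately have "ennreal t < (SUP n. emeasure M (?A n))"
    using less by (simp add: distribution_def)
  then obtain n where n: "ennreal t < distribution M f (l + 1 / Suc n)"
    by (auto simp: less_SUP_iff distribution_def)
  have "ennreal (l + 1 / Suc n) \<le> rearrangement M f t"
    unfolding rearrangement_def
  proof (rule Inf_greatest)
    fix z assume "z \<in> {ennreal m |m. 0 < m \<and> emeasure M {x \<in> space M. m < \<bar>f x\<bar>} \<le> ennreal t}"
    then obtain m where m: "z = ennreal m" "0 < m" "distribution M f m \<le> ennreal t"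
      by (auto simp: distribution_def)
    then have "distribution M f m < distribution M f (l + 1 / Suc n)"
      using n by (rule_tac order.strict_trans1)
    then have "\<not> m \<le> l + 1 / Suc n"
      using antimonoD[OF antimono_distribution[OF assms(1)], of m "l + 1 / Suc n"] by auto
    then show "ennreal (l + 1 / Suc n) \<le> z"
      unfolding m by (intro ennreal_leI) simp
  qed
  moreover have "ennreal l < ennreal (l + 1 / Suc n)"
    using l by (intro ennreal_lessI) (auto intro: add_nonneg_pos)
  ultimately show "ennreal l < rearrangement M f t" by simp
qed

lemma antimono_rearrangement: "antimono (rearrangement M f)"
  unfolding rearrangement_def
  by (intro antimonoI Inf_superset_mono) (blast intro: order_trans ennreal_leI)

lemma borel_measurable_rearrangement [measurable]:
  assumes "h \<in> borel_measurable N"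
  shows "(\<lambda>x. rearrangement M f (h x)) \<in> borel_measurable N"
  by (rule measurable_compose[OF assms borel_measurable_antimono_ennreal[OF antimono_rearrangement]])

lemma rearrangement_layer:
  assumes "f \<in> borel_measurable M"
  shows "rearrangement M f t = (\<integral>\<^sup>+l\<in>{0..}. indicator {l. ennreal t < distribution M f l} l \<partial>lborel)"
proof -
  have "rearrangement M f t = (\<integral>\<^sup>+l\<in>{0..}. indicator {l. ennreal l < rearrangement M f t} l \<partial>lborel)"
    by (rule ennreal_layer[symmetric])
  also have "\<dots> = (\<integral>\<^sup>+l\<in>{0..}. indicator {l. ennreal t < distribution M f l} l \<partial>lborel)"
    using rearrangement_greater_iff[OF assms]
    by (intro nn_integral_cong) (auto simp: indicator_def)
  finally show ?thesis .
qed

lemma rearrangement_mono: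
  assumes [measurable]: "f \<in> borel_measurable M" "h \<in> borel_measurable M"
    and le: "AE x in M. \<bar>f x\<bar> \<le> \<bar>h x\<bar>"
  shows "rearrangement M f t \<le> rearrangement M h t"
proof (rule ennreal_le_of_less)
  fix l :: real assume l: "0 \<le> l" "ennreal l < rearrangement M f t"
  have "distribution M f l \<le> distribution M h l"
    unfolding distribution_def using le by (intro emeasure_mono_AE) auto
  then show "ennreal l \<le> rearrangement M h t"
    using l rearrangement_greater_iff[OF assms(1)] rearrangement_greater_iff[OF assms(2)]
    by (intro less_imp_le) auto
qed

lemma rearrangement_cmult:
  assumes [measurable]: "f \<in> borel_measurable M"
  shows "rearrangement M (\<lambda>x. c * f x) t = ennreal \<bar>c\<bar> * rearrangement M f t"
proof (cases "c = 0")
  case True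
  have "rearrangement M (\<lambda>x. c * f x) t \<le> 0"
  proof (rule ennreal_le_of_less)
    fix l :: real assume "0 \<le> l" "ennreal l < rearrangement M (\<lambda>x. c * f x) t"
    then show "ennreal l \<le> 0"
      using True by (subst (asm) rearrangement_greater_iff) (auto simp: distribution_def)
  qed
  then show ?thesis using True by simp
next
  case False
  show ?thesis
  proof (rule ennreal_eq_of_less_iff)
    fix l :: real assume l: "0 \<le> l"
    have "ennreal l < rearrangement M (\<lambda>x. c * f x) t \<longleftrightarrow> ennreal t < distribution M (\<lambda>x. c * f x) l"
      using l by (intro rearrangement_greater_iff) auto
    also have "distribution M (\<lambda>x. c * f x) l = distribution M f (l / \<bar>c\<bar>)"
      unfolding distribution_def using False
      by (intro arg_cong[where f = "emeasure M"]) (auto simp: abs_mult field_simps)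
    also have "ennreal t < \<dots> \<longleftrightarrow> ennreal (l / \<bar>c\<bar>) < rearrangement M f t"
      using l by (intro rearrangement_greater_iff[symmetric]) auto
    also have "\<dots> \<longleftrightarrow> ennreal l < ennreal \<bar>c\<bar> * rearrangement M f t"
      using False l
      by (cases "rearrangement M f t")
         (auto simp: ennreal_less_iff ennreal_mult_top field_simps simp flip: ennreal_mult)
    finally show "ennreal l < rearrangement M (\<lambda>x. c * f x) t \<longleftrightarrow> ennreal l < ennreal \<bar>c\<bar> * rearrangement M f t" .
  qed
qed

lemma nn_integral_indicator_less:
  "(\<integral>\<^sup>+s\<in>{0<..}. indicator {s. ennreal s < y} s \<partial>lborel) = y"
proof -
  have "(\<integral>\<^sup>+s\<in>{0<..}. indicator {s. ennreal s < y} s \<partial>lborel) = (\<integral>\<^sup>+l\<in>{0..}. indicator {l. ennreal l < y} l \<partial>lborel)"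
    using AE_lborel_singleton[of 0]
    by (intro nn_integral_cong_AE) (auto simp: indicator_def elim!: eventually_mono)
  then show ?thesis by (simp only: ennreal_layer)
qed

text \<open>
  Tonelli's theorem for the region \<open>t < distribution M f l\<close>: the layer of \<open>f\<^sup>*\<close> at height \<open>l\<close> is an
  interval that starts at \<open>0\<close>.
\<close>

lemma nn_integral_rearrangement_layer:
  assumes [measurable]: "f \<in> borel_measurable M" "v \<in> borel_measurable borel"
  shows "(\<integral>\<^sup>+t. v t * rearrangement M f t \<partial>lborel)
    = (\<integral>\<^sup>+l\<in>{0..}. (\<integral>\<^sup>+t. v t * indicator {t. ennreal t < distribution M f l} t \<partial>lborel) \<partial>lborel)"
proof -
  let ?G = "\<lambda>t l. v t * indicator {l. ennreal t < distribution M f l} l * indicator {0..} l"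
  have "(\<integral>\<^sup>+t. v t * rearrangement M f t \<partial>lborel) = (\<integral>\<^sup>+t. \<integral>\<^sup>+l. ?G t l \<partial>lborel \<partial>lborel)"
    unfolding rearrangement_layer[OF assms(1)] mult.assoc
    by (intro nn_integral_cong nn_integral_cmult[symmetric]) measurable
  also have "\<dots> = (\<integral>\<^sup>+l. \<integral>\<^sup>+t. ?G t l \<partial>lborel \<partial>lborel)"
    by (rule lborel_pair.Fubini') (simp add: split_beta', measurable)
  also have "\<dots> = (\<integral>\<^sup>+l\<in>{0..}. (\<integral>\<^sup>+t. v t * indicator {t. ennreal t < distribution M f l} t \<partial>lborel) \<partial>lborel)"
    by (intro nn_integral_cong, subst nn_integral_multc[symmetric])
       (auto intro!: nn_integral_cong simp: indicator_def)
  finally show ?thesis .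
qed

lemma nn_integral_rearrangement_min:
  assumes [measurable]: "f \<in> borel_measurable M"
  shows "(\<integral>\<^sup>+s. indicator {s. 0 < s \<and> ennreal s < y} s * rearrangement M f s \<partial>lborel)
    = (\<integral>\<^sup>+l\<in>{0..}. min y (distribution M f l) \<partial>lborel)"
proof -
  have "(\<integral>\<^sup>+s. indicator {s. 0 < s \<and> ennreal s < y} s * indicator {t. ennreal t < z} s \<partial>lborel) = min y z" for z
    by (subst nn_integral_indicator_less[symmetric]) (auto intro!: nn_integral_cong simp: indicator_def)
  then show ?thesis
    by (subst nn_integral_rearrangement_layer) simp_all
qed

lemma nn_integral_rearrangement:
  assumes "f \<in> borel_measurable M"
  shows "(\<integral>\<^sup>+s\<in>{0<..<t}. rearrangement M f s \<partial>lborel)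
    = (\<integral>\<^sup>+l\<in>{0..}. min (ennreal t) (distribution M f l) \<partial>lborel)"
  unfolding nn_integral_rearrangement_min[OF assms, symmetric]
  by (intro nn_integral_cong) (auto simp: indicator_def ennreal_less_iff)

text \<open>
  Measurability and monotonicity of \<open>f\<^sup>*\<^sup>*\<close> can be read off from this formula, since
  \<open>min t y / t\<close> decreases in \<open>t\<close>.
\<close>

lemma averaged_rearrangement_layer:
  assumes [measurable]: "f \<in> borel_measurable M"
  shows "averaged_rearrangement M f t = (\<integral>\<^sup>+l\<in>{0..}. ennreal (1 / t) * min (ennreal t) (distribution M f l) \<partial>lborel)"
  unfolding averaged_rearrangement_def nn_integral_rearrangement[OF assms]
  by (subst nn_integral_cmult[symmetric]) (auto simp: mult.assoc)

lemma borel_measurable_averaged_rearrangement [measurable]: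
  assumes [measurable]: "f \<in> borel_measurable M" "h \<in> borel_measurable N"
  shows "(\<lambda>x. averaged_rearrangement M f (h x)) \<in> borel_measurable N"
proof -
  have "(\<lambda>t. averaged_rearrangement M f t) \<in> borel_measurable borel"
    unfolding averaged_rearrangement_layer[OF assms(1)] by measurable
  then show ?thesis by (rule measurable_compose[OF assms(2)])
qed

lemma averaged_rearrangement_antimono:
  assumes [measurable]: "f \<in> borel_measurable M" and st: "0 < s" "s \<le> t"
  shows "averaged_rearrangement M f t \<le> averaged_rearrangement M f s"
proof -
  have "ennreal (1 / t) * min (ennreal t) y \<le> ennreal (1 / s) * min (ennreal s) y" for y
  proof (cases y)
    case (real r)
    have "1 / t * min t r \<le> 1 / s * min s r"
      using st real by (auto simp: min_def field_simps intro!: mult_left_mono)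
    then show ?thesis
      using st real by (simp add: min_ennreal ennreal_leI flip: ennreal_mult)
  next
    case top
    then show ?thesis using st by (simp add: min_def top_unique flip: ennreal_mult)
  qed
  then show ?thesis
    unfolding averaged_rearrangement_layer[OF assms(1)]
    by (intro nn_integral_mono mult_right_mono) auto
qed

lemma rearrangement_le_averaged:
  assumes "0 < t"
  shows "rearrangement M f t \<le> averaged_rearrangement M f t"
proof -
  have "rearrangement M f t = ennreal (1 / t) * (\<integral>\<^sup>+s\<in>{0<..<t}. rearrangement M f t \<partial>lborel)"
    using assms ennreal_mult[of t "1 / t"]
    by (simp add: nn_integral_cmult_indicator mult_ac) (simp add: mult.left_commute[of "ennreal t"])
  also have "\<dots> \<le> averaged_rearrangement M f t"
    unfolding averaged_rearrangement_def
    by (intro mult_left_mono nn_integral_mono)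
       (auto simp: indicator_def intro!: antimonoD[OF antimono_rearrangement])
  finally show ?thesis .
qed

lemma averaged_rearrangement_mono:
  assumes "f \<in> borel_measurable M" "h \<in> borel_measurable M" "AE x in M. \<bar>f x\<bar> \<le> \<bar>h x\<bar>"
  shows "averaged_rearrangement M f t \<le> averaged_rearrangement M h t"
  unfolding averaged_rearrangement_def
  by (intro mult_left_mono nn_integral_mono mult_right_mono rearrangement_mono assms) auto

lemma averaged_rearrangement_cmult:
  assumes "f \<in> borel_measurable M"
  shows "averaged_rearrangement M (\<lambda>x. c * f x) t = ennreal \<bar>c\<bar> * averaged_rearrangement M f t"
  unfolding averaged_rearrangement_def rearrangement_cmult[OF assms]
  by (simp add: mult.assoc nn_integral_cmult mult.left_commute)

context sigma_finite_measure begin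

lemma nn_integral_layer_cake:
  assumes [measurable]: "g \<in> borel_measurable M" "w \<in> borel_measurable M"
  shows "(\<integral>\<^sup>+x. w x * ennreal \<bar>g x\<bar> \<partial>M) = (\<integral>\<^sup>+l\<in>{0..}. (\<integral>\<^sup>+x. w x * indicator {x \<in> space M. l < \<bar>g x\<bar>} x \<partial>M) \<partial>lborel)"
proof -
  interpret pair_sigma_finite lborel M by standard
  have "(\<integral>\<^sup>+x. w x * ennreal \<bar>g x\<bar> \<partial>M) = (\<integral>\<^sup>+x. \<integral>\<^sup>+l. w x * (indicator {l. ennreal l < ennreal \<bar>g x\<bar>} l * indicator {0..} l) \<partial>lborel \<partial>M)"
    by (intro nn_integral_cong, subst nn_integral_cmult) (simp_all only: ennreal_layer, measurable)
  also have "\<dots> = (\<integral>\<^sup>+l. \<integral>\<^sup>+x. w x * (indicator {l. ennreal l < ennreal \<bar>g x\<bar>} l * indicator {0..} l) \<partial>M \<partial>lborel)"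
    by (rule Fubini') (simp add: split_beta', measurable)
  also have "\<dots> = (\<integral>\<^sup>+l\<in>{0..}. (\<integral>\<^sup>+x. w x * indicator {x \<in> space M. l < \<bar>g x\<bar>} x \<partial>M) \<partial>lborel)"
    by (intro nn_integral_cong, subst nn_integral_multc[symmetric])
       (auto intro!: nn_integral_cong simp: indicator_def ennreal_less_iff)
  finally show ?thesis .
qed

lemma nn_integral_abs_distribution:
  assumes [measurable]: "g \<in> borel_measurable M"
  shows "(\<integral>\<^sup>+x. ennreal \<bar>g x\<bar> \<partial>M) = (\<integral>\<^sup>+l\<in>{0..}. distribution M g l \<partial>lborel)"
  using nn_integral_layer_cake[OF assms, of "\<lambda>x. 1"] by (simp add: distribution_def)

lemma nn_integral_on_set_distribution:
  assumes [measurable]: "g \<in> borel_measurable M" "F \<in> sets M"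
  shows "(\<integral>\<^sup>+x\<in>F. ennreal \<bar>g x\<bar> \<partial>M) = (\<integral>\<^sup>+l\<in>{0..}. emeasure M (F \<inter> {x \<in> space M. l < \<bar>g x\<bar>}) \<partial>lborel)"
  using nn_integral_layer_cake[OF assms(1), of "indicator F"]
  by (simp add: mult.commute indicator_inter_arith[symmetric])

lemma nn_integral_rearrangement_eq:
  assumes "f \<in> borel_measurable M"
  shows "(\<integral>\<^sup>+t\<in>{0<..}. rearrangement M f t \<partial>lborel) = (\<integral>\<^sup>+x. ennreal \<bar>f x\<bar> \<partial>M)"
  using nn_integral_rearrangement_min[OF assms, of top]
  by (simp add: nn_integral_abs_distribution[OF assms] greaterThan_def mult.commute less_top[symmetric])

text \<open>
  The case of Hardy and Littlewood's inequality in which one function is an indicator.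
\<close>

lemma nn_integral_on_set_le:
  assumes [measurable]: "g \<in> borel_measurable M" "F \<in> sets M"
  shows "(\<integral>\<^sup>+x\<in>F. ennreal \<bar>g x\<bar> \<partial>M)
    \<le> (\<integral>\<^sup>+s. indicator {s. 0 < s \<and> ennreal s < emeasure M F} s * rearrangement M g s \<partial>lborel)"
  unfolding nn_integral_on_set_distribution[OF assms] nn_integral_rearrangement_min[OF assms(1)]
  by (intro nn_integral_mono mult_right_mono) (auto simp: distribution_def intro!: emeasure_mono)

text \<open>
  Cutting \<open>f\<close> into its level sets reduces the claim to \<open>nn_integral_on_set_le\<close>, and
  \<open>nn_integral_rearrangement_layer\<close> puts the layers of \<open>f\<^sup>*\<close> together again.
\<close>

theorem Hardy_Littlewood:
  assumes [measurable]: "f \<in> borel_measurable M" "g \<in> borel_measurable M"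
  shows "(\<integral>\<^sup>+x. ennreal \<bar>f x * g x\<bar> \<partial>M) \<le> (\<integral>\<^sup>+t\<in>{0<..}. rearrangement M f t * rearrangement M g t \<partial>lborel)"
proof -
  let ?v = "\<lambda>t. rearrangement M g t * indicator {0<..} t"
  have "(\<integral>\<^sup>+x. ennreal \<bar>f x * g x\<bar> \<partial>M) = (\<integral>\<^sup>+x. ennreal \<bar>g x\<bar> * ennreal \<bar>f x\<bar> \<partial>M)"
    by (intro nn_integral_cong) (simp add: abs_mult ennreal_mult mult.commute)
  also have "\<dots> = (\<integral>\<^sup>+l\<in>{0..}. (\<integral>\<^sup>+x\<in>{x \<in> space M. l < \<bar>f x\<bar>}. ennreal \<bar>g x\<bar> \<partial>M) \<partial>lborel)"
    by (rule nn_integral_layer_cake) auto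
  also have "\<dots> \<le> (\<integral>\<^sup>+l\<in>{0..}. (\<integral>\<^sup>+s. ?v s * indicator {s. ennreal s < distribution M f l} s \<partial>lborel) \<partial>lborel)"
  proof (intro nn_integral_mono mult_right_mono)
    fix l :: real
    have "(\<integral>\<^sup>+x\<in>{x \<in> space M. l < \<bar>f x\<bar>}. ennreal \<bar>g x\<bar> \<partial>M)
      \<le> (\<integral>\<^sup>+s. indicator {s. 0 < s \<and> ennreal s < distribution M f l} s * rearrangement M g s \<partial>lborel)"
      unfolding distribution_def by (rule nn_integral_on_set_le) auto
    also have "\<dots> = (\<integral>\<^sup>+s. ?v s * indicator {s. ennreal s < distribution M f l} s \<partial>lborel)"
      by (intro nn_integral_cong) (auto simp: indicator_def)
    finally show "(\<integral>\<^sup>+x\<in>{x \<in> space M. l < \<bar>f x\<bar>}. ennreal \<bar>g x\<bar> \<partial>M)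
      \<le> (\<integral>\<^sup>+s. ?v s * indicator {s. ennreal s < distribution M f l} s \<partial>lborel)" .
  qed simp
  also have "\<dots> = (\<integral>\<^sup>+t. ?v t * rearrangement M f t \<partial>lborel)"
    by (rule nn_integral_rearrangement_layer[symmetric]) auto
  also have "\<dots> = (\<integral>\<^sup>+t\<in>{0<..}. rearrangement M f t * rearrangement M g t \<partial>lborel)"
    by (simp add: mult_ac)
  finally show ?thesis .
qed

end

section \<open>Rearrangements on finite and on divisible measures\<close>

context finite_measure begin

lemma rearrangement_tendsto_0:
  fixes u :: "nat \<Rightarrow> 'a \<Rightarrow> real"
  assumes [measurable]: "\<And>n. u n \<in> borel_measurable M"
    and lim: "\<And>x. x \<in> space M \<Longrightarrow> (\<lambda>n. u n x) \<longlonglongrightarrow> 0" and t: "0 < t"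
  shows "(\<lambda>n. rearrangement M (u n) t) \<longlonglongrightarrow> 0"
proof (rule order_tendstoI)
  fix y :: ennreal assume "0 < y"
  obtain e where e: "0 < e" "ennreal e < y"
  proof -
    obtain z where z: "0 < z" "z < y" using dense[OF \<open>0 < y\<close>] by auto
    then have "z < top" using less_le_trans top_greatest by blast
    then obtain e where "z = ennreal e" "0 \<le> e" by (cases z) auto
    then show ?thesis using z that[of e] by auto
  qed
  have "(\<lambda>n. \<integral>\<^sup>+x. indicator {x \<in> space M. e < \<bar>u n x\<bar>} x \<partial>M) \<longlonglongrightarrow> (\<integral>\<^sup>+x. 0 \<partial>M)"
  proof (rule nn_integral_dominated_convergence[where w = "\<lambda>x. 1"])
    show "AE x in M. (\<lambda>n. indicator {x \<in> space M. e < \<bar>u n x\<bar>} x) \<longlonglongrightarrow> (0::ennreal)"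
    proof (rule AE_I2)
      fix x assume x: "x \<in> space M"
      have "\<forall>\<^sub>F n in sequentially. \<bar>u n x\<bar> < e"
        using tendstoD[OF lim[OF x] e(1)] by simp
      then have "\<forall>\<^sub>F n in sequentially. indicator {x \<in> space M. e < \<bar>u n x\<bar>} x = (0::ennreal)"
        by eventually_elim auto
      then show "(\<lambda>n. indicator {x \<in> space M. e < \<bar>u n x\<bar>} x) \<longlonglongrightarrow> (0::ennreal)"
        by (rule tendsto_eventually)
    qed
  qed (auto simp: indicator_def emeasure_finite simp flip: less_top)
  then have "(\<lambda>n. distribution M (u n) e) \<longlonglongrightarrow> 0"
    by (simp add: distribution_def)
  then have "\<forall>\<^sub>F n in sequentially. distribution M (u n) e < ennreal t"
    using t by (intro order_tendstoD(2)) auto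
  then show "\<forall>\<^sub>F n in sequentially. rearrangement M (u n) t < y"
  proof eventually_elim
    case (elim n)
    then have "\<not> ennreal e < rearrangement M (u n) t"
      using e(1) by (subst rearrangement_greater_iff) auto
    then show ?case using e(2) by auto
  qed
qed simp

lemma averaged_rearrangement_tendsto_0:
  fixes u :: "nat \<Rightarrow> 'a \<Rightarrow> real"
  assumes [measurable]: "\<And>n. u n \<in> borel_measurable M" "h \<in> borel_measurable M"
    and lim: "\<And>x. x \<in> space M \<Longrightarrow> (\<lambda>n. u n x) \<longlonglongrightarrow> 0" and t: "0 < t"
    and bd: "\<And>n x. x \<in> space M \<Longrightarrow> \<bar>u n x\<bar> \<le> h x"
    and fin: "averaged_rearrangement M h t < \<infinity>"
  shows "(\<lambda>n. averaged_rearrangement M (u n) t) \<longlonglongrightarrow> 0"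
proof -
  have "(\<lambda>n. \<integral>\<^sup>+s\<in>{0<..<t}. rearrangement M (u n) s \<partial>lborel) \<longlonglongrightarrow> (\<integral>\<^sup>+s. 0 \<partial>(lborel::real measure))"
  proof (rule nn_integral_dominated_convergence[where w = "\<lambda>s. rearrangement M h s * indicator {0<..<t} s"])
    show "(\<integral>\<^sup>+s\<in>{0<..<t}. rearrangement M h s \<partial>lborel) < \<infinity>"
      using fin t by (auto simp: averaged_rearrangement_def ennreal_mult_less_top)
    have "\<bar>u n x\<bar> \<le> \<bar>h x\<bar>" if "x \<in> space M" for n x
      using bd[OF that, of n] by linarith
    then show "AE s in lborel. rearrangement M (u n) s * indicator {0<..<t} s \<le> rearrangement M h s * indicator {0<..<t} s" for n
      by (intro AE_I2 mult_right_mono rearrangement_mono) auto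
    show "AE s in lborel. (\<lambda>n. rearrangement M (u n) s * indicator {0<..<t} s) \<longlonglongrightarrow> 0"
      using rearrangement_tendsto_0[OF _ lim] by (intro AE_I2) (auto simp: indicator_def)
  qed auto
  then have "(\<lambda>n. ennreal (1 / t) * (\<integral>\<^sup>+s\<in>{0<..<t}. rearrangement M (u n) s \<partial>lborel)) \<longlonglongrightarrow> ennreal (1 / t) * 0"
    by (intro ennreal_tendsto_cmult) auto
  then show ?thesis by (simp add: averaged_rearrangement_def)
qed

text \<open>
  Otherwise the functions \<open>f / n\<close>, which tend to \<open>0\<close> pointwise, would all have an infinite
  rearrangement at \<open>t\<close>.
\<close>

lemma rearrangement_finite:
  assumes [measurable]: "f \<in> borel_measurable M" and t: "0 < t"
  shows "rearrangement M f t < \<infinity>"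
proof -
  have "(\<lambda>n. rearrangement M (\<lambda>x. 1 / real (Suc n) * f x) t) \<longlonglongrightarrow> 0"
  proof (rule rearrangement_tendsto_0[OF _ _ t])
    fix x
    show "(\<lambda>n. 1 / real (Suc n) * f x) \<longlonglongrightarrow> 0"
      using tendsto_mult_left_zero[OF LIMSEQ_inverse_real_of_nat, of "f x"] by (simp add: inverse_eq_divide)
  qed auto
  then have "\<forall>\<^sub>F n in sequentially. rearrangement M (\<lambda>x. 1 / real (Suc n) * f x) t < 1"
    by (intro order_tendstoD(2)) auto
  then obtain n where "rearrangement M (\<lambda>x. 1 / real (Suc n) * f x) t < 1"
    by (auto dest: eventually_happens)
  then have "ennreal (1 / real (Suc n)) * rearrangement M f t < 1"
    by (subst (asm) rearrangement_cmult) (auto simp del: of_nat_Suc)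
  then show ?thesis by (cases "rearrangement M f t") (auto simp: ennreal_mult_top)
qed

end

text \<open>
  Finite measures without atoms, in the form in which the absence of atoms is used.
\<close>

locale divisible_measure = finite_measure +
  assumes divisible: "A \<in> sets M \<Longrightarrow> 0 \<le> t \<Longrightarrow> t \<le> measure M A \<Longrightarrow> \<exists>B\<in>sets M. B \<subseteq> A \<and> measure M B = t"
begin

text \<open>
  The interesting case is that \<open>t\<close> lies strictly between \<open>0\<close> and the total measure.  Let
  \<open>L = g\<^sup>*(t)\<close>.  The set \<open>{|g| > L}\<close> has measure at most \<open>t\<close> and \<open>{|g| \<ge> L}\<close> has measure at
  least \<open>t\<close>, so divisibility provides \<open>F\<close> of measure \<open>t\<close> between them.  For every \<open>l\<close>, either \<open>F\<close>
  contains \<open>{|g| > l}\<close> or is contained in it, so they intersect in a set of the largest possible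
  measure.
\<close>

lemma ex_set_rearrangement:
  assumes g[measurable]: "g \<in> borel_measurable M" and t: "0 \<le> t"
  shows "\<exists>F\<in>sets M. emeasure M F \<le> ennreal t \<and>
    (\<integral>\<^sup>+s\<in>{0<..<t}. rearrangement M g s \<partial>lborel) \<le> (\<integral>\<^sup>+x\<in>F. ennreal \<bar>g x\<bar> \<partial>M)"
proof -
  have D: "distribution M g l = ennreal (measure M {x \<in> space M. l < \<bar>g x\<bar>})" for l
    by (simp add: distribution_def emeasure_eq_measure)
  consider "t = 0" | "measure M (space M) \<le> t" | "0 < t" "t < measure M (space M)"
    using t by linarith
  then show ?thesis
  proof cases
    case 1
    then show ?thesis by (intro bexI[of _ "{}"]) auto
  next
    case 2
    have "(\<integral>\<^sup>+s\<in>{0<..<t}. rearrangement M g s \<partial>lborel) \<le> (\<integral>\<^sup>+l\<in>{0..}. distribution M g l \<partial>lborel)"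
      unfolding nn_integral_rearrangement[OF g] by (intro nn_integral_mono mult_right_mono) auto
    also have "\<dots> = (\<integral>\<^sup>+x\<in>space M. ennreal \<bar>g x\<bar> \<partial>M)"
      by (subst nn_integral_abs_distribution[symmetric]) (auto intro!: nn_integral_cong)
    finally show ?thesis using 2 by (intro bexI[of _ "space M"]) (auto simp: emeasure_eq_measure ennreal_leI)
  next
    case 3
    obtain L where lam: "rearrangement M g t = ennreal L" "0 \<le> L"
      using rearrangement_finite[OF g 3(1)] by (cases "rearrangement M g t") auto
    define G where "G = {x \<in> space M. L < \<bar>g x\<bar>}"
    define H where "H = {x \<in> space M. L \<le> \<bar>g x\<bar>}"
    have [measurable]: "G \<in> sets M" "H \<in> sets M" by (auto simp: G_def H_def)
    have Gt: "measure M G \<le> t"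
      using rearrangement_greater_iff[OF g lam(2), of t] lam 3(1)
      by (auto simp: D G_def not_less)
    have Ht: "t \<le> measure M H"
    proof (cases "L = 0")
      case True
      then show ?thesis using 3 by (simp add: H_def)
    next
      case False
      \<comment> \<open>\<open>H\<close> is the intersection of the sets \<open>{|g| > ?l n}\<close>, whose measure exceeds \<open>t\<close> since \<open>?l n < g\<^sup>*(t)\<close>.\<close>
      let ?l = "\<lambda>n::nat. L - L / Suc n"
      let ?A = "\<lambda>n::nat. {x \<in> space M. ?l n < \<bar>g x\<bar>}"
      have "decseq ?A"
      proof (intro decseq_SucI subsetI)
        fix n x assume "x \<in> ?A (Suc n)"
        moreover have "L / Suc (Suc n) \<le> L / Suc n"
          using lam(2) by (intro divide_left_mono) auto
        ultimately show "x \<in> ?A n" by (auto simp del: of_nat_Suc)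
      qed
      moreover have "(\<Inter>n. ?A n) = H"
      proof (intro set_eqI iffI)
        fix x assume "x \<in> (\<Inter>n. ?A n)"
        then have x: "x \<in> space M" "\<And>n. ?l n < \<bar>g x\<bar>" by auto
        have "(\<lambda>n. L - L * inverse (real (Suc n))) \<longlonglongrightarrow> L - L * 0"
          by (intro tendsto_intros LIMSEQ_inverse_real_of_nat)
        then have "L \<le> \<bar>g x\<bar>"
          using x(2) by (intro tendsto_upperbound[of "\<lambda>n. L - L * inverse (real (Suc n))" L sequentially])
            (auto intro!: always_eventually less_imp_le simp: divide_inverse simp del: of_nat_Suc)
        then show "x \<in> H" using x by (simp add: H_def)
      next
        fix x assume x: "x \<in> H"
        have "?l n < L" for n using False lam(2) by (simp del: of_nat_Suc)
        moreover have "L \<le> \<bar>g x\<bar>" using x by (simp add: H_def)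
        ultimately have "?l n < \<bar>g x\<bar>" for n
          by (rule less_le_trans)
        then show "x \<in> (\<Inter>n. ?A n)" using x by (auto simp: H_def)
      qed
      moreover have "?A n \<in> sets M" for n by measurable
      then have "range ?A \<subseteq> sets M" by (rule image_subsetI)
      ultimately have "(\<lambda>n. measure M (?A n)) \<longlonglongrightarrow> measure M H"
        using finite_Lim_measure_decseq[of ?A] by simp
      moreover have "t \<le> measure M (?A n)" for n
      proof -
        have l: "0 \<le> ?l n" "?l n < L" using False lam(2) by (simp_all add: field_simps)
        then have "ennreal (?l n) < rearrangement M g t"
          by (simp add: lam ennreal_less_iff)
        then have "ennreal t < ennreal (measure M (?A n))"
          using rearrangement_greater_iff[OF g l(1)] by (simp only: D)
        then show ?thesis using 3(1) by (simp add: ennreal_less_iff)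
      qed
      ultimately show ?thesis
        by (intro tendsto_lowerbound[of "\<lambda>n. measure M (?A n)"]) auto
    qed
    have GH: "G \<subseteq> H" by (auto simp: G_def H_def)
    have "t - measure M G \<le> measure M (H - G)"
      using Ht GH by (subst finite_measure_Diff) auto
    then obtain B where B: "B \<in> sets M" "B \<subseteq> H - G" "measure M B = t - measure M G"
      using divisible[of "H - G" "t - measure M G"] Gt by auto
    define F where "F = G \<union> B"
    have [measurable]: "F \<in> sets M" using B by (simp add: F_def)
    have "measure M F = measure M G + measure M B"
      unfolding F_def using B by (intro finite_measure_Union) auto
    then have F: "measure M F = t" "G \<subseteq> F" "F \<subseteq> H"
      using B GH by (auto simp: F_def)
    have "min (ennreal t) (distribution M g l) \<le> emeasure M (F \<inter> {x \<in> space M. l < \<bar>g x\<bar>})" for l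
    proof (cases "L \<le> l")
      case True
      then have "F \<inter> {x \<in> space M. l < \<bar>g x\<bar>} = {x \<in> space M. l < \<bar>g x\<bar>}"
        using F(2) by (auto simp: G_def)
      then show ?thesis by (simp add: distribution_def)
    next
      case False
      then have "F \<inter> {x \<in> space M. l < \<bar>g x\<bar>} = F"
        using F(3) by (auto simp: H_def)
      then show ?thesis using F(1) by (simp add: emeasure_eq_measure)
    qed
    then have "(\<integral>\<^sup>+s\<in>{0<..<t}. rearrangement M g s \<partial>lborel) \<le> (\<integral>\<^sup>+x\<in>F. ennreal \<bar>g x\<bar> \<partial>M)"
      unfolding nn_integral_rearrangement[OF g] nn_integral_on_set_distribution[OF g \<open>F \<in> sets M\<close>]
      by (intro nn_integral_mono mult_right_mono) auto
    then show ?thesis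
      using F(1) by (intro bexI[of _ F]) (auto simp: emeasure_eq_measure)
  qed
qed

text \<open>
  By \<open>ex_set_rearrangement\<close> the left hand side, multiplied by \<open>t\<close>, is at most the integral of the sum
  over one set \<open>E\<close> of measure at most \<open>t\<close>, and \<open>F\<^sub>j \<inter> E\<close> has measure at most \<open>min \<tau>\<^sub>j t\<close>.
\<close>

lemma averaged_rearrangement_sum_le:
  fixes c \<tau> :: "'i \<Rightarrow> real"
  assumes J: "finite J" and F: "\<And>j. j \<in> J \<Longrightarrow> F j \<in> sets M" and c: "\<And>j. j \<in> J \<Longrightarrow> 0 \<le> c j"
    and \<tau>: "\<And>j. j \<in> J \<Longrightarrow> 0 \<le> \<tau> j" "\<And>j. j \<in> J \<Longrightarrow> emeasure M (F j) \<le> ennreal (\<tau> j)" and t: "0 < t"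
  shows "averaged_rearrangement M (\<lambda>x. \<Sum>j\<in>J. c j * indicator (F j) x) t
    \<le> ennreal (\<Sum>j\<in>J. c j * min 1 (\<tau> j / t))"
proof -
  let ?f = "\<lambda>x. \<Sum>j\<in>J. c j * indicator (F j) x"
  have [measurable]: "?f \<in> borel_measurable M" using F by measurable
  obtain E where E: "E \<in> sets M" "emeasure M E \<le> ennreal t"
    "(\<integral>\<^sup>+s\<in>{0<..<t}. rearrangement M ?f s \<partial>lborel) \<le> (\<integral>\<^sup>+x\<in>E. ennreal \<bar>?f x\<bar> \<partial>M)"
    using ex_set_rearrangement[of ?f t] t by auto
  note E(3)
  also have "(\<integral>\<^sup>+x\<in>E. ennreal \<bar>?f x\<bar> \<partial>M) = (\<integral>\<^sup>+x. (\<Sum>j\<in>J. ennreal (c j) * indicator (F j \<inter> E) x) \<partial>M)"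
  proof (intro nn_integral_cong)
    fix x
    have "ennreal \<bar>?f x\<bar> = (\<Sum>j\<in>J. ennreal (c j * indicator (F j) x))"
      using c by (subst sum_ennreal) (auto simp: abs_of_nonneg sum_nonneg)
    also have "\<dots> = (\<Sum>j\<in>J. ennreal (c j) * indicator (F j) x)"
      by (intro sum.cong) (auto simp: indicator_def)
    finally show "ennreal \<bar>?f x\<bar> * indicator E x = (\<Sum>j\<in>J. ennreal (c j) * indicator (F j \<inter> E) x)"
      by (simp add: sum_distrib_right mult.assoc indicator_inter_arith)
  qed
  also have "\<dots> = (\<Sum>j\<in>J. ennreal (c j) * emeasure M (F j \<inter> E))"
    using F E(1) by (subst nn_integral_sum) (auto simp: nn_integral_cmult_indicator)
  also have "\<dots> \<le> (\<Sum>j\<in>J. ennreal (c j * min (\<tau> j) t))"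
  proof (intro sum_mono)
    fix j assume j: "j \<in> J"
    have "emeasure M (F j \<inter> E) \<le> ennreal (\<tau> j)" "emeasure M (F j \<inter> E) \<le> ennreal t"
      using F[OF j] E(1,2) \<tau>(2)[OF j] emeasure_mono[of "F j \<inter> E" "F j" M] emeasure_mono[of "F j \<inter> E" E M]
      by auto
    then have "emeasure M (F j \<inter> E) \<le> ennreal (min (\<tau> j) t)"
      by (simp add: min_def)
    then show "ennreal (c j) * emeasure M (F j \<inter> E) \<le> ennreal (c j * min (\<tau> j) t)"
      using c[OF j] \<tau>(1)[OF j] t by (subst ennreal_mult) (auto intro!: mult_left_mono)
  qed
  also have "\<dots> = ennreal (\<Sum>j\<in>J. c j * min (\<tau> j) t)"
    using c \<tau>(1) t by (intro sum_ennreal) auto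
  finally have "averaged_rearrangement M ?f t \<le> ennreal (1 / t) * ennreal (\<Sum>j\<in>J. c j * min (\<tau> j) t)"
    unfolding averaged_rearrangement_def by (intro mult_left_mono) auto
  also have "\<dots> = ennreal (1 / t * (\<Sum>j\<in>J. c j * min (\<tau> j) t))"
    using t c \<tau>(1) by (intro ennreal_mult[symmetric] sum_nonneg mult_nonneg_nonneg) auto
  also have "1 / t * (\<Sum>j\<in>J. c j * min (\<tau> j) t) = (\<Sum>j\<in>J. c j * min 1 (\<tau> j / t))"
    unfolding sum_distrib_left using t by (intro sum.cong) (auto simp: min_def field_simps)
  finally show ?thesis .
qed

end

text \<open>
  Spheres are null sets, so the measure of \<open>A \<inter> cball 0 r\<close> depends continuously on \<open>r\<close> and the
  intermediate value theorem applies.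
\<close>

lemma divisible_lebesgue_on:
  fixes S :: "'a::euclidean_space set"
  assumes S: "S \<in> lmeasurable"
  shows "divisible_measure (lebesgue_on S)"
proof -
  interpret finite_measure "lebesgue_on S" by (rule finite_measure_lebesgue_on[OF S])
  show ?thesis
  proof
    fix A t assume A: "A \<in> sets (lebesgue_on S)" and t: "0 \<le> t" "t \<le> measure (lebesgue_on S) A"
    have Sl: "S \<in> sets lebesgue" using S by auto
    have A': "A \<in> sets lebesgue" "A \<subseteq> S"
      using A Sl by (auto simp: sets_restrict_space_iff)
    have Al: "A \<in> lmeasurable" using A' S by (metis fmeasurable_Int_fmeasurable inf.absorb_iff2)
    have mA: "measure (lebesgue_on S) B = measure lebesgue B" if "B \<subseteq> S" for B
      using Sl that by (intro measure_restrict_space) auto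
    interpret A: finite_measure "lebesgue_on A" by (rule finite_measure_lebesgue_on[OF Al])
    define P where "P = distr (lebesgue_on A) borel (norm :: 'a \<Rightarrow> real)"
    have [measurable]: "(norm :: 'a \<Rightarrow> real) \<in> borel_measurable (lebesgue_on A)"
      using A' by (intro measurable_restrict_space1 borel_measurable_norm measurable_completion) auto
    interpret P: finite_measure P unfolding P_def by (rule A.finite_measure_distr) measurable
    interpret P: finite_borel_measure P by standard (simp add: P_def)
    have meas: "measure P X = measure lebesgue {x \<in> A. norm x \<in> X}" if "X \<in> sets borel" for X
      unfolding P_def using that A'
      by (simp add: measure_distr measure_restrict_space vimage_def Int_def conj_commute)
    have "measure P {r} = 0" for r
    proof -
      have "{x \<in> A. norm x \<in> {r}} \<subseteq> sphere 0 r" by (auto simp: sphere_def)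
      then have "negligible {x \<in> A. norm x \<in> {r}}"
        using negligible_sphere negligible_subset by blast
      then show ?thesis
        by (subst meas) (auto simp: negligible_iff_null_sets measure_eq_0_null_sets)
    qed
    then have cont: "isCont (cdf P) r" for r
      by (simp add: P.isCont_cdf)
    have neg: "cdf P (-1) = 0"
    proof -
      have "\<not> norm x \<le> -1" for x :: 'a
        using norm_ge_zero[of x] by linarith
      then show ?thesis unfolding cdf_def by (subst meas) simp_all
    qed
    show "\<exists>B\<in>sets (lebesgue_on S). B \<subseteq> A \<and> measure (lebesgue_on S) B = t"
    proof (cases "t = measure lebesgue A")
      case True
      then show ?thesis using A A' mA by (intro bexI[of _ A]) auto
    next
      case False
      then have lt: "t < measure lebesgue A" using t mA A'(2) by simp
      have "measure P (space P) = measure lebesgue A"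
        by (subst meas) (auto simp: P_def)
      then have "\<forall>\<^sub>F r in at_top. t < cdf P r"
        using P.cdf_lim_at_top lt by (intro order_tendstoD(1)) auto
      then have "\<forall>\<^sub>F r in at_top. t < cdf P r \<and> -1 \<le> r"
        using eventually_ge_at_top by (rule eventually_conj)
      then obtain r where "t < cdf P r" "-1 \<le> r"
        by (auto dest: eventually_happens)
      then obtain r where "cdf P r = t"
        using IVT[of "cdf P" "-1" t r] neg t(1) cont by auto
      then have r: "measure lebesgue {x \<in> A. norm x \<in> {..r}} = t"
        unfolding cdf_def by (subst (asm) meas) auto
      have "{x \<in> A. norm x \<in> {..r}} = A \<inter> cball 0 r" by auto
      then have "{x \<in> A. norm x \<in> {..r}} \<in> sets (lebesgue_on S)"
        using A' Sl by (auto simp: sets_restrict_space_iff)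
      moreover have "measure (lebesgue_on S) {x \<in> A. norm x \<in> {..r}} = t"
        unfolding r[symmetric] using A' by (intro mA) auto
      ultimately show ?thesis by (intro bexI[of _ "{x \<in> A. norm x \<in> {..r}}"]) auto
    qed
  qed
qed

section \<open>Lorentz functionals and Hoelder's inequality for them\<close>

text \<open>
  The Haar measure \<open>dt/t\<close> of the multiplicative group of positive reals.  Its invariance under
  dilations makes the constants below independent of the scale.
\<close>

definition haar :: "real measure" where
  "haar = density lborel (\<lambda>t. ennreal (1 / t) * indicator {0<..} t)"

lemma sets_haar [measurable_cong]: "sets haar = sets borel"
  by (simp add: haar_def)

lemma space_haar [simp]: "space haar = UNIV"
  by (simp add: haar_def)

lemma nn_integral_haar:
  assumes [measurable]: "F \<in> borel_measurable borel"
  shows "(\<integral>\<^sup>+t. F t \<partial>haar) = (\<integral>\<^sup>+t\<in>{0<..}. F t * ennreal (1 / t) \<partial>lborel)"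
  unfolding haar_def by (subst nn_integral_density) (auto intro!: nn_integral_cong simp: mult_ac)

lemma AE_haarI: "(\<And>t. 0 < t \<Longrightarrow> P t) \<Longrightarrow> AE t in haar. P t"
  unfolding haar_def by (subst AE_density) (auto simp: indicator_def)

lemma nn_integral_haar_scale:
  assumes [measurable]: "F \<in> borel_measurable borel" and c: "0 < c"
  shows "(\<integral>\<^sup>+t. F (t / c) \<partial>haar) = (\<integral>\<^sup>+t. F t \<partial>haar)"
proof -
  have "(\<integral>\<^sup>+t. F (t / c) \<partial>haar) = (\<integral>\<^sup>+t\<in>{0<..}. F (t / c) * ennreal (1 / t) \<partial>lborel)"
    by (rule nn_integral_haar) measurable
  also have "\<dots> = ennreal c * (\<integral>\<^sup>+t. F ((0 + c * t) / c) * ennreal (1 / (0 + c * t)) * indicator {0<..} (0 + c * t) \<partial>lborel)"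
    using c by (subst nn_integral_real_affine[where c = c and t = 0]) auto
  also have "\<dots> = (\<integral>\<^sup>+t\<in>{0<..}. F t * ennreal (1 / t) \<partial>lborel)"
  proof (subst nn_integral_cmult[symmetric])
    show "(\<integral>\<^sup>+t. ennreal c * (F ((0 + c * t) / c) * ennreal (1 / (0 + c * t)) * indicator {0<..} (0 + c * t)) \<partial>lborel)
      = (\<integral>\<^sup>+t\<in>{0<..}. F t * ennreal (1 / t) \<partial>lborel)"
    proof (intro nn_integral_cong)
      fix t :: real
      have "ennreal (1 / t) = ennreal c * ennreal (1 / (c * t))" if "0 < t"
        using c that by (simp flip: ennreal_mult)
      then show "ennreal c * (F ((0 + c * t) / c) * ennreal (1 / (0 + c * t)) * indicator {0<..} (0 + c * t))
        = F t * ennreal (1 / t) * indicator {0<..} t"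
        using c by (cases "0 < t") (auto simp: indicator_def zero_less_mult_iff mult_ac)
    qed
  qed measurable
  also have "\<dots> = (\<integral>\<^sup>+t. F t \<partial>haar)" by (rule nn_integral_haar[symmetric]) measurable
  finally show ?thesis .
qed

lemma lorentz_functional_finite:
  assumes [measurable]: "h \<in> borel_measurable borel" and "r \<noteq> \<infinity>"
  shows "lorentz_functional p r h =
    epowr (\<integral>\<^sup>+t. epowr (ennreal (t powr enn2real (1 / p)) * h t) (enn2real r) \<partial>haar) (1 / enn2real r)"
  using assms(2) unfolding lorentz_functional_def by (subst nn_integral_haar) auto

lemma lorentz_functional_mono:
  assumes "\<And>t. 0 < t \<Longrightarrow> h t \<le> k t"
  shows "lorentz_functional p r h \<le> lorentz_functional p r k"
proof (cases "r = \<infinity>")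
  case True
  then show ?thesis
    unfolding lorentz_functional_def using assms
    by (auto intro!: SUP_subset_mono mult_left_mono)
next
  case False
  have "epowr (ennreal (t powr enn2real (1 / p)) * h t) (enn2real r) * ennreal (1 / t) * indicator {0<..} t
    \<le> epowr (ennreal (t powr enn2real (1 / p)) * k t) (enn2real r) * ennreal (1 / t) * indicator {0<..} t" for t
    using assms[of t] by (cases "0 < t") (auto intro!: mult_right_mono epowr_mono mult_left_mono)
  then show ?thesis
    unfolding lorentz_functional_def using False by (auto intro!: epowr_mono nn_integral_mono)
qed

lemma lorentz_functional_cmult:
  assumes [measurable]: "h \<in> borel_measurable borel" and r: "1 \<le> r" "r < \<infinity>"
  shows "lorentz_functional p r (\<lambda>t. c * h t) = c * lorentz_functional p r h"
proof -
  have R: "1 \<le> enn2real r" using r by (cases r) auto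
  have "(\<integral>\<^sup>+t. epowr (ennreal (t powr enn2real (1 / p)) * (c * h t)) (enn2real r) \<partial>haar)
    = epowr c (enn2real r) * (\<integral>\<^sup>+t. epowr (ennreal (t powr enn2real (1 / p)) * h t) (enn2real r) \<partial>haar)"
    by (subst nn_integral_cmult[symmetric]) (auto simp: epowr_mult mult_ac)
  then show ?thesis
    using r R by (simp add: lorentz_functional_finite epowr_mult epowr_epowr)
qed

text \<open>
  Dominated convergence.  Convergence is only required where \<open>h\<close> is finite, which is the case almost
  everywhere: the rearrangements \<open>u\<^sub>n\<^sup>*\<^sup>*(t)\<close> may fail to converge where \<open>h\<^sup>*\<^sup>*(t) = \<infinity>\<close>.
\<close>

lemma lorentz_functional_tendsto_0:
  fixes u :: "nat \<Rightarrow> real \<Rightarrow> ennreal"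
  assumes [measurable]: "\<And>n. u n \<in> borel_measurable borel" "h \<in> borel_measurable borel"
    and r: "1 \<le> r" "r < \<infinity>"
    and le: "\<And>n t. 0 < t \<Longrightarrow> u n t \<le> h t" and fin: "lorentz_functional p r h < \<infinity>"
    and lim: "\<And>t. 0 < t \<Longrightarrow> h t < \<infinity> \<Longrightarrow> (\<lambda>n. u n t) \<longlonglongrightarrow> 0"
  shows "(\<lambda>n. lorentz_functional p r (u n)) \<longlonglongrightarrow> 0"
proof -
  have R: "1 \<le> enn2real r" using r by (cases r) auto
  let ?W = "\<lambda>h t. epowr (ennreal (t powr enn2real (1 / p)) * h t) (enn2real r)"
  have finW: "(\<integral>\<^sup>+t. ?W h t \<partial>haar) < \<infinity>"
    using fin r by (auto simp: lorentz_functional_finite simp flip: less_top)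
  then have "AE t in haar. ?W h t \<noteq> \<infinity>"
    by (intro nn_integral_noteq_infinite) auto
  moreover have "AE t in haar. 0 < t"
    by (rule AE_haarI) simp
  ultimately have "AE t in haar. (\<lambda>n. ?W (u n) t) \<longlonglongrightarrow> 0"
  proof eventually_elim
    case (elim t)
    then have "h t < \<infinity>" by (auto simp: ennreal_mult_eq_top_iff less_top)
    then have "(\<lambda>n. ennreal (t powr enn2real (1 / p)) * u n t) \<longlonglongrightarrow> ennreal (t powr enn2real (1 / p)) * 0"
      using elim by (intro ennreal_tendsto_cmult lim) auto
    then show ?case using R by (intro epowr_tendsto_0) auto
  qed
  then have "(\<lambda>n. \<integral>\<^sup>+t. ?W (u n) t \<partial>haar) \<longlonglongrightarrow> (\<integral>\<^sup>+t. 0 \<partial>haar)"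
    using R by (intro nn_integral_dominated_convergence[OF _ _ _ _ finW])
       (auto intro!: AE_haarI epowr_mono mult_left_mono le)
  then show ?thesis
    using r R by (simp add: lorentz_functional_finite) (intro epowr_tendsto_0, auto)
qed

lemma conjugate_exponent_cases:
  assumes "1 \<le> r" "r < \<infinity>" "1 / r + 1 / r' = (1 :: ennreal)"
  obtains "r = 1" "r' = \<infinity>"
  | R R' where "r = ennreal R" "r' = ennreal R'" "1 < R" "1 < R'" "1 / R + 1 / R' = 1"
proof -
  obtain R where R: "r = ennreal R" "1 \<le> R"
    using assms by (cases r) auto
  have inv: "1 / ennreal x = ennreal (1 / x)" if "0 < x" for x
    using that divide_ennreal[of 1 x] by simp
  show thesis
  proof (cases "r'")
    case (real R')
    have "R' \<noteq> 0" using assms real by (auto simp: ennreal_divide_zero)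
    then have R': "0 < R'" using real by simp
    then have eq: "1 / R + 1 / R' = 1"
      using assms(3) R real inv[of R] inv[of R'] by (simp flip: ennreal_plus)
    have "1 < R"
    proof (rule ccontr)
      assume "\<not> 1 < R"
      with R have "R = 1" by simp
      with eq R' show False by simp
    qed
    moreover have "1 < R'"
    proof -
      have "0 < 1 / R" using \<open>1 < R\<close> by simp
      with eq have "1 / R' < 1" by linarith
      then show ?thesis using R' by (simp add: field_simps)
    qed
    ultimately show thesis using that(2) R real eq by auto
  next
    case top
    then have "ennreal (1 / R) = 1" using assms(3) R inv[of R] by simp
    then have "R = 1" using R by simp
    then show thesis using that(1) R top by auto
  qed
qed

lemma conjugate_weights:
  assumes "1 \<le> p" "p < \<infinity>" "1 / p + 1 / p' = (1 :: ennreal)"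
  shows "0 < enn2real (1 / p)" "enn2real (1 / p) \<le> 1" "1 < p \<Longrightarrow> enn2real (1 / p) < 1"
    "enn2real (1 / p') = 1 - enn2real (1 / p)"
proof -
  have inv: "1 / ennreal x = ennreal (1 / x)" if "0 < x" for x
    using that divide_ennreal[of 1 x] by simp
  have "0 < enn2real (1 / p) \<and> enn2real (1 / p) \<le> 1 \<and> (1 < p \<longrightarrow> enn2real (1 / p) < 1) \<and>
    enn2real (1 / p') = 1 - enn2real (1 / p)"
    using assms
  proof (cases rule: conjugate_exponent_cases)
    case (2 P P')
    then have "enn2real (1 / p) = 1 / P" "enn2real (1 / p') = 1 / P'"
      by (simp_all add: inv)
    with 2 show ?thesis by simp
  qed simp
  then show "0 < enn2real (1 / p)" "enn2real (1 / p) \<le> 1" "1 < p \<Longrightarrow> enn2real (1 / p) < 1"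
    "enn2real (1 / p') = 1 - enn2real (1 / p)" by auto
qed

text \<open>
  Hoelder's inequality for \<open>dt/t\<close>, because \<open>t\<^bsup>1/p\<^esup> t\<^bsup>1/p'\<^esup> = t\<close>.
\<close>

lemma lorentz_Hoelder:
  assumes [measurable]: "h \<in> borel_measurable borel" "k \<in> borel_measurable borel"
    and p: "1 \<le> p" "p < \<infinity>" "1 / p + 1 / p' = 1"
    and r: "1 \<le> r" "r < \<infinity>" "1 / r + 1 / r' = 1"
  shows "(\<integral>\<^sup>+t\<in>{0<..}. h t * k t \<partial>lborel) \<le> lorentz_functional p r h * lorentz_functional p' r' k"
proof -
  define a where "a = enn2real (1 / p)"
  define H where "H = (\<lambda>t. ennreal (t powr a) * h t)"
  define G where "G = (\<lambda>t. ennreal (t powr (1 - a)) * k t)"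
  have a': "enn2real (1 / p') = 1 - a"
    using conjugate_weights[OF p] by (simp add: a_def)
  have [measurable]: "H \<in> borel_measurable borel" "G \<in> borel_measurable borel"
    by (simp_all add: H_def G_def)
  have "(\<integral>\<^sup>+t\<in>{0<..}. h t * k t \<partial>lborel) = (\<integral>\<^sup>+t. H t * G t \<partial>haar)"
  proof (subst nn_integral_haar, measurable, intro nn_integral_cong)
    fix t :: real
    have "ennreal (t powr a) * ennreal (t powr (1 - a)) * ennreal (1 / t) = 1" if "0 < t"
      using that by (simp add: powr_add[symmetric] flip: ennreal_mult)
    then have "0 < t \<Longrightarrow> H t * G t * ennreal (1 / t) = h t * k t"
      unfolding H_def G_def by (metis mult.assoc mult.commute mult_1)
    then show "h t * k t * indicator {0<..} t = H t * G t * ennreal (1 / t) * indicator {0<..} t"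
      by (auto simp: indicator_def)
  qed
  also have "\<dots> \<le> lorentz_functional p r h * lorentz_functional p' r' k"
    using r
  proof (cases rule: conjugate_exponent_cases)
    case 1
    have "(\<integral>\<^sup>+t. H t * G t \<partial>haar) \<le> (\<integral>\<^sup>+t. H t * lorentz_functional p' r' k \<partial>haar)"
    proof (intro nn_integral_mono_AE AE_haarI mult_left_mono)
      fix t :: real assume "0 < t"
      then show "G t \<le> lorentz_functional p' r' k"
        unfolding lorentz_functional_def using 1 by (auto simp: G_def a' intro!: SUP_upper2[of t])
    qed simp
    also have "\<dots> = (\<integral>\<^sup>+t. H t \<partial>haar) * lorentz_functional p' r' k"
      by (rule nn_integral_multc) measurable
    also have "(\<integral>\<^sup>+t. H t \<partial>haar) = lorentz_functional p r h"
      using 1 by (subst lorentz_functional_finite) (auto simp: H_def a_def)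
    finally show ?thesis .
  next
    case (2 R R')
    have "(\<integral>\<^sup>+t. H t * G t \<partial>haar)
      \<le> epowr (\<integral>\<^sup>+t. epowr (H t) R \<partial>haar) (1 / R) * epowr (\<integral>\<^sup>+t. epowr (G t) R' \<partial>haar) (1 / R')"
      using 2 by (intro Hoelder_nn_integral) auto
    also have "\<dots> = lorentz_functional p r h * lorentz_functional p' r' k"
      using 2 by (subst (1 2) lorentz_functional_finite) (auto simp: H_def G_def a' simp flip: a_def)
    finally show ?thesis .
  qed
  finally show ?thesis .
qed

text \<open>
  Jensen's inequality for the power \<open>R\<close> and weights \<open>k\<^sub>j\<close> of total mass at most \<open>\<kappa>\<close>.
\<close>

lemma weighted_power_mean:
  fixes k b :: "'i \<Rightarrow> ennreal"
  assumes J: "finite J" and R: "1 \<le> R" and \<kappa>: "0 < \<kappa>" "(\<Sum>j\<in>J. k j) \<le> ennreal \<kappa>"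
  shows "epowr (\<Sum>j\<in>J. k j * b j) R \<le> ennreal (\<kappa> powr (R - 1)) * (\<Sum>j\<in>J. k j * epowr (b j) R)"
proof (cases "R = 1")
  case True
  then show ?thesis using \<kappa> by simp
next
  case False
  define R' where "R' = R / (R - 1)"
  have R': "1 < R" "1 < R'" "1 / R' + 1 / R = 1"
    using False R by (auto simp: R'_def field_simps)
  have "k j * b j = epowr (k j) (1 / R') * (epowr (k j) (1 / R) * b j)" for j
    using R' by (simp add: mult.assoc[symmetric] epowr_add)
  then have "(\<Sum>j\<in>J. k j * b j) = (\<integral>\<^sup>+j. epowr (k j) (1 / R') * (epowr (k j) (1 / R) * b j) \<partial>count_space J)"
    using J by (simp add: nn_integral_count_space_finite)
  also have "\<dots> \<le> epowr (\<integral>\<^sup>+j. epowr (epowr (k j) (1 / R')) R' \<partial>count_space J) (1 / R')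
      * epowr (\<integral>\<^sup>+j. epowr (epowr (k j) (1 / R) * b j) R \<partial>count_space J) (1 / R)"
    using R' by (intro Hoelder_nn_integral) auto
  also have "\<dots> = epowr (\<Sum>j\<in>J. k j) (1 / R') * epowr (\<Sum>j\<in>J. k j * epowr (b j) R) (1 / R)"
    using J R' by (simp add: nn_integral_count_space_finite epowr_epowr epowr_mult)
  finally have "epowr (\<Sum>j\<in>J. k j * b j) R
    \<le> epowr (epowr (\<Sum>j\<in>J. k j) (1 / R') * epowr (\<Sum>j\<in>J. k j * epowr (b j) R) (1 / R)) R"
    using R by (intro epowr_mono) auto
  also have "\<dots> = epowr (\<Sum>j\<in>J. k j) (R - 1) * (\<Sum>j\<in>J. k j * epowr (b j) R)"
    using R' by (simp add: epowr_mult epowr_epowr R'_def)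
  also have "\<dots> \<le> epowr (ennreal \<kappa>) (R - 1) * (\<Sum>j\<in>J. k j * epowr (b j) R)"
    using R \<kappa> by (intro mult_right_mono epowr_mono) auto
  finally show ?thesis using \<kappa> by (simp add: epowr_ennreal)
qed

section \<open>A discrete Hardy inequality\<close>

text \<open>
  If \<open>F\<close> has measure \<open>\<tau>\<close>, then \<open>t\<^bsup>\<alpha>\<^esup> \<chi>\<^sub>F\<^sup>*\<^sup>*(t) = \<tau>\<^bsup>\<alpha>\<^esup> hardy_kernel \<alpha> (t / \<tau>)\<close>.
\<close>

definition hardy_kernel :: "real \<Rightarrow> real \<Rightarrow> real" where
  "hardy_kernel \<alpha> s = min (s powr \<alpha>) (s powr (\<alpha> - 1))"

lemma borel_measurable_hardy_kernel [measurable]: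
  assumes [measurable]: "f \<in> borel_measurable M"
  shows "(\<lambda>x. hardy_kernel \<alpha> (f x)) \<in> borel_measurable M"
  unfolding hardy_kernel_def by measurable

lemma hardy_kernel_nonneg: "0 \<le> hardy_kernel \<alpha> s"
  by (simp add: hardy_kernel_def)

lemma hardy_kernel_integral:
  assumes "0 < \<alpha>" "\<alpha> < 1"
  shows "(\<integral>\<^sup>+s. ennreal (hardy_kernel \<alpha> s) \<partial>haar) < \<infinity>"
proof -
  have "(\<integral>\<^sup>+s. ennreal (hardy_kernel \<alpha> s) \<partial>haar)
    \<le> (\<integral>\<^sup>+s. ennreal (s powr (\<alpha> - 1)) * indicator {0..1} s + ennreal (s powr (\<alpha> - 2)) * indicator {1..} s \<partial>lborel)"
  proof (subst nn_integral_haar, measurable, intro nn_integral_mono)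
    fix s :: real
    have *: "ennreal (hardy_kernel \<alpha> s) * ennreal (1 / s) \<le> ennreal (s powr (b - 1))"
      if "0 < s" "hardy_kernel \<alpha> s \<le> s powr b" for b
    proof -
      have "hardy_kernel \<alpha> s * (1 / s) \<le> s powr b * (1 / s)"
        using that by (intro mult_right_mono) auto
      also have "\<dots> = s powr (b - 1)"
        using that by (simp add: powr_diff)
      finally show ?thesis
        using that by (simp add: ennreal_leI hardy_kernel_nonneg flip: ennreal_mult)
    qed
    show "ennreal (hardy_kernel \<alpha> s) * ennreal (1 / s) * indicator {0<..} s
      \<le> ennreal (s powr (\<alpha> - 1)) * indicator {0..1} s + ennreal (s powr (\<alpha> - 2)) * indicator {1..} s"
      using *[of \<alpha>] *[of "\<alpha> - 1"] by (auto simp: indicator_def hardy_kernel_def add_increasing2)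
  qed
  also have "\<dots> = (\<integral>\<^sup>+s. ennreal (s powr (\<alpha> - 1)) * indicator {0..1} s \<partial>lborel)
      + (\<integral>\<^sup>+s. ennreal (s powr (\<alpha> - 2)) * indicator {1..} s \<partial>lborel)"
    by (rule nn_integral_add) measurable
  also have "\<dots> < \<infinity>"
    using nn_integral_has_integral_lebesgue'[OF _ has_integral_powr_from_0[of "\<alpha> - 1" 1]]
      nn_integral_has_integral_lebesgue'[OF _ has_integral_powr_to_inf[of "\<alpha> - 2" 1]] assms
    by simp
  finally show ?thesis .
qed

text \<open>
  The two geometric series that majorise the sum of \<open>hardy_kernel \<alpha> (t / 2\<^sup>j)\<close> over all integers \<open>j\<close>:
  one for \<open>2\<^sup>j \<le> t\<close>, one for \<open>2\<^sup>j > t\<close>.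
\<close>

definition hardy_sum :: "real \<Rightarrow> real" where
  "hardy_sum \<alpha> = 1 / (1 - 2 powr (\<alpha> - 1)) + 1 / (1 - 2 powr (- \<alpha>))"

lemma sum_geometric_le:
  fixes x :: real
  assumes x: "0 \<le> x" "x < 1" and J: "finite J" and inj: "inj_on h J"
  shows "(\<Sum>j\<in>J. x ^ h j) \<le> 1 / (1 - x)"
proof -
  have "(\<Sum>j\<in>J. x ^ h j) = (\<Sum>n\<in>h ` J. x ^ n)"
    using inj by (simp add: sum.reindex)
  also have "\<dots> \<le> (\<Sum>n. x ^ n)"
    using x J by (intro sum_le_suminf) auto
  also have "\<dots> = 1 / (1 - x)"
    using x by (intro suminf_geometric) auto
  finally show ?thesis .
qed

lemma hardy_sum_pos:
  assumes "0 < \<alpha>" "\<alpha> < 1"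
  shows "1 \<le> hardy_sum \<alpha>"
proof -
  have "2 powr (\<alpha> - 1) < (1::real)" "2 powr (- \<alpha>) < (1::real)"
    using assms powr_less_mono[of "\<alpha> - 1" 0 2] powr_less_mono[of "- \<alpha>" 0 2] by auto
  then have "1 \<le> 1 / (1 - 2 powr (\<alpha> - 1) :: real)" "0 \<le> 1 / (1 - 2 powr (- \<alpha>) :: real)"
    by (auto simp: field_simps)
  then show ?thesis unfolding hardy_sum_def by linarith
qed

abbreviation dyadic :: "int \<Rightarrow> real" where
  "dyadic j \<equiv> 2 powr real_of_int j"

lemma dyadic_floor:
  assumes "0 < t"
  obtains m :: int where "dyadic m \<le> t" "t < dyadic (m + 1)"
proof (rule that[of "\<lfloor>log 2 t\<rfloor>"])
  show "dyadic \<lfloor>log 2 t\<rfloor> \<le> t"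
    using assms by (subst le_log_iff[symmetric]) auto
  show "t < dyadic (\<lfloor>log 2 t\<rfloor> + 1)"
    using assms by (subst log_less_iff[symmetric]) auto
qed

lemma hardy_kernel_sum:
  assumes \<alpha>: "0 < \<alpha>" "\<alpha> < 1" and J: "finite J" and t: "0 < t"
  shows "(\<Sum>j\<in>J. hardy_kernel \<alpha> (t / dyadic j)) \<le> hardy_sum \<alpha>"
proof -
  obtain m :: int where m: "dyadic m \<le> t" "t < dyadic (m + 1)"
    using dyadic_floor[OF t] .
  have x: "2 powr (\<alpha> - 1) < (1::real)" "2 powr (- \<alpha>) < (1::real)"
    using \<alpha> powr_less_mono[of "\<alpha> - 1" 0 2] powr_less_mono[of "- \<alpha>" 0 2] by auto
  have low: "hardy_kernel \<alpha> (t / dyadic j) \<le> (2 powr (\<alpha> - 1)) ^ nat (m - j)" if "j \<le> m" for j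
  proof -
    have "hardy_kernel \<alpha> (t / dyadic j) \<le> (t / dyadic j) powr (\<alpha> - 1)"
      by (simp add: hardy_kernel_def)
    also have "\<dots> \<le> (dyadic m / dyadic j) powr (\<alpha> - 1)"
      using \<alpha> m t by (intro powr_mono2') (auto simp: divide_right_mono)
    also have "\<dots> = (2 powr (\<alpha> - 1)) ^ nat (m - j)"
      using that by (simp add: powr_diff[symmetric] powr_powr powr_realpow[symmetric] mult.commute)
    finally show ?thesis .
  qed
  have high: "hardy_kernel \<alpha> (t / dyadic j) \<le> (2 powr (- \<alpha>)) ^ nat (j - m - 1)" if "m < j" for j
  proof -
    have "hardy_kernel \<alpha> (t / dyadic j) \<le> (t / dyadic j) powr \<alpha>"
      by (simp add: hardy_kernel_def)
    also have "\<dots> \<le> (dyadic (m + 1) / dyadic j) powr \<alpha>"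
      using \<alpha> m t by (intro powr_mono2) (auto simp: divide_right_mono)
    also have "\<dots> = (2 powr (- \<alpha>)) ^ nat (j - m - 1)"
      using that by (simp add: powr_diff[symmetric] powr_powr powr_realpow[symmetric] algebra_simps)
    finally show ?thesis .
  qed
  have "(\<Sum>j\<in>J. hardy_kernel \<alpha> (t / dyadic j))
    = (\<Sum>j\<in>{j\<in>J. j \<le> m} \<union> {j\<in>J. m < j}. hardy_kernel \<alpha> (t / dyadic j))"
    by (intro sum.cong) auto
  also have "\<dots> = (\<Sum>j\<in>{j\<in>J. j \<le> m}. hardy_kernel \<alpha> (t / dyadic j))
      + (\<Sum>j\<in>{j\<in>J. m < j}. hardy_kernel \<alpha> (t / dyadic j))"
    using J by (intro sum.union_disjoint) auto
  also have "\<dots> \<le> (\<Sum>j\<in>{j\<in>J. j \<le> m}. (2 powr (\<alpha> - 1)) ^ nat (m - j)) + (\<Sum>j\<in>{j\<in>J. m < j}. (2 powr (- \<alpha>)) ^ nat (j - m - 1))"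
    using low high by (intro add_mono sum_mono) auto
  also have "\<dots> \<le> hardy_sum \<alpha>"
    unfolding hardy_sum_def using x J
    by (intro add_mono sum_geometric_le) (auto simp: inj_on_def)
  finally show ?thesis .
qed

lemma ideal_norm_lorentz:
  assumes "1 \<le> r" "r < \<infinity>"
  shows "ideal_norm M (\<lambda>f. lorentz_functional p r (rearrangement M f))"
  using assms lorentz_functional_cmult[of "rearrangement M _" r p]
  by unfold_locales (auto simp: ext[OF rearrangement_cmult] intro!: lorentz_functional_mono rearrangement_mono)

lemma ideal_norm_lorentz_avg:
  assumes "1 \<le> r" "r < \<infinity>"
  shows "ideal_norm M (\<lambda>f. lorentz_functional p r (averaged_rearrangement M f))"
  using assms lorentz_functional_cmult[of "averaged_rearrangement M _" r p]
  by unfold_locales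
     (auto simp: ext[OF averaged_rearrangement_cmult] intro!: lorentz_functional_mono averaged_rearrangement_mono)

lemma ennreal_sum_mult:
  assumes "\<And>j. j \<in> J \<Longrightarrow> 0 \<le> a j" "\<And>j. j \<in> J \<Longrightarrow> 0 \<le> b j"
  shows "ennreal (\<Sum>j\<in>J. a j * b j) = (\<Sum>j\<in>J. ennreal (a j) * ennreal (b j))"
proof -
  have "(\<Sum>j\<in>J. ennreal (a j) * ennreal (b j)) = (\<Sum>j\<in>J. ennreal (a j * b j))"
    using assms by (intro sum.cong refl ennreal_mult[symmetric]) auto
  also have "\<dots> = ennreal (\<Sum>j\<in>J. a j * b j)"
    using assms by (intro sum_ennreal) auto
  finally show ?thesis by simp
qed

definition hardy_const :: "real \<Rightarrow> real \<Rightarrow> real" where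
  "hardy_const \<alpha> R = (hardy_sum \<alpha> powr (R - 1) * enn2real (\<integral>\<^sup>+s. ennreal (hardy_kernel \<alpha> s) \<partial>haar)) powr (1 / R)"

context divisible_measure begin

text \<open>
  A discrete Hardy inequality.  With \<open>b\<^sub>j = \<tau>\<^sub>j\<^bsup>\<alpha>\<^esup> c\<^sub>j\<close>, \<open>averaged_rearrangement_sum_le\<close> bounds \<open>t\<^bsup>\<alpha>\<^esup> f\<^sup>*\<^sup>*(t)\<close>
  by the sum of the \<open>hardy_kernel \<alpha> (t / \<tau>\<^sub>j) b\<^sub>j\<close>.  Its power \<open>R\<close> is estimated by \<open>weighted_power_mean\<close>
  and integrated, where dilation invariance gives the same integral for every \<open>j\<close>.
\<close>

lemma lorentz_avg_sum_le:
  fixes c \<tau> :: "'i \<Rightarrow> real"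
  assumes r: "1 \<le> r" "r < \<infinity>" and \<alpha>: "enn2real (1 / p) = \<alpha>" "0 < \<alpha>" "\<alpha> < 1" and R: "enn2real r = R"
    and J: "finite J" and F: "\<And>j. j \<in> J \<Longrightarrow> F j \<in> sets M" and c: "\<And>j. j \<in> J \<Longrightarrow> 0 \<le> c j"
    and \<tau>: "\<And>j. j \<in> J \<Longrightarrow> 0 < \<tau> j" "\<And>j. j \<in> J \<Longrightarrow> emeasure M (F j) \<le> ennreal (\<tau> j)"
    and ker: "\<And>t. 0 < t \<Longrightarrow> (\<Sum>j\<in>J. hardy_kernel \<alpha> (t / \<tau> j)) \<le> hardy_sum \<alpha>"
  shows "lorentz_functional p r (averaged_rearrangement M (\<lambda>x. \<Sum>j\<in>J. c j * indicator (F j) x))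
    \<le> ennreal (hardy_const \<alpha> R * (\<Sum>j\<in>J. (\<tau> j powr \<alpha> * c j) powr R) powr (1 / R))"
proof -
  let ?f = "\<lambda>x. \<Sum>j\<in>J. c j * indicator (F j) x"
  define A where "A = (\<integral>\<^sup>+s. ennreal (hardy_kernel \<alpha> s) \<partial>haar)"
  define b where "b j = \<tau> j powr \<alpha> * c j" for j
  have [measurable]: "?f \<in> borel_measurable M" using F by measurable
  have R1: "1 \<le> R" using r R by (cases r) auto
  have S: "1 \<le> hardy_sum \<alpha>" using \<alpha> by (intro hardy_sum_pos)
  have Afin: "A < \<infinity>" unfolding A_def using \<alpha> by (intro hardy_kernel_integral)
  have "epowr (ennreal (t powr \<alpha>) * averaged_rearrangement M ?f t) R
     \<le> ennreal (hardy_sum \<alpha> powr (R - 1)) * (\<Sum>j\<in>J. ennreal (hardy_kernel \<alpha> (t / \<tau> j)) * epowr (ennreal (b j)) R)"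
    if t: "0 < t" for t
  proof -
    have "ennreal (t powr \<alpha>) * averaged_rearrangement M ?f t \<le> ennreal (t powr \<alpha>) * ennreal (\<Sum>j\<in>J. c j * min 1 (\<tau> j / t))"
      using J F c \<tau> t by (intro mult_left_mono averaged_rearrangement_sum_le) (auto intro: less_imp_le)
    also have "\<dots> = ennreal (\<Sum>j\<in>J. t powr \<alpha> * (c j * min 1 (\<tau> j / t)))"
    proof (subst ennreal_mult[symmetric])
      have "0 \<le> \<tau> j" if "j \<in> J" for j using \<tau>(1)[OF that] by simp
      then show "0 \<le> (\<Sum>j\<in>J. c j * min 1 (\<tau> j / t))"
        using c t by (intro sum_nonneg mult_nonneg_nonneg) auto
    qed (simp_all add: sum_distrib_left)
    also have "(\<Sum>j\<in>J. t powr \<alpha> * (c j * min 1 (\<tau> j / t))) = (\<Sum>j\<in>J. hardy_kernel \<alpha> (t / \<tau> j) * b j)"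
    proof (intro sum.cong refl)
      fix j assume j: "j \<in> J"
      have "(t / \<tau> j) powr (\<alpha> - 1) = (t / \<tau> j) powr \<alpha> * (\<tau> j / t)"
        using \<tau>(1)[OF j] t by (simp add: powr_diff)
      then have "hardy_kernel \<alpha> (t / \<tau> j) = (t / \<tau> j) powr \<alpha> * min 1 (\<tau> j / t)"
        by (simp add: hardy_kernel_def min_mult_distrib_left)
      also have "\<dots> * b j = t powr \<alpha> * (c j * min 1 (\<tau> j / t))"
        using \<tau>(1)[OF j] t by (simp add: b_def powr_divide)
      finally show "t powr \<alpha> * (c j * min 1 (\<tau> j / t)) = hardy_kernel \<alpha> (t / \<tau> j) * b j" by simp
    qed
    also have "ennreal \<dots> = (\<Sum>j\<in>J. ennreal (hardy_kernel \<alpha> (t / \<tau> j)) * ennreal (b j))"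
      using c by (intro ennreal_sum_mult) (auto simp: b_def hardy_kernel_nonneg)
    finally have "epowr (ennreal (t powr \<alpha>) * averaged_rearrangement M ?f t) R
      \<le> epowr (\<Sum>j\<in>J. ennreal (hardy_kernel \<alpha> (t / \<tau> j)) * ennreal (b j)) R"
      using R1 by (intro epowr_mono) auto
    also have "\<dots> \<le> ennreal (hardy_sum \<alpha> powr (R - 1)) * (\<Sum>j\<in>J. ennreal (hardy_kernel \<alpha> (t / \<tau> j)) * epowr (ennreal (b j)) R)"
    proof (rule weighted_power_mean[OF J R1])
      show "(\<Sum>j\<in>J. ennreal (hardy_kernel \<alpha> (t / \<tau> j))) \<le> ennreal (hardy_sum \<alpha>)"
        using ker[OF t] by (subst sum_ennreal) (auto simp: hardy_kernel_nonneg intro: ennreal_leI)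
    qed (use S in simp)
    finally show ?thesis .
  qed
  then have "(\<integral>\<^sup>+t. epowr (ennreal (t powr \<alpha>) * averaged_rearrangement M ?f t) R \<partial>haar)
    \<le> (\<integral>\<^sup>+t. ennreal (hardy_sum \<alpha> powr (R - 1)) * (\<Sum>j\<in>J. ennreal (hardy_kernel \<alpha> (t / \<tau> j)) * epowr (ennreal (b j)) R) \<partial>haar)"
    by (intro nn_integral_mono_AE AE_haarI)
  also have "\<dots> = ennreal (hardy_sum \<alpha> powr (R - 1)) * (\<Sum>j\<in>J. A * epowr (ennreal (b j)) R)"
  proof -
    have "(\<integral>\<^sup>+t. ennreal (hardy_kernel \<alpha> (t / \<tau> j)) \<partial>haar) = A" if "j \<in> J" for j
      unfolding A_def by (rule nn_integral_haar_scale[OF _ \<tau>(1)[OF that]]) measurable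
    then show ?thesis
      by (simp add: nn_integral_cmult nn_integral_sum nn_integral_multc)
  qed
  also have "\<dots> = ennreal ((hardy_sum \<alpha> powr (R - 1) * enn2real A) * (\<Sum>j\<in>J. b j powr R))"
  proof -
    have "(\<Sum>j\<in>J. A * epowr (ennreal (b j)) R) = ennreal (enn2real A) * (\<Sum>j\<in>J. ennreal (b j powr R))"
      using Afin c by (simp add: sum_distrib_left[symmetric] epowr_ennreal b_def)
    also have "\<dots> = ennreal (enn2real A * (\<Sum>j\<in>J. b j powr R))"
      by (simp add: sum_nonneg ennreal_mult)
    finally show ?thesis by (simp add: ennreal_mult sum_nonneg mult.assoc)
  qed
  finally have le: "(\<integral>\<^sup>+t. epowr (ennreal (t powr \<alpha>) * averaged_rearrangement M ?f t) R \<partial>haar)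
    \<le> ennreal ((hardy_sum \<alpha> powr (R - 1) * enn2real A) * (\<Sum>j\<in>J. b j powr R))" .
  have "lorentz_functional p r (averaged_rearrangement M ?f)
    = epowr (\<integral>\<^sup>+t. epowr (ennreal (t powr \<alpha>) * averaged_rearrangement M ?f t) R \<partial>haar) (1 / R)"
    using r by (subst lorentz_functional_finite) (auto simp: \<alpha>(1) R)
  also have "\<dots> \<le> epowr (ennreal ((hardy_sum \<alpha> powr (R - 1) * enn2real A) * (\<Sum>j\<in>J. b j powr R))) (1 / R)"
    using R1 by (intro epowr_mono le) auto
  also have "\<dots> = ennreal (hardy_const \<alpha> R * (\<Sum>j\<in>J. b j powr R) powr (1 / R))"
    by (simp add: epowr_ennreal sum_nonneg powr_mult hardy_const_def A_def)
  finally show ?thesis by (simp add: b_def)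
qed

text \<open>
  The test function is \<open>\<Sum>\<^sub>j c\<^sub>j \<chi>(F\<^sub>j)\<close>, where \<open>F\<^sub>j\<close> has measure at most \<open>\<tau>\<^sub>j\<close> and carries at least the
  mass \<open>\<tau>\<^sub>j g\<^sup>*\<^sup>*(\<tau>\<^sub>j)\<close> of \<open>|g|\<close>.
\<close>

lemma koethe_lorentz_avg_sum:
  fixes c \<tau> :: "'i \<Rightarrow> real" and p r :: ennreal
  defines "K \<equiv> koethe_norm M (\<lambda>f. lorentz_functional p r (averaged_rearrangement M f))"
  assumes r: "1 \<le> r" "r < \<infinity>" and \<alpha>: "enn2real (1 / p) = \<alpha>" "0 < \<alpha>" "\<alpha> < 1" and R: "enn2real r = R"
    and J: "finite J" and c: "\<And>j. j \<in> J \<Longrightarrow> 0 \<le> c j" and \<tau>: "\<And>j. j \<in> J \<Longrightarrow> 0 < \<tau> j"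
    and ker: "\<And>t. 0 < t \<Longrightarrow> (\<Sum>j\<in>J. hardy_kernel \<alpha> (t / \<tau> j)) \<le> hardy_sum \<alpha>"
    and g[measurable]: "g \<in> borel_measurable M" and fin: "K g < \<infinity>"
  shows "(\<Sum>j\<in>J. ennreal (c j * \<tau> j) * averaged_rearrangement M g (\<tau> j))
    \<le> ennreal (hardy_const \<alpha> R * (\<Sum>j\<in>J. (\<tau> j powr \<alpha> * c j) powr R) powr (1 / R)) * K g"
proof -
  interpret N: ideal_norm M "\<lambda>f. lorentz_functional p r (averaged_rearrangement M f)"
    using r by (rule ideal_norm_lorentz_avg)
  have "\<exists>F. \<forall>j\<in>J. F j \<in> sets M \<and> emeasure M (F j) \<le> ennreal (\<tau> j) \<and>
    (\<integral>\<^sup>+s\<in>{0<..<\<tau> j}. rearrangement M g s \<partial>lborel) \<le> (\<integral>\<^sup>+x\<in>F j. ennreal \<bar>g x\<bar> \<partial>M)"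
    using ex_set_rearrangement[OF g less_imp_le[OF \<tau>]] by (intro bchoice) auto
  then obtain F where F: "\<And>j. j \<in> J \<Longrightarrow> F j \<in> sets M" "\<And>j. j \<in> J \<Longrightarrow> emeasure M (F j) \<le> ennreal (\<tau> j)"
    "\<And>j. j \<in> J \<Longrightarrow> (\<integral>\<^sup>+s\<in>{0<..<\<tau> j}. rearrangement M g s \<partial>lborel) \<le> (\<integral>\<^sup>+x\<in>F j. ennreal \<bar>g x\<bar> \<partial>M)"
    by blast
  let ?f = "\<lambda>x. \<Sum>j\<in>J. c j * indicator (F j) x"
  have [measurable]: "?f \<in> borel_measurable M" using F by measurable
  have Nf: "lorentz_functional p r (averaged_rearrangement M ?f)
    \<le> ennreal (hardy_const \<alpha> R * (\<Sum>j\<in>J. (\<tau> j powr \<alpha> * c j) powr R) powr (1 / R))" (is "?N \<le> ennreal ?B")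
    by (rule lorentz_avg_sum_le[OF r \<alpha> R J F(1) c \<tau> F(2) ker])
  then have fX: "?f \<in> ideal_space M (\<lambda>f. lorentz_functional p r (averaged_rearrangement M f))"
    by (auto simp: ideal_space_def intro: le_less_trans)
  have "(\<Sum>j\<in>J. ennreal (c j * \<tau> j) * averaged_rearrangement M g (\<tau> j))
    \<le> (\<Sum>j\<in>J. ennreal (c j) * (\<integral>\<^sup>+x\<in>F j. ennreal \<bar>g x\<bar> \<partial>M))"
  proof (intro sum_mono)
    fix j assume j: "j \<in> J"
    have "ennreal (c j * \<tau> j) * averaged_rearrangement M g (\<tau> j)
      = ennreal (c j * \<tau> j * (1 / \<tau> j)) * (\<integral>\<^sup>+s\<in>{0<..<\<tau> j}. rearrangement M g s \<partial>lborel)"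
      unfolding averaged_rearrangement_def using c[OF j] \<tau>[OF j]
      by (subst ennreal_mult[of "c j * \<tau> j"]) (auto simp: mult.assoc)
    also have "c j * \<tau> j * (1 / \<tau> j) = c j" using \<tau>[OF j] by simp
    finally show "ennreal (c j * \<tau> j) * averaged_rearrangement M g (\<tau> j)
      \<le> ennreal (c j) * (\<integral>\<^sup>+x\<in>F j. ennreal \<bar>g x\<bar> \<partial>M)"
      using F(3)[OF j] by (simp add: mult_left_mono)
  qed
  also have "\<dots> = (\<integral>\<^sup>+x. (\<Sum>j\<in>J. ennreal (c j) * (ennreal \<bar>g x\<bar> * indicator (F j) x)) \<partial>M)"
    using F(1) by (subst nn_integral_sum) (auto simp: nn_integral_cmult)
  also have "\<dots> = (\<integral>\<^sup>+x. ennreal \<bar>?f x * g x\<bar> \<partial>M)"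
  proof (intro nn_integral_cong)
    fix x
    have "ennreal \<bar>?f x * g x\<bar> = ennreal (\<Sum>j\<in>J. c j * indicator (F j) x) * ennreal \<bar>g x\<bar>"
      using c by (simp add: abs_mult ennreal_mult abs_of_nonneg sum_nonneg)
    also have "ennreal (\<Sum>j\<in>J. c j * indicator (F j) x) = (\<Sum>j\<in>J. ennreal (c j) * indicator (F j) x)"
      using c by (subst ennreal_sum_mult) (auto simp: ennreal_indicator)
    finally show "(\<Sum>j\<in>J. ennreal (c j) * (ennreal \<bar>g x\<bar> * indicator (F j) x)) = ennreal \<bar>?f x * g x\<bar>"
      by (simp add: sum_distrib_left mult_ac)
  qed
  also have "\<dots> \<le> ?N * K g"
    unfolding K_def using fX g fin[unfolded K_def] by (rule N.koethe_Hoelder)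
  also have "\<dots> \<le> ennreal ?B * K g"
    by (intro mult_right_mono Nf) simp
  finally show ?thesis .
qed

text \<open>
  The case of a single set.  It is the whole lower bound when \<open>r = 1\<close>, and for other \<open>r\<close> it shows that
  \<open>g\<^sup>*\<^sup>*\<close> is finite.
\<close>

lemma koethe_lorentz_avg_single:
  fixes p r :: ennreal
  defines "K \<equiv> koethe_norm M (\<lambda>f. lorentz_functional p r (averaged_rearrangement M f))"
  assumes r: "1 \<le> r" "r < \<infinity>" and \<alpha>: "enn2real (1 / p) = \<alpha>" "0 < \<alpha>" "\<alpha> < 1" and R: "enn2real r = R"
    and t: "0 < t" and g[measurable]: "g \<in> borel_measurable M" and fin: "K g < \<infinity>"
  shows "ennreal (t powr (1 - \<alpha>)) * averaged_rearrangement M g t \<le> ennreal (hardy_const \<alpha> R) * K g"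
proof -
  have R1: "1 \<le> R" using r R by (cases r) auto
  have "hardy_kernel \<alpha> s \<le> 1" if "0 < s" for s
    using \<alpha> that powr_le1[of \<alpha> s] powr_mono2'[of "\<alpha> - 1" 1 s]
    by (cases "s \<le> 1") (auto simp: hardy_kernel_def min_def)
  then have ker: "(\<Sum>j\<in>{()}. hardy_kernel \<alpha> (s / t)) \<le> hardy_sum \<alpha>" if "0 < s" for s
    using that t hardy_sum_pos[OF \<alpha>(2,3)] by (simp add: order_trans[of _ 1])
  have "(\<Sum>j\<in>{()}. ennreal (t powr (- \<alpha>) * t) * averaged_rearrangement M g t)
    \<le> ennreal (hardy_const \<alpha> R * (\<Sum>j\<in>{()}. (t powr \<alpha> * t powr (- \<alpha>)) powr R) powr (1 / R)) * K g"
    unfolding K_def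
    by (rule koethe_lorentz_avg_sum[OF r \<alpha> R _ _ _ ker g fin[unfolded K_def]]) (use t in auto)
  moreover have "t powr (- \<alpha>) * t = t powr (1 - \<alpha>)" "t powr \<alpha> * t powr (- \<alpha>) = 1"
    using t by (simp_all add: powr_diff powr_minus field_simps)
  ultimately show ?thesis by simp
qed

end

section \<open>Lower bound for the Koethe norm of averaged Lorentz spaces\<close>

lemma haar_dyadic_le:
  assumes "0 < \<tau>"
  shows "(\<integral>\<^sup>+t. indicator {\<tau>..<2 * \<tau>} t \<partial>haar) \<le> 1"
proof -
  have "(\<integral>\<^sup>+t. indicator {\<tau>..<2 * \<tau>} t \<partial>haar) \<le> (\<integral>\<^sup>+t. ennreal (1 / \<tau>) * indicator {\<tau>..<2 * \<tau>} t \<partial>lborel)"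
    using assms by (subst nn_integral_haar, measurable, intro nn_integral_mono)
      (auto simp: indicator_def intro!: ennreal_leI divide_left_mono mult_pos_pos)
  also have "\<dots> = 1"
    using assms by (simp add: nn_integral_cmult_indicator flip: ennreal_mult)
  finally show ?thesis .
qed

text \<open>
  For \<open>2\<^sup>j \<le> t < 2 * 2\<^sup>j\<close>, the value of \<open>t\<^bsup>\<beta>\<^esup> h(t)\<close> is at most \<open>2\<^bsup>\<beta>\<^esup>\<close> times that at \<open>2\<^sup>j\<close>, and this
  interval has measure at most \<open>1\<close> for \<open>dt/t\<close>.
\<close>

lemma haar_dyadic_sum:
  fixes h :: "real \<Rightarrow> ennreal"
  assumes [measurable]: "h \<in> borel_measurable borel"
    and anti: "\<And>s t. 0 < s \<Longrightarrow> s \<le> t \<Longrightarrow> h t \<le> h s"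
    and \<beta>: "0 \<le> \<beta>" and R: "0 < R"
    and B: "\<And>n::nat. (\<Sum>j\<in>{- int n..<int n}. epowr (ennreal ((dyadic j) powr \<beta>) * h (dyadic j)) R) \<le> B"
  shows "(\<integral>\<^sup>+t. epowr (ennreal (t powr \<beta>) * h t) R \<partial>haar) \<le> epowr (ennreal (2 powr \<beta>)) R * B"
proof -
  let ?F = "\<lambda>t. epowr (ennreal (t powr \<beta>) * h t) R"
  let ?I = "\<lambda>n::nat. {2 powr - real n..<2 powr real n}"
  have part: "(\<integral>\<^sup>+t. ?F t * indicator (?I n) t \<partial>haar) \<le> epowr (ennreal (2 powr \<beta>)) R * B" for n
  proof -
    let ?J = "{- int n..<int n}"
    define a where "a j = ennreal ((dyadic j) powr \<beta>) * h (dyadic j)" for j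
    have "(\<integral>\<^sup>+t. ?F t * indicator (?I n) t \<partial>haar)
      \<le> (\<integral>\<^sup>+t. (\<Sum>j\<in>?J. epowr (ennreal (2 powr \<beta>) * a j) R * indicator {dyadic j..<2 * dyadic j} t) \<partial>haar)"
    proof (intro nn_integral_mono_AE AE_haarI)
      fix t :: real assume t: "0 < t"
      show "?F t * indicator (?I n) t
        \<le> (\<Sum>j\<in>?J. epowr (ennreal (2 powr \<beta>) * a j) R * indicator {dyadic j..<2 * dyadic j} t)"
      proof (cases "t \<in> ?I n")
        case True
        obtain m :: int where m: "dyadic m \<le> t" "t < dyadic (m + 1)"
          using dyadic_floor[OF t] .
        have "2 powr - real n < dyadic (m + 1)" "dyadic m < 2 powr real n"
          using le_less_trans[of "2 powr - real n" t "dyadic (m + 1)"]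
            le_less_trans[of "dyadic m" t "2 powr real n"] True m by (auto simp only: atLeastLessThan_iff)
        then have "- real n < real_of_int (m + 1)" "real_of_int m < real n"
          by (simp_all del: of_int_add)
        then have mJ: "m \<in> ?J" by auto
        have m2: "t < 2 * dyadic m"
          using m(2) by (simp add: powr_add mult.commute)
        have "t powr \<beta> \<le> (2 * dyadic m) powr \<beta>"
          using t m2 \<beta> by (intro powr_mono2) auto
        then have "ennreal (t powr \<beta>) * h t \<le> ennreal ((2 * dyadic m) powr \<beta>) * h (dyadic m)"
          using m(1) by (intro mult_mono anti ennreal_leI) auto
        also have "\<dots> = ennreal (2 powr \<beta>) * a m"
          by (simp add: a_def powr_mult ennreal_mult mult.assoc)
        finally have "?F t * indicator (?I n) t \<le> epowr (ennreal (2 powr \<beta>) * a m) R * indicator {dyadic m..<2 * dyadic m} t"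
          using True m(1) m2 R by (simp add: epowr_mono)
        also have "\<dots> \<le> (\<Sum>j\<in>?J. epowr (ennreal (2 powr \<beta>) * a j) R * indicator {dyadic j..<2 * dyadic j} t)"
          by (rule member_le_sum[OF mJ]) auto
        finally show ?thesis .
      qed simp
    qed
    also have "\<dots> = (\<Sum>j\<in>?J. epowr (ennreal (2 powr \<beta>) * a j) R * (\<integral>\<^sup>+t. indicator {dyadic j..<2 * dyadic j} t \<partial>haar))"
      by (subst nn_integral_sum, measurable, intro sum.cong refl nn_integral_cmult, measurable)
    also have "\<dots> \<le> (\<Sum>j\<in>?J. epowr (ennreal (2 powr \<beta>) * a j) R * 1)"
      by (intro sum_mono mult_left_mono haar_dyadic_le) auto
    also have "\<dots> = epowr (ennreal (2 powr \<beta>)) R * (\<Sum>j\<in>?J. epowr (a j) R)"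
      by (simp add: epowr_mult sum_distrib_left)
    also have "\<dots> \<le> epowr (ennreal (2 powr \<beta>)) R * B"
      using B[of n] by (intro mult_left_mono) (auto simp: a_def)
    finally show ?thesis .
  qed
  have "(\<integral>\<^sup>+t. ?F t \<partial>haar) = (\<integral>\<^sup>+t. (SUP n. ?F t * indicator (?I n) t) \<partial>haar)"
  proof (intro nn_integral_cong_AE AE_haarI)
    fix t :: real assume t: "0 < t"
    obtain n :: nat where n: "\<bar>log 2 t\<bar> < real n" using reals_Archimedean2 by blast
    have "2 powr - real n \<le> 2 powr log 2 t" "2 powr log 2 t < 2 powr real n"
      using n by (auto simp del: powr_log_cancel)
    then have "t \<in> ?I n" using t by simp
    then have "?F t \<le> ?F t * indicator (?I n) t" by simp
    then have "?F t \<le> (SUP n. ?F t * indicator (?I n) t)"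
      by (rule SUP_upper2[rotated]) simp
    moreover have "(SUP n. ?F t * indicator (?I n) t) \<le> ?F t"
      by (intro SUP_least) (auto simp: indicator_def)
    ultimately show "?F t = (SUP n. ?F t * indicator (?I n) t)" by (rule antisym)
  qed
  also have "\<dots> = (SUP n. \<integral>\<^sup>+t. ?F t * indicator (?I n) t \<partial>haar)"
  proof (rule nn_integral_monotone_convergence_SUP)
    show "incseq (\<lambda>n t. ?F t * indicator (?I n) t)"
    proof (intro incseq_SucI le_funI mult_left_mono)
      fix n t
      have "2 powr - real (Suc n) \<le> (2 powr - real n :: real)" "2 powr real n \<le> (2 powr real (Suc n) :: real)"
        by (intro powr_mono; simp)+
      then have "?I n \<subseteq> ?I (Suc n)"
        by (auto simp only: atLeastLessThan_iff intro: order_trans less_le_trans)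
      then show "indicator (?I n) t \<le> (indicator (?I (Suc n)) t :: ennreal)"
        by (intro indicator_leI) (rule subsetD)
    qed simp
  qed measurable
  also have "\<dots> \<le> epowr (ennreal (2 powr \<beta>)) R * B"
    by (intro SUP_least part)
  finally show ?thesis .
qed

text \<open>
  The converse of Hoelder's inequality: for \<open>l = (\<eta> / u)\<^bsup>q' - 1\<^esup> / u\<close> both sums in the hypothesis
  equal the sum in the conclusion.
\<close>

lemma finite_lq_converse:
  fixes q q' :: real
  assumes q: "1 < q" "1 < q'" "1 / q + 1 / q' = 1"
    and \<eta>: "\<And>k. k \<in> J \<Longrightarrow> 0 \<le> \<eta> k" and u: "\<And>k. k \<in> J \<Longrightarrow> 0 < u k" and B: "0 \<le> B"
    and bound: "\<And>l. (\<And>k. k \<in> J \<Longrightarrow> 0 \<le> l k) \<Longrightarrow>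
      (\<Sum>k\<in>J. l k * \<eta> k) \<le> B * (\<Sum>k\<in>J. (u k * l k) powr q) powr (1 / q)"
  shows "(\<Sum>k\<in>J. (\<eta> k / u k) powr q') \<le> B powr q'"
proof -
  define S where "S = (\<Sum>k\<in>J. (\<eta> k / u k) powr q')"
  have qq: "(q' - 1) * q = q'" using q by (auto simp: field_simps)
  let ?l = "\<lambda>k. (\<eta> k / u k) powr (q' - 1) / u k"
  have 1: "?l k * \<eta> k = (\<eta> k / u k) powr q'" if "k \<in> J" for k
    using u[OF that] \<eta>[OF that] by (cases "\<eta> k = 0") (auto simp: powr_diff)
  have 2: "(u k * ?l k) powr q = (\<eta> k / u k) powr q'" if "k \<in> J" for k
    using u[OF that] by (simp add: powr_powr qq)
  have "S \<le> B * S powr (1 / q)"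
    using bound[of ?l] u 1 2 by (simp add: S_def less_imp_le)
  moreover have "0 \<le> S" by (simp add: S_def sum_nonneg)
  ultimately show ?thesis
  proof (cases "S = 0")
    case False
    then have Sp: "0 < S" using \<open>0 \<le> S\<close> by simp
    have "S powr (1 / q') * S powr (1 / q) = S"
      using Sp q by (simp add: powr_add[symmetric] add.commute)
    then have "S powr (1 / q') * S powr (1 / q) \<le> B * S powr (1 / q)"
      using \<open>S \<le> B * S powr (1 / q)\<close> by simp
    then have "S powr (1 / q') \<le> B"
      using Sp by (simp add: mult_le_cancel_right)
    then have "(S powr (1 / q')) powr q' \<le> B powr q'"
      using q by (intro powr_mono2) auto
    then show ?thesis using q Sp by (simp add: powr_powr S_def)
  qed (simp add: S_def)
qed

context divisible_measure begin

text \<open>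
  By \<open>koethe_lorentz_avg_sum\<close> for \<open>\<tau>\<^sub>j = 2\<^sup>j\<close>, with arbitrary coefficients, and \<open>finite_lq_converse\<close> the
  values of \<open>g\<^sup>*\<^sup>*\<close> at the powers of \<open>2\<close> are controlled, and they suffice by \<open>haar_dyadic_sum\<close>.  Adding
  \<open>1\<close> makes the constant positive, so that the right hand side is \<open>\<infinity>\<close> when the Koethe norm is.
\<close>

theorem koethe_lorentz_avg_lower:
  fixes p r p' r' :: ennreal
  defines "K \<equiv> koethe_norm M (\<lambda>f. lorentz_functional p r (averaged_rearrangement M f))"
  assumes p: "1 < p" "p < \<infinity>" "1 / p + 1 / p' = 1"
    and r: "1 \<le> r" "r < \<infinity>" "1 / r + 1 / r' = 1"
    and g[measurable]: "g \<in> borel_measurable M"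
  shows "lorentz_functional p' r' (averaged_rearrangement M g)
    \<le> ennreal (2 * hardy_const (enn2real (1 / p)) (enn2real r) + 1) * K g"
    (is "lorentz_functional p' r' ?A \<le> _")
proof (cases "K g = \<infinity>")
  case True
  have "0 \<le> hardy_const (enn2real (1 / p)) (enn2real r)" by (simp add: hardy_const_def)
  then show ?thesis using True by (simp add: ennreal_mult_top)
next
  case False
  define \<alpha> where "\<alpha> = enn2real (1 / p)"
  define C where "C = hardy_const \<alpha> (enn2real r)"
  have C: "0 \<le> C" by (simp add: C_def hardy_const_def)
  have \<alpha>: "0 < \<alpha>" "\<alpha> < 1" and \<alpha>': "enn2real (1 / p') = 1 - \<alpha>"
    using conjugate_weights[of p p'] p by (auto simp: \<alpha>_def)
  have fin: "K g < \<infinity>" using False by (simp add: less_top)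
  have single: "ennreal (t powr (1 - \<alpha>)) * ?A t \<le> ennreal C * K g" if "0 < t" for t
    unfolding K_def C_def
    by (rule koethe_lorentz_avg_single[OF r(1,2) \<alpha>_def[symmetric] \<alpha> refl that g fin[unfolded K_def]])
  obtain k where k: "K g = ennreal k" "0 \<le> k" using fin by (cases "K g") auto
  have "lorentz_functional p' r' ?A \<le> ennreal (2 * C) * K g"
    using r
  proof (cases rule: conjugate_exponent_cases)
    case 1
    have "lorentz_functional p' r' ?A \<le> ennreal C * K g"
      unfolding lorentz_functional_def using 1 single by (auto simp: \<alpha>' intro!: SUP_least)
    also have "\<dots> \<le> ennreal (2 * C) * K g"
      using C by (intro mult_right_mono ennreal_leI) auto
    finally show ?thesis .
  next
    case (2 R R')
    have R: "enn2real r = R" "enn2real r' = R'" using 2 by auto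
    have "?A t < \<infinity>" if t: "0 < t" for t
    proof -
      have "ennreal C * K g < \<infinity>" using k by (simp flip: ennreal_mult add: C)
      then have "ennreal (t powr (1 - \<alpha>)) * ?A t < \<infinity>"
        using single[OF t] by (rule order.strict_trans1[rotated])
      then show ?thesis using t by (auto simp: ennreal_mult_less_top)
    qed
    then have G: "?A t = ennreal (enn2real (?A t))" if "0 < t" for t
      using that by simp
    define y where "y j = (dyadic j) powr (1 - \<alpha>) * enn2real (?A (dyadic j))" for j
    have y0: "0 \<le> y j" for j by (simp add: y_def)
    have y: "ennreal ((dyadic j) powr (1 - \<alpha>)) * ?A (dyadic j) = ennreal (y j)" for j
      unfolding y_def by (subst G) (simp_all add: ennreal_mult)
    have "(\<Sum>j\<in>{- int n..<int n}. epowr (ennreal (y j)) R') \<le> ennreal ((C * k) powr R')" for n :: nat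
    proof -
      let ?J = "{- int n..<int n}"
      let ?G = "\<lambda>j. enn2real (?A (dyadic j))"
      have "(\<Sum>j\<in>?J. c j * (dyadic j * ?G j))
        \<le> C * k * (\<Sum>j\<in>?J. ((dyadic j) powr \<alpha> * c j) powr R) powr (1 / R)"
        if c: "\<And>j. j \<in> ?J \<Longrightarrow> 0 \<le> c j" for c
      proof -
        have "ennreal (\<Sum>j\<in>?J. (c j * dyadic j) * ?G j)
          = (\<Sum>j\<in>?J. ennreal (c j * dyadic j) * ?A (dyadic j))"
          using c by (subst ennreal_sum_mult) (auto intro!: sum.cong simp: G[symmetric])
        also have "\<dots> \<le> ennreal (C * (\<Sum>j\<in>?J. ((dyadic j) powr \<alpha> * c j) powr R) powr (1 / R)) * K g"
          unfolding K_def C_def R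
          by (intro koethe_lorentz_avg_sum[OF r(1,2) \<alpha>_def[symmetric] \<alpha> R(1) _ c _ _ g fin[unfolded K_def]] hardy_kernel_sum \<alpha>)
            auto
        finally show ?thesis
          using k C by (simp add: mult_ac flip: ennreal_mult)
      qed
      then have "(\<Sum>j\<in>?J. (dyadic j * ?G j / (dyadic j) powr \<alpha>) powr R') \<le> (C * k) powr R'"
        using 2 C k by (intro finite_lq_converse[of R R']) auto
      moreover have "dyadic j * ?G j / (dyadic j) powr \<alpha> = y j" for j
        by (simp add: y_def powr_diff)
      ultimately show ?thesis
        using y0 by (simp add: epowr_ennreal ennreal_leI)
    qed
    then have "(\<integral>\<^sup>+t. epowr (ennreal (t powr (1 - \<alpha>)) * ?A t) R' \<partial>haar)
      \<le> epowr (ennreal (2 powr (1 - \<alpha>))) R' * ennreal ((C * k) powr R')"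
      using \<alpha> 2 by (intro haar_dyadic_sum averaged_rearrangement_antimono g) (auto simp: y)
    also have "\<dots> = epowr (ennreal (2 powr (1 - \<alpha>) * (C * k))) R'"
      using C k by (subst ennreal_mult) (simp_all add: epowr_mult epowr_ennreal)
    finally have "lorentz_functional p' r' ?A \<le> ennreal (2 powr (1 - \<alpha>) * (C * k))"
      using 2 by (subst lorentz_functional_finite) (auto simp: \<alpha>' R epowr_le_iff)
    also have "\<dots> \<le> ennreal (2 * (C * k))"
    proof -
      have "2 powr (1 - \<alpha>) \<le> 2 powr (1::real)" using \<alpha> by (intro powr_mono) auto
      then show ?thesis using C k by (intro ennreal_leI mult_right_mono) auto
    qed
    also have "\<dots> = ennreal (2 * C) * K g"
      using C k by (simp add: ennreal_mult mult.assoc)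
    finally show ?thesis .
  qed
  also have "\<dots> \<le> ennreal (2 * C + 1) * K g"
    using C by (intro mult_right_mono ennreal_leI) auto
  finally show ?thesis by (simp add: C_def \<alpha>_def)
qed

end

section \<open>Local duality for both kinds of Lorentz spaces\<close>

text \<open>
  The argument that both kinds of Lorentz norm share: dominated convergence carries the pointwise
  convergence of the rearrangements over to the norms.  Here \<open>\<rho>\<close> stands for \<open>f \<mapsto> f\<^sup>*\<close> or \<open>f \<mapsto> f\<^sup>*\<^sup>*\<close>.
\<close>

lemma (in finite_measure) order_continuous_lorentzI:
  assumes ideal: "ideal_norm M (\<lambda>f. lorentz_functional p r (\<rho> f))"
    and r: "1 \<le> r" "r < \<infinity>" and unit: "lorentz_functional p r (\<rho> (\<lambda>x. 1)) < \<infinity>"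
    and [measurable]: "\<And>f. f \<in> borel_measurable M \<Longrightarrow> \<rho> f \<in> borel_measurable borel"
    and mono: "\<And>f h t. f \<in> borel_measurable M \<Longrightarrow> h \<in> borel_measurable M \<Longrightarrow>
      AE x in M. \<bar>f x\<bar> \<le> \<bar>h x\<bar> \<Longrightarrow> \<rho> f t \<le> \<rho> h t"
    and lim: "\<And>u h t. \<lbrakk>\<And>n. u n \<in> borel_measurable M; h \<in> borel_measurable M;
        \<And>x. x \<in> space M \<Longrightarrow> (\<lambda>n. u n x) \<longlonglongrightarrow> 0; 0 < t;
        \<And>n x. x \<in> space M \<Longrightarrow> \<bar>u n x\<bar> \<le> h x; \<rho> h t < \<infinity>\<rbrakk> \<Longrightarrow> (\<lambda>n::nat. \<rho> (u n) t) \<longlonglongrightarrow> 0"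
  shows "order_continuous_ideal_norm M (\<lambda>f. lorentz_functional p r (\<rho> f))"
proof -
  let ?N = "\<lambda>f. lorentz_functional p r (\<rho> f)"
  interpret ideal_norm M ?N by (rule ideal)
  show ?thesis
  proof
    show "\<exists>w\<in>ideal_space M ?N. \<forall>x\<in>space M. 0 < w x"
      using unit by (intro bexI[of _ "\<lambda>x. 1"]) (auto simp: ideal_space_def)
    fix u :: "nat \<Rightarrow> 'a \<Rightarrow> real" and h
    assume u[measurable]: "\<And>n. u n \<in> borel_measurable M" and h: "h \<in> ideal_space M ?N"
      and bd: "\<And>n x. x \<in> space M \<Longrightarrow> \<bar>u n x\<bar> \<le> h x"
      and u0: "\<And>x. x \<in> space M \<Longrightarrow> (\<lambda>n. u n x) \<longlonglongrightarrow> 0"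
    have [measurable]: "h \<in> borel_measurable M" using h by (rule ideal_space_measurable)
    show "(\<lambda>n. ?N (u n)) \<longlonglongrightarrow> 0"
    proof (rule lorentz_functional_tendsto_0[where h = "\<rho> h"])
      show "?N h < \<infinity>" using h by (simp add: ideal_space_def)
      show "\<rho> (u n) t \<le> \<rho> h t" for n t
        by (intro mono AE_I2 order_trans[OF bd abs_ge_self]) auto
      show "(\<lambda>n. \<rho> (u n) t) \<longlonglongrightarrow> 0" if "0 < t" "\<rho> h t < \<infinity>" for t
        using that by (intro lim[where h = h] u0 bd) auto
    qed (use r in auto)
  qed
qed

context divisible_measure begin

lemma lorentz_avg_indicator_finite:
  assumes p: "1 < p" "p < \<infinity>" and r: "1 \<le> r" "r < \<infinity>"
  shows "lorentz_functional p r (averaged_rearrangement M (\<lambda>x. 1)) < \<infinity>"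
proof -
  obtain P where P: "p = ennreal P" "1 < P"
    using p by (cases p) auto
  then have \<alpha>: "enn2real (1 / p) = 1 / P"
    using divide_ennreal[of 1 P] by simp
  \<comment> \<open>One is added because the space may be a null set and the measures \<open>\<tau>\<^sub>j\<close> have to be positive.\<close>
  let ?\<tau> = "measure M (space M) + 1"
  interpret N: ideal_norm M "\<lambda>f. lorentz_functional p r (averaged_rearrangement M f)"
    using r by (rule ideal_norm_lorentz_avg)
  have "lorentz_functional p r (averaged_rearrangement M (\<lambda>x. 1))
    \<le> lorentz_functional p r (averaged_rearrangement M (\<lambda>x. \<Sum>j\<in>{0::int}. 1 * indicator (space M) x))"
    by (intro N.monotone) auto
  also have "\<dots> \<le> ennreal (hardy_const (1 / P) (enn2real r) * (\<Sum>j\<in>{0::int}. (?\<tau> powr (1 / P) * 1) powr enn2real r) powr (1 / enn2real r))"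
  proof (rule lorentz_avg_sum_le[OF r \<alpha>])
    show "(\<Sum>j\<in>{0::int}. hardy_kernel (1 / P) (t / ?\<tau>)) \<le> hardy_sum (1 / P)" if "0 < t" for t
      using hardy_kernel_sum[of "1 / P" "{0}" "t / ?\<tau>"] P that
      by (auto simp: add_nonneg_pos)
    show "emeasure M (space M) \<le> ennreal ?\<tau>"
      by (simp add: emeasure_eq_measure)
  qed (use P in \<open>auto simp: add_nonneg_pos\<close>)
  also have "\<dots> < \<infinity>" by simp
  finally show ?thesis .
qed

lemma lorentz_1_1_eq:
  assumes [measurable]: "f \<in> borel_measurable M"
  shows "lorentz_functional 1 1 (rearrangement M f) = (\<integral>\<^sup>+x. ennreal \<bar>f x\<bar> \<partial>M)"
proof -
  have "lorentz_functional 1 1 (rearrangement M f) = (\<integral>\<^sup>+t\<in>{0<..}. ennreal (t powr 1) * rearrangement M f t * ennreal (1 / t) \<partial>lborel)"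
    by (simp add: lorentz_functional_def)
  also have "\<dots> = (\<integral>\<^sup>+t\<in>{0<..}. rearrangement M f t \<partial>lborel)"
  proof (intro nn_integral_cong)
    fix t :: real
    have "ennreal (t powr 1) * ennreal (1 / t) = 1" if "0 < t"
      using that by (simp flip: ennreal_mult)
    then have "0 < t \<Longrightarrow> ennreal (t powr 1) * rearrangement M f t * ennreal (1 / t) = rearrangement M f t"
      by (metis mult.commute mult.left_commute mult_1_right)
    then show "ennreal (t powr 1) * rearrangement M f t * ennreal (1 / t) * indicator {0<..} t = rearrangement M f t * indicator {0<..} t"
      by (simp add: indicator_def)
  qed
  finally show ?thesis by (simp add: nn_integral_rearrangement_eq)
qed

lemma lorentz_le_avg:
  "lorentz_functional p r (rearrangement M f) \<le> lorentz_functional p r (averaged_rearrangement M f)"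
  by (intro lorentz_functional_mono rearrangement_le_averaged)

lemma order_continuous_lorentz_avg:
  assumes p: "1 < p" "p < \<infinity>" and r: "1 \<le> r" "r < \<infinity>"
  shows "order_continuous_ideal_norm M (\<lambda>f. lorentz_functional p r (averaged_rearrangement M f))"
  by (rule order_continuous_lorentzI[OF ideal_norm_lorentz_avg[OF r] r lorentz_avg_indicator_finite[OF p r]])
     (auto intro: averaged_rearrangement_mono averaged_rearrangement_tendsto_0)

lemma order_continuous_lorentz:
  assumes p: "1 \<le> p" "p < \<infinity>" and r: "1 \<le> r" "r \<le> p"
  shows "order_continuous_ideal_norm M (\<lambda>f. lorentz_functional p r (rearrangement M f))"
proof -
  have r': "r < \<infinity>" using p r by (auto intro: le_less_trans)
  have "lorentz_functional p r (rearrangement M (\<lambda>x. 1)) < \<infinity>"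
  proof (cases "p = 1")
    case True
    then show ?thesis using r lorentz_1_1_eq[of "\<lambda>x. 1"] by (simp add: emeasure_eq_measure)
  next
    case False
    then have "1 < p" using p by auto
    then show ?thesis
      using lorentz_avg_indicator_finite[of p r] p r(1) r' lorentz_le_avg by (auto intro: le_less_trans)
  qed
  then show ?thesis
    by (rule order_continuous_lorentzI[OF ideal_norm_lorentz[OF r(1) r'] r(1) r'])
       (auto intro: rearrangement_mono rearrangement_tendsto_0)
qed

lemma lorentz_integral_le:
  assumes p: "1 \<le> p" "p < \<infinity>" "1 / p + 1 / p' = 1"
    and r: "1 \<le> r" "r < \<infinity>" "1 / r + 1 / r' = 1"
    and [measurable]: "f \<in> borel_measurable M" "g \<in> borel_measurable M"
  shows "(\<integral>\<^sup>+x. ennreal \<bar>f x * g x\<bar> \<partial>M)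
    \<le> lorentz_functional p r (rearrangement M f) * lorentz_functional p' r' (rearrangement M g)"
  by (rule order_trans[OF Hardy_Littlewood lorentz_Hoelder[OF _ _ p r]]) measurable

lemma lorentz_avg_integral_le:
  assumes p: "1 \<le> p" "p < \<infinity>" "1 / p + 1 / p' = 1"
    and r: "1 \<le> r" "r < \<infinity>" "1 / r + 1 / r' = 1"
    and "f \<in> borel_measurable M" "g \<in> borel_measurable M"
  shows "(\<integral>\<^sup>+x. ennreal \<bar>f x * g x\<bar> \<partial>M)
    \<le> lorentz_functional p r (averaged_rearrangement M f) * lorentz_functional p' r' (averaged_rearrangement M g)"
  by (rule order_trans[OF lorentz_integral_le[OF assms] mult_mono]) (auto intro: lorentz_le_avg)

text \<open>
  For \<open>p > 1\<close> this follows from the averaged case: by \<open>f\<^sup>* \<le> f\<^sup>*\<^sup>*\<close>, passing to \<open>f\<^sup>*\<close> enlarges the unit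
  ball over which the Koethe norm is a supremum and decreases the left hand side.  For \<open>p = r = 1\<close> the
  left hand side is the essential supremum of \<open>|g|\<close>, and the normalised indicators of the level sets
  \<open>{|g| > l}\<close> are test functions of \<open>L\<^sup>1\<close> norm \<open>1\<close>.
\<close>

theorem koethe_lorentz_lower:
  fixes p r p' r' :: ennreal
  assumes p: "1 \<le> p" "p < \<infinity>" "1 / p + 1 / p' = 1"
    and r: "1 \<le> r" "r \<le> p" "1 / r + 1 / r' = 1"
    and g[measurable]: "g \<in> borel_measurable M"
  shows "lorentz_functional p' r' (rearrangement M g)
    \<le> ennreal (2 * hardy_const (enn2real (1 / p)) (enn2real r) + 1)
      * koethe_norm M (\<lambda>f. lorentz_functional p r (rearrangement M f)) g"
    (is "_ \<le> ennreal ?C * ?K g")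
proof (cases "p = 1")
  case False
  then have p1: "1 < p" using p by auto
  have r': "r < \<infinity>" using p r by (auto intro: le_less_trans)
  have "lorentz_functional p' r' (rearrangement M g) \<le> lorentz_functional p' r' (averaged_rearrangement M g)"
    by (rule lorentz_le_avg)
  also have "\<dots> \<le> ennreal ?C * koethe_norm M (\<lambda>f. lorentz_functional p r (averaged_rearrangement M f)) g"
    by (rule koethe_lorentz_avg_lower[OF p1 p(2,3) r(1) r' r(3) g])
  also have "\<dots> \<le> ennreal ?C * ?K g"
    unfolding koethe_norm_def
  proof (intro mult_left_mono SUP_subset_mono subsetI)
    fix f assume "f \<in> {f \<in> ideal_space M (\<lambda>f. lorentz_functional p r (averaged_rearrangement M f)).
      lorentz_functional p r (averaged_rearrangement M f) \<le> 1}"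
    then show "f \<in> {f \<in> ideal_space M (\<lambda>f. lorentz_functional p r (rearrangement M f)).
      lorentz_functional p r (rearrangement M f) \<le> 1}"
      using lorentz_le_avg[of p r f] by (auto simp: ideal_space_def intro: le_less_trans order_trans)
  qed auto
  finally show ?thesis .
next
  case True
  then have r1: "r = 1" using r by auto
  have "1 / p' = (0 :: ennreal)" "1 / r' = (0 :: ennreal)"
    using p(3) r(3) True r1 ennreal_add_left_cancel[of 1 "1 / p'" 0] ennreal_add_left_cancel[of 1 "1 / r'" 0] by auto
  then have inf: "r' = \<infinity>" "enn2real (1 / p') = 0"
    by (auto simp: ennreal_divide_eq_0_iff)
  have "lorentz_functional p' r' (rearrangement M g) \<le> ?K g"
    unfolding lorentz_functional_def[of p'] inf if_P[OF refl]
  proof (rule SUP_least, rule ennreal_le_of_less)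
    fix t l :: real assume t: "t \<in> {0<..}" and l: "0 \<le> l" and "ennreal l < ennreal (t powr 0) * rearrangement M g t"
    then have less: "ennreal l < rearrangement M g t" by simp
    define F where "F = {x \<in> space M. l < \<bar>g x\<bar>}"
    have [measurable]: "F \<in> sets M" by (simp add: F_def)
    have "ennreal t < emeasure M F"
      using less rearrangement_greater_iff[OF g l] by (simp add: distribution_def F_def)
    then have mF: "0 < measure M F" using t by (simp add: emeasure_eq_measure ennreal_less_iff)
    define f where "f = (\<lambda>x. 1 / measure M F * indicator F x)"
    have [measurable]: "f \<in> borel_measurable M" by (simp add: f_def)
    have "(\<integral>\<^sup>+x. ennreal \<bar>f x\<bar> \<partial>M) = (\<integral>\<^sup>+x. ennreal (1 / measure M F) * indicator F x \<partial>M)"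
      by (intro nn_integral_cong) (auto simp: f_def indicator_def)
    also have "\<dots> = 1"
      using mF by (simp add: nn_integral_cmult_indicator emeasure_eq_measure flip: ennreal_mult)
    finally have N1: "lorentz_functional p r (rearrangement M f) = 1"
      using True r1 lorentz_1_1_eq[of f] by simp
    have "ennreal l = (\<integral>\<^sup>+x. ennreal (l / measure M F) * indicator F x \<partial>M)"
      using mF l by (simp add: nn_integral_cmult_indicator emeasure_eq_measure flip: ennreal_mult)
    also have "\<dots> \<le> (\<integral>\<^sup>+x. ennreal \<bar>f x * g x\<bar> \<partial>M)"
      using mF by (intro nn_integral_mono)
        (auto simp: f_def F_def indicator_def abs_mult intro!: ennreal_leI divide_right_mono)
    also have "\<dots> \<le> ?K g"
      unfolding koethe_norm_def using N1 by (intro SUP_upper) (auto simp: ideal_space_def)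
    finally show "ennreal l \<le> ?K g" .
  qed
  also have "?K g = ennreal 1 * ?K g" by simp
  also have "\<dots> \<le> ennreal ?C * ?K g"
    by (intro mult_right_mono ennreal_leI) (auto simp: hardy_const_def)
  finally show ?thesis .
qed

end

section \<open>Pieces, gluing and weighted sequence spaces\<close>

lemma nn_integral_idx: "(\<integral>\<^sup>+k. F k \<partial>count_space idx) = (\<Sum>n. F (int n - 1))"
proof -
  have "bij_betw (\<lambda>n. int n - 1) UNIV idx"
    by (rule bij_betw_byWitness[where f' = "\<lambda>k. nat (k + 1)"]) (auto simp: idx_def)
  from nn_integral_bij_count_space[OF this, of F] show ?thesis
    by (simp add: nn_integral_count_space_nat)
qed

lemma nn_integral_idx_le:
  assumes "\<And>J. finite J \<Longrightarrow> J \<subseteq> idx \<Longrightarrow> (\<Sum>k\<in>J. F k) \<le> B"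
  shows "(\<integral>\<^sup>+k. F k \<partial>count_space idx) \<le> B"
proof -
  have "(\<Sum>n<N. F (int n - 1)) \<le> B" for N
  proof -
    have "(\<Sum>n<N. F (int n - 1)) = (\<Sum>k\<in>(\<lambda>n. int n - 1) ` {..<N}. F k)"
      by (subst sum.reindex) (auto simp: inj_on_def)
    also have "\<dots> \<le> B"
      by (rule assms) (auto simp: idx_def)
    finally show ?thesis .
  qed
  then show ?thesis
    unfolding nn_integral_idx suminf_eq_SUP by (intro SUP_least)
qed

lemma piece_upper: "k \<in> idx \<Longrightarrow> x \<in> piece \<Omega> k \<Longrightarrow> norm x < 2 powi k"
  by (auto simp: piece_def split: if_splits)

lemma piece_lower: "k \<noteq> -1 \<Longrightarrow> x \<in> piece \<Omega> k \<Longrightarrow> 2 powi (k - 1) \<le> norm x"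
  by (auto simp: piece_def split: if_splits)

lemma piece_subset: "piece \<Omega> k \<subseteq> \<Omega>"
  by (auto simp: piece_def)

lemma ex1_piece: "\<exists>!k. k \<in> idx \<and> x \<in> piece UNIV k"
proof (rule ex_ex1I)
  show "\<exists>k. k \<in> idx \<and> x \<in> piece UNIV k"
  proof (cases "norm x < 1 / 2")
    case True
    then show ?thesis by (intro exI[of _ "-1"]) (auto simp: piece_def idx_def)
  next
    case False
    then have pos: "0 < norm x" by linarith
    obtain m :: int where m: "2 powr real_of_int m \<le> norm x" "norm x < 2 powr real_of_int (m + 1)"
      using dyadic_floor[OF pos] .
    have "2 powr real_of_int (-1) \<le> norm x" using False by (simp add: powr_minus)
    then have "2 powr real_of_int (-1) < 2 powr real_of_int (m + 1)" using m(2) by (rule le_less_trans)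
    then have "real_of_int (-1) < real_of_int (m + 1)"
      by (subst (asm) powr_less_cancel_iff) simp_all
    then have "-1 < m + 1" by (simp only: of_int_less_iff)
    then have "m + 1 \<in> idx" "m + 1 \<noteq> -1" by (auto simp: idx_def)
    moreover have "2 powi (m + 1 - 1) \<le> norm x" "norm x < 2 powi (m + 1)"
      using m by (simp_all add: powr_real_of_int' del: of_int_add)
    ultimately show ?thesis by (intro exI[of _ "m + 1"]) (auto simp: piece_def)
  qed
next
  have no: False if "k \<in> idx" "x \<in> piece UNIV k" "l \<in> idx" "x \<in> piece UNIV l" "k < l" for k l
  proof -
    have "l \<noteq> -1" using that by (auto simp: idx_def)
    have "norm x < 2 powi k" using that by (intro piece_upper)
    also have "\<dots> \<le> 2 powi (l - 1)" using that by (intro power_int_increasing) auto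
    also have "\<dots> \<le> norm x" using that \<open>l \<noteq> -1\<close> by (intro piece_lower)
    finally show False by simp
  qed
  show "k = l" if "k \<in> idx \<and> x \<in> piece UNIV k" "l \<in> idx \<and> x \<in> piece UNIV l" for k l
    using no[of k l] no[of l k] that by (meson linorder_neqE)
qed

definition piece_index :: "'a::euclidean_space \<Rightarrow> int" where
  "piece_index x = (THE k. k \<in> idx \<and> x \<in> piece UNIV k)"

lemma piece_index: "piece_index x \<in> idx" "x \<in> piece UNIV (piece_index x)"
  using theI'[OF ex1_piece[of x]] by (simp_all add: piece_index_def)

lemma piece_index_eq: "k \<in> idx \<Longrightarrow> x \<in> piece \<Omega> k \<Longrightarrow> piece_index x = k"
  using ex1_piece[of x] piece_index[of x] by (auto simp: piece_def split: if_splits)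

lemma mem_piece_iff: "k \<in> idx \<Longrightarrow> x \<in> piece \<Omega> k \<longleftrightarrow> x \<in> \<Omega> \<and> piece_index x = k"
  using piece_index[of x] piece_index_eq[of k x \<Omega>] by (auto simp: piece_def split: if_splits)

definition glue :: "(int \<Rightarrow> 'a::euclidean_space \<Rightarrow> real) \<Rightarrow> 'a \<Rightarrow> real" where
  "glue \<phi> x = \<phi> (piece_index x) x"

lemma piece_lebesgue:
  assumes "\<Omega> \<in> sets lebesgue"
  shows "piece \<Omega> k \<in> sets lebesgue"
proof -
  have "piece \<Omega> k = \<Omega> \<inter> piece UNIV k" by (auto simp: piece_def)
  moreover have "piece UNIV k \<in> sets (borel :: 'a measure)" by (simp add: piece_def)
  ultimately show ?thesis using assms by auto
qed

lemma piece_lmeasurable: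
  assumes "\<Omega> \<in> sets lebesgue" "k \<in> idx"
  shows "piece \<Omega> k \<in> lmeasurable"
proof (rule bounded_set_imp_lmeasurable[OF _ piece_lebesgue[OF assms(1)]])
  show "bounded (piece \<Omega> k)"
    by (rule boundedI[of _ "2 powi k"]) (use piece_upper[OF assms(2)] in \<open>auto intro: less_imp_le\<close>)
qed

lemma measurable_piece:
  "f \<in> borel_measurable (lebesgue_on \<Omega>) \<Longrightarrow> f \<in> borel_measurable (lebesgue_on (piece \<Omega> k))"
  by (rule measurable_restrict_mono[OF _ piece_subset])

lemma measurable_glue:
  assumes \<Omega>: "\<Omega> \<in> sets lebesgue"
    and \<phi>: "\<And>k. k \<in> idx \<Longrightarrow> \<phi> k \<in> borel_measurable (lebesgue_on (piece \<Omega> k))"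
  shows "glue \<phi> \<in> borel_measurable (lebesgue_on \<Omega>)"
proof (rule measurable_piecewise_restrict[of "piece \<Omega> ` idx"])
  show "countable (piece \<Omega> ` idx)" by simp
  show "X \<inter> space (lebesgue_on \<Omega>) \<in> sets (lebesgue_on \<Omega>)" if "X \<in> piece \<Omega> ` idx" for X
    using that piece_lebesgue[OF \<Omega>] piece_subset \<Omega> by (auto simp: sets_restrict_space_iff)
  show "space (lebesgue_on \<Omega>) \<subseteq> \<Union> (piece \<Omega> ` idx)"
    using piece_index by (auto simp: mem_piece_iff)
  fix X assume "X \<in> piece \<Omega> ` idx"
  then obtain k where k: "k \<in> idx" "X = piece \<Omega> k" by auto
  have "restrict_space (lebesgue_on \<Omega>) X = lebesgue_on (piece \<Omega> k)"
    unfolding k using \<Omega> piece_lebesgue[OF \<Omega>, of k] Int_absorb1[OF piece_subset[of \<Omega> k]]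
    by (subst restrict_restrict_space) auto
  then show "glue \<phi> \<in> borel_measurable (restrict_space (lebesgue_on \<Omega>) X)"
    using \<phi>[OF k(1)] k(1)
    by (simp, subst measurable_cong[of _ _ "\<phi> k"]) (auto simp: glue_def piece_index_eq)
qed

lemma nn_integral_pieces:
  assumes \<Omega>: "\<Omega> \<in> sets lebesgue" and F: "F \<in> borel_measurable (lebesgue_on \<Omega>)"
  shows "(\<integral>\<^sup>+x. F x \<partial>lebesgue_on \<Omega>) = (\<integral>\<^sup>+k. (\<integral>\<^sup>+x. F x \<partial>lebesgue_on (piece \<Omega> k)) \<partial>count_space idx)"
proof -
  have F'[measurable]: "(\<lambda>x. F x * indicator \<Omega> x) \<in> borel_measurable lebesgue"
    using F \<Omega> by (subst (asm) borel_measurable_restrict_space_iff_ennreal) auto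
  have [measurable]: "piece \<Omega> k \<in> sets lebesgue" for k by (rule piece_lebesgue[OF \<Omega>])
  have "(\<integral>\<^sup>+x. F x \<partial>lebesgue_on \<Omega>) = (\<integral>\<^sup>+x. F x * indicator \<Omega> x \<partial>lebesgue)"
    using \<Omega> by (intro nn_integral_restrict_space) auto
  also have "\<dots> = (\<integral>\<^sup>+x. (\<Sum>n. F x * indicator \<Omega> x * indicator (piece \<Omega> (int n - 1)) x) \<partial>lebesgue)"
  proof (intro nn_integral_cong)
    fix x :: 'a
    show "F x * indicator \<Omega> x = (\<Sum>n. F x * indicator \<Omega> x * indicator (piece \<Omega> (int n - 1)) x)"
    proof (cases "x \<in> \<Omega>")
      case True
      define m where "m = nat (piece_index x + 1)"
      have "x \<in> piece \<Omega> (int n - 1) \<longleftrightarrow> n = m" for n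
        using True piece_index(1)[of x] mem_piece_iff[of "int n - 1" x \<Omega>] by (auto simp: m_def idx_def)
      then have "(\<lambda>n. F x * indicator \<Omega> x * indicator (piece \<Omega> (int n - 1)) x) = (\<lambda>n. if n = m then F x else 0)"
        using True by (auto simp: indicator_def)
      then show ?thesis using True sums_If_finite_set[of "{m}" "\<lambda>_. F x"] by (simp add: sums_unique[symmetric])
    qed simp
  qed
  also have "\<dots> = (\<Sum>n. \<integral>\<^sup>+x. F x * indicator \<Omega> x * indicator (piece \<Omega> (int n - 1)) x \<partial>lebesgue)"
    by (rule nn_integral_suminf) measurable
  also have "\<dots> = (\<Sum>n. \<integral>\<^sup>+x. F x \<partial>lebesgue_on (piece \<Omega> (int n - 1)))"
  proof (intro suminf_cong)
    fix n
    have "(\<integral>\<^sup>+x. F x \<partial>lebesgue_on (piece \<Omega> (int n - 1))) = (\<integral>\<^sup>+x. F x * indicator (piece \<Omega> (int n - 1)) x \<partial>lebesgue)"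
      by (intro nn_integral_restrict_space) simp
    also have "\<dots> = (\<integral>\<^sup>+x. F x * indicator \<Omega> x * indicator (piece \<Omega> (int n - 1)) x \<partial>lebesgue)"
      using piece_subset[of \<Omega> "int n - 1"] by (intro nn_integral_cong) (auto simp: indicator_def)
    finally show "(\<integral>\<^sup>+x. F x * indicator \<Omega> x * indicator (piece \<Omega> (int n - 1)) x \<partial>lebesgue)
      = (\<integral>\<^sup>+x. F x \<partial>lebesgue_on (piece \<Omega> (int n - 1)))" by simp
  qed
  finally show ?thesis by (simp only: nn_integral_idx)
qed

text \<open>
  Admitting the value \<open>\<infinity>\<close> for the entries of the sequence avoids side conditions on the finiteness of
  the local norms.
\<close>

definition lq_functional :: "real \<Rightarrow> real \<Rightarrow> (int \<Rightarrow> ennreal) \<Rightarrow> ennreal" where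
  "lq_functional a q x = epowr (\<integral>\<^sup>+k. epowr (ennreal (2 powr (real_of_int k * a)) * x k) q \<partial>count_space idx) (1 / q)"

lemma weighted_lq_norm_eq: "weighted_lq_norm a q x = lq_functional a q (\<lambda>k. ennreal \<bar>x k\<bar>)"
  unfolding weighted_lq_norm_def lq_functional_def
  by (simp add: epowr_mult epowr_ennreal powr_powr ennreal_mult mult.assoc)

lemma lq_functional_cong: "(\<And>k. k \<in> idx \<Longrightarrow> x k = y k) \<Longrightarrow> lq_functional a q x = lq_functional a q y"
  unfolding lq_functional_def by (intro arg_cong2[where f = epowr] nn_integral_cong) auto

lemma lq_functional_mono:
  "0 < q \<Longrightarrow> (\<And>k. k \<in> idx \<Longrightarrow> x k \<le> y k) \<Longrightarrow> lq_functional a q x \<le> lq_functional a q y"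
  unfolding lq_functional_def by (intro epowr_mono nn_integral_mono mult_left_mono) auto

lemma lq_functional_cmult:
  assumes "0 < q"
  shows "lq_functional a q (\<lambda>k. c * x k) = c * lq_functional a q x"
proof -
  have "(\<integral>\<^sup>+k. epowr (ennreal (2 powr (real_of_int k * a)) * (c * x k)) q \<partial>count_space idx)
    = epowr c q * (\<integral>\<^sup>+k. epowr (ennreal (2 powr (real_of_int k * a)) * x k) q \<partial>count_space idx)"
    by (subst nn_integral_cmult[symmetric]) (auto simp: epowr_mult mult_ac)
  then show ?thesis
    using assms by (simp add: lq_functional_def epowr_mult epowr_epowr)
qed

lemma lq_functional_finite_component:
  assumes fin: "lq_functional a q x < \<infinity>" and k: "k \<in> idx"
  shows "x k < \<infinity>"
proof (rule ccontr)
  assume "\<not> x k < \<infinity>"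
  then have "epowr (ennreal (2 powr (real_of_int k * a)) * x k) q = \<infinity>"
    by (simp add: less_top[symmetric] ennreal_mult_top)
  then have "(\<integral>\<^sup>+k. epowr (ennreal (2 powr (real_of_int k * a)) * x k) q \<partial>count_space idx) = \<infinity>"
    using nn_integral_ge_point[OF k, of "\<lambda>k. epowr (ennreal (2 powr (real_of_int k * a)) * x k) q"]
    by (simp add: top_unique)
  with fin show False by (simp add: lq_functional_def)
qed

lemma lq_functional_Hoelder:
  assumes "1 < q" "1 < q'" "1 / q + 1 / q' = 1"
  shows "(\<integral>\<^sup>+k. x k * y k \<partial>count_space idx) \<le> lq_functional a q x * lq_functional (- a) q' y"
proof -
  have "ennreal (2 powr (real_of_int k * a)) * ennreal (2 powr (real_of_int k * - a)) = 1" for k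
    by (simp add: powr_add[symmetric] flip: ennreal_mult)
  then have "x k * y k = (ennreal (2 powr (real_of_int k * a)) * x k) * (ennreal (2 powr (real_of_int k * - a)) * y k)" for k
    by (metis mult.assoc mult.commute mult_1)
  then have "(\<integral>\<^sup>+k. x k * y k \<partial>count_space idx)
    = (\<integral>\<^sup>+k. (ennreal (2 powr (real_of_int k * a)) * x k) * (ennreal (2 powr (real_of_int k * - a)) * y k) \<partial>count_space idx)"
    by simp
  also have "\<dots> \<le> lq_functional a q x * lq_functional (- a) q' y"
    unfolding lq_functional_def by (rule Hoelder_nn_integral[OF assms]) auto
  finally show ?thesis .
qed

lemma ideal_norm_weighted_lq:
  assumes "0 < q"
  shows "ideal_norm (count_space idx) (weighted_lq_norm a q)"
proof
  fix f :: "int \<Rightarrow> real" and c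
  show "weighted_lq_norm a q (\<lambda>k. c * f k) = ennreal \<bar>c\<bar> * weighted_lq_norm a q f"
    using assms by (simp add: weighted_lq_norm_eq abs_mult ennreal_mult lq_functional_cmult)
next
  fix f h :: "int \<Rightarrow> real"
  assume "AE k in count_space idx. \<bar>f k\<bar> \<le> \<bar>h k\<bar>"
  then show "weighted_lq_norm a q f \<le> weighted_lq_norm a q h"
    using assms by (auto simp: weighted_lq_norm_eq AE_count_space intro!: lq_functional_mono ennreal_leI)
qed

abbreviation piece_part :: "'a::euclidean_space set \<Rightarrow> int \<Rightarrow> ('a \<Rightarrow> real) \<Rightarrow> 'a \<Rightarrow> real" where
  "piece_part \<Omega> k f \<equiv> (\<lambda>x. f x * indicator (piece \<Omega> k) x)"

lemma measurable_piece_part: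
  assumes "f \<in> borel_measurable (lebesgue_on \<Omega>)"
  shows "piece_part \<Omega> k f \<in> borel_measurable (lebesgue_on (piece \<Omega> k))"
  by (subst measurable_cong[of _ _ f]) (auto intro: measurable_piece[OF assms])

text \<open>
  An infinite local norm makes the weighted sum infinite, so the case distinction in
  \<open>composite_norm\<close> is absorbed by the value \<open>\<infinity>\<close>.
\<close>

lemma composite_weighted_lq:
  assumes "f \<in> borel_measurable (lebesgue_on \<Omega>)" "0 < q"
  shows "composite_norm (weighted_lq_norm a q) X \<Omega> f = lq_functional a q (\<lambda>k. X k (piece_part \<Omega> k f))"
proof (cases "\<forall>k\<in>idx. X k (piece_part \<Omega> k f) < \<infinity>")
  case True
  then show ?thesis
    using measurable_piece_part[OF assms(1)]
    by (simp add: composite_norm_def ideal_space_def weighted_lq_norm_eq) (intro lq_functional_cong, simp)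
next
  case False
  then have "lq_functional a q (\<lambda>k. X k (piece_part \<Omega> k f)) = \<infinity>"
    using lq_functional_finite_component[of a q "\<lambda>k. X k (piece_part \<Omega> k f)"]
    by (metis infinity_ennreal_def less_top)
  with False show ?thesis
    by (auto simp: composite_norm_def ideal_space_def)
qed

section \<open>Duality for composite norms\<close>

text \<open>
  Duality up to constants on the single pieces.  The essential point is that \<open>C\<close> does not depend on
  \<open>k\<close>.
\<close>

locale local_duality =
  fixes \<Omega> :: "'a::euclidean_space set"
    and X Y :: "int \<Rightarrow> ('a \<Rightarrow> real) \<Rightarrow> ennreal"
    and a q q' C :: real
  assumes \<Omega>: "\<Omega> \<in> sets lebesgue"
    and q: "1 < q" "1 < q'" "1 / q + 1 / q' = 1"
    and C: "0 < C"
    and local_norm: "k \<in> idx \<Longrightarrow> order_continuous_ideal_norm (lebesgue_on (piece \<Omega> k)) (X k)"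
    and local_Hoelder: "\<lbrakk>k \<in> idx; f \<in> borel_measurable (lebesgue_on (piece \<Omega> k));
        g \<in> borel_measurable (lebesgue_on (piece \<Omega> k))\<rbrakk>
      \<Longrightarrow> (\<integral>\<^sup>+x. ennreal \<bar>f x * g x\<bar> \<partial>lebesgue_on (piece \<Omega> k)) \<le> X k f * Y k g"
    and local_lower: "\<lbrakk>k \<in> idx; g \<in> borel_measurable (lebesgue_on (piece \<Omega> k))\<rbrakk>
      \<Longrightarrow> Y k g \<le> ennreal C * koethe_norm (lebesgue_on (piece \<Omega> k)) (X k) g"
begin

abbreviation "M \<equiv> lebesgue_on \<Omega>"
abbreviation "L k \<equiv> lebesgue_on (piece \<Omega> k)"
abbreviation cut :: "int \<Rightarrow> ('a \<Rightarrow> real) \<Rightarrow> 'a \<Rightarrow> real" where "cut \<equiv> piece_part \<Omega>"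
abbreviation "N \<equiv> composite_norm (weighted_lq_norm a q) X \<Omega>"
abbreviation "Z \<equiv> composite_norm (weighted_lq_norm (- a) q') Y \<Omega>"

lemma N_eq: "f \<in> borel_measurable M \<Longrightarrow> N f = lq_functional a q (\<lambda>k. X k (cut k f))"
  using q by (intro composite_weighted_lq) auto

lemma Z_eq: "f \<in> borel_measurable M \<Longrightarrow> Z f = lq_functional (- a) q' (\<lambda>k. Y k (cut k f))"
  using q by (intro composite_weighted_lq) auto

lemma local_ideal: "k \<in> idx \<Longrightarrow> ideal_norm (L k) (X k)"
  using local_norm order_continuous_ideal_norm.axioms(1) by blast

lemmas local_homogeneous = ideal_norm.homogeneous[OF local_ideal]
lemmas local_monotone = ideal_norm.monotone[OF local_ideal]

lemma AE_piece:
  assumes "AE x in M. P x"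
  shows "AE x in L k. P x"
proof -
  have "AE x in lebesgue. x \<in> \<Omega> \<longrightarrow> P x"
    using assms \<Omega> by (subst (asm) AE_restrict_space_iff) auto
  then have "AE x in lebesgue. x \<in> piece \<Omega> k \<longrightarrow> P x"
    by eventually_elim (use piece_subset in blast)
  then show ?thesis
    using piece_lebesgue[OF \<Omega>] by (subst AE_restrict_space_iff) auto
qed

lemma composite_ideal_norm: "ideal_norm M N"
proof
  fix f :: "'a \<Rightarrow> real" and c assume [measurable]: "f \<in> borel_measurable M"
  have "X k (cut k (\<lambda>x. c * f x)) = ennreal \<bar>c\<bar> * X k (cut k f)" if "k \<in> idx" for k
    using local_homogeneous[OF that measurable_piece_part, of f c] by (simp add: mult.assoc)
  then have "N (\<lambda>x. c * f x) = lq_functional a q (\<lambda>k. ennreal \<bar>c\<bar> * X k (cut k f))"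
    by (subst N_eq) (auto intro: lq_functional_cong)
  also have "\<dots> = ennreal \<bar>c\<bar> * N f"
    using q by (simp add: lq_functional_cmult N_eq)
  finally show "N (\<lambda>x. c * f x) = ennreal \<bar>c\<bar> * N f" .
next
  fix f h :: "'a \<Rightarrow> real"
  assume fh: "f \<in> borel_measurable M" "h \<in> borel_measurable M" and le: "AE x in M. \<bar>f x\<bar> \<le> \<bar>h x\<bar>"
  have "X k (cut k f) \<le> X k (cut k h)" if "k \<in> idx" for k
  proof (rule local_monotone[OF that])
    show "AE x in L k. \<bar>cut k f x\<bar> \<le> \<bar>cut k h x\<bar>"
      using AE_piece[OF le] by eventually_elim (auto simp: indicator_def)
  qed (intro measurable_piece_part fh)+
  then show "N f \<le> N h"
    using q by (subst (1 2) N_eq) (auto intro: lq_functional_mono fh)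
qed

lemma part_in_local_space:
  assumes "f \<in> ideal_space M N" "k \<in> idx"
  shows "cut k f \<in> ideal_space (L k) (X k)"
  using assms by (auto simp: ideal_space_def composite_norm_def split: if_splits)

lemma composite_order_continuous:
  fixes u :: "nat \<Rightarrow> 'a \<Rightarrow> real"
  assumes u: "\<And>n. u n \<in> borel_measurable M" and h: "h \<in> ideal_space M N"
    and bd: "\<And>n x. x \<in> space M \<Longrightarrow> \<bar>u n x\<bar> \<le> h x"
    and lim: "\<And>x. x \<in> space M \<Longrightarrow> (\<lambda>n. u n x) \<longlonglongrightarrow> 0"
  shows "(\<lambda>n. N (u n)) \<longlonglongrightarrow> 0"
proof -
  have hm: "h \<in> borel_measurable M" using h by (simp add: ideal_space_def)
  let ?W = "\<lambda>f k. epowr (ennreal (2 powr (real_of_int k * a)) * X k (cut k f)) q"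
  have "(\<lambda>n. \<integral>\<^sup>+k. ?W (u n) k \<partial>count_space idx) \<longlonglongrightarrow> (\<integral>\<^sup>+k. 0 \<partial>count_space idx)"
  proof (rule nn_integral_dominated_convergence[where w = "?W h"])
    show "(\<integral>\<^sup>+k. ?W h k \<partial>count_space idx) < \<infinity>"
      using h by (auto simp: ideal_space_def N_eq lq_functional_def simp flip: less_top)
    have "X k (cut k (u n)) \<le> X k (cut k h)" if k: "k \<in> idx" for k n
    proof (rule local_monotone[OF k])
      show "AE x in L k. \<bar>cut k (u n) x\<bar> \<le> \<bar>cut k h x\<bar>"
        using order_trans[OF bd abs_ge_self] piece_subset[of \<Omega> k] by (intro AE_I2) (auto simp: abs_mult)
    qed (intro measurable_piece_part u hm)+
    then show "AE k in count_space idx. ?W (u n) k \<le> ?W h k" for n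
      using q by (auto simp: AE_count_space intro!: epowr_mono mult_left_mono)
    have "(\<lambda>n. X k (cut k (u n))) \<longlonglongrightarrow> 0" if k: "k \<in> idx" for k
    proof (rule order_continuous_ideal_norm.order_continuous[OF local_norm[OF k] _ part_in_local_space[OF h k]])
      show "cut k (u n) \<in> borel_measurable (L k)" for n by (intro measurable_piece_part u)
      show "\<bar>cut k (u n) x\<bar> \<le> cut k h x" if "x \<in> space (L k)" for n x
        using that bd piece_subset[of \<Omega> k] by (auto simp: abs_mult)
      show "(\<lambda>n. cut k (u n) x) \<longlonglongrightarrow> 0" if "x \<in> space (L k)" for x
        using that lim piece_subset[of \<Omega> k] by auto
    qed
    then have "(\<lambda>n. ennreal (2 powr (real_of_int k * a)) * X k (cut k (u n))) \<longlonglongrightarrow> ennreal (2 powr (real_of_int k * a)) * 0"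
      if "k \<in> idx" for k
      using that by (intro ennreal_tendsto_cmult) auto
    then show "AE k in count_space idx. (\<lambda>n. ?W (u n) k) \<longlonglongrightarrow> 0"
      using q by (auto simp: AE_count_space intro!: epowr_tendsto_0)
  qed auto
  then show ?thesis
    using q u by (simp add: N_eq lq_functional_def) (intro epowr_tendsto_0, auto)
qed

lemma lq_functional_geometric:
  assumes "0 < s"
  shows "lq_functional a s (\<lambda>k. ennreal (2 powr (- (real_of_int k * (a + 1))))) < \<infinity>"
proof -
  have x: "0 \<le> 2 powr (- s)" "2 powr (- s) < (1::real)"
    using assms powr_less_mono[of "- s" 0 2] by auto
  have "(\<integral>\<^sup>+k. epowr (ennreal (2 powr (real_of_int k * a)) * ennreal (2 powr (- (real_of_int k * (a + 1))))) s \<partial>count_space idx)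
    \<le> ennreal (2 powr s * (1 / (1 - 2 powr (- s))))"
  proof (rule nn_integral_idx_le)
    fix J assume J: "finite J" "J \<subseteq> idx"
    have "epowr (ennreal (2 powr (real_of_int k * a)) * ennreal (2 powr (- (real_of_int k * (a + 1))))) s
      = ennreal (2 powr s * (2 powr (- s)) ^ nat (k + 1))" if "k \<in> J" for k
    proof -
      have "0 \<le> k + 1" using that J by (auto simp: idx_def)
      then have "(2 powr (- s)) ^ nat (k + 1) = 2 powr (- s * (real_of_int k + 1))"
        by (simp add: powr_powr powr_realpow[symmetric])
      then show ?thesis
        by (simp add: epowr_ennreal powr_powr powr_add[symmetric] algebra_simps flip: ennreal_mult)
    qed
    then have "(\<Sum>k\<in>J. epowr (ennreal (2 powr (real_of_int k * a)) * ennreal (2 powr (- (real_of_int k * (a + 1))))) s)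
      = ennreal (2 powr s * (\<Sum>k\<in>J. (2 powr (- s)) ^ nat (k + 1)))"
      by (simp add: sum_distrib_left)
    also have "\<dots> \<le> ennreal (2 powr s * (1 / (1 - 2 powr (- s))))"
    proof (intro ennreal_leI mult_left_mono sum_geometric_le)
      show "inj_on (\<lambda>k. nat (k + 1)) J"
        by (rule inj_on_subset[OF _ J(2)]) (auto simp: inj_on_def idx_def eq_nat_nat_iff)
    qed (use J x in auto)
    finally show "(\<Sum>k\<in>J. epowr (ennreal (2 powr (real_of_int k * a)) * ennreal (2 powr (- (real_of_int k * (a + 1))))) s)
      \<le> ennreal (2 powr s * (1 / (1 - 2 powr (- s))))" .
  qed
  also have "\<dots> < \<infinity>" by simp
  finally show ?thesis
    by (auto simp: lq_functional_def simp flip: less_top)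
qed

text \<open>
  Local weak units are glued after rescaling them to norm at most \<open>2\<^bsup>-k(a+1)\<^esup>\<close>, a sequence of finite
  weighted \<open>l\<^sub>q\<close> norm.
\<close>

lemma composite_weak_unit: "\<exists>w\<in>ideal_space M N. \<forall>x\<in>space M. 0 < w x"
proof -
  have "\<forall>k\<in>idx. \<exists>w. w \<in> ideal_space (L k) (X k) \<and> (\<forall>x\<in>space (L k). 0 < w x)"
    using order_continuous_ideal_norm.weak_unit[OF local_norm] by blast
  then obtain w where w: "\<And>k. k \<in> idx \<Longrightarrow> w k \<in> ideal_space (L k) (X k)"
    "\<And>k x. k \<in> idx \<Longrightarrow> x \<in> piece \<Omega> k \<Longrightarrow> 0 < w k x"
    by (auto dest!: bchoice)
  have wm: "w k \<in> borel_measurable (L k)" if "k \<in> idx" for k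
    using w(1)[OF that] by (simp add: ideal_space_def)
  define e where "e k = 2 powr (- (real_of_int k * (a + 1))) / (enn2real (X k (w k)) + 1)" for k
  have e: "0 < e k" for k by (simp add: e_def add_nonneg_pos)
  define v where "v = glue (\<lambda>k x. e k * w k x)"
  have vm: "v \<in> borel_measurable M"
    unfolding v_def using wm by (intro measurable_glue[OF \<Omega>] borel_measurable_times) auto
  have "X k (cut k v) \<le> ennreal (2 powr (- (real_of_int k * (a + 1))))" if k: "k \<in> idx" for k
  proof -
    have "X k (cut k v) \<le> X k (\<lambda>x. e k * w k x)"
    proof (rule local_monotone[OF k measurable_piece_part[OF vm]])
      show "AE x in L k. \<bar>cut k v x\<bar> \<le> \<bar>e k * w k x\<bar>"
        using k by (intro AE_I2) (auto simp: v_def glue_def piece_index_eq)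
    qed (use wm[OF k] in measurable)
    also have "\<dots> = ennreal (e k) * X k (w k)"
      using local_homogeneous[OF k wm[OF k], of "e k"] e[of k] by simp
    also have "X k (w k) = ennreal (enn2real (X k (w k)))"
      using w(1)[OF k] by (simp add: ideal_space_def)
    also have "ennreal (e k) * \<dots> = ennreal (e k * enn2real (X k (w k)))"
      using e[of k] by (simp add: ennreal_mult)
    also have "e k * enn2real (X k (w k)) \<le> e k * (enn2real (X k (w k)) + 1)"
      using e[of k] by (intro mult_left_mono) auto
    also have "\<dots> = 2 powr (- (real_of_int k * (a + 1)))"
      using enn2real_nonneg[of "X k (w k)"] by (simp add: e_def del: enn2real_nonneg)
    finally show ?thesis by (simp add: ennreal_leI)
  qed
  then have "N v \<le> lq_functional a q (\<lambda>k. ennreal (2 powr (- (real_of_int k * (a + 1)))))"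
    using q by (subst N_eq[OF vm]) (intro lq_functional_mono, auto)
  also have "\<dots> < \<infinity>" using q by (intro lq_functional_geometric) auto
  finally have "v \<in> ideal_space M N" using vm by (simp add: ideal_space_def)
  moreover have "0 < v x" if "x \<in> space M" for x
    using that w(2)[of "piece_index x" x] e piece_index(1)[of x] mem_piece_iff[of "piece_index x" x \<Omega>]
    by (simp add: v_def glue_def)
  ultimately show ?thesis by blast
qed

lemma sigma_finite_M: "sigma_finite_measure M"
proof
  have "emeasure M (piece \<Omega> k) \<noteq> \<infinity>" if "k \<in> idx" for k
    using piece_lmeasurable[OF \<Omega> that] \<Omega> piece_subset[of \<Omega> k]
    by (subst emeasure_restrict_space) (auto simp: fmeasurable_def)
  moreover have "piece \<Omega> k \<in> sets M" for k
    using piece_lebesgue[OF \<Omega>] piece_subset[of \<Omega> k] \<Omega> by (auto simp: sets_restrict_space_iff)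
  moreover have "(\<Union>k\<in>idx. piece \<Omega> k) = space M"
    using piece_index(1) piece_subset[of \<Omega>] by (auto simp: mem_piece_iff)
  ultimately show "\<exists>A. countable A \<and> A \<subseteq> sets M \<and> \<Union> A = space M \<and> (\<forall>a\<in>A. emeasure M a \<noteq> \<infinity>)"
    by (intro exI[of _ "piece \<Omega> ` idx"]) auto
qed

theorem composite_order_continuous_ideal_norm: "order_continuous_ideal_norm M N"
proof -
  interpret ideal_norm M N by (rule composite_ideal_norm)
  interpret sigma_finite_measure M by (rule sigma_finite_M)
  show ?thesis
  proof
    show "(\<lambda>n. N (u n)) \<longlonglongrightarrow> 0"
      if "\<And>n. u n \<in> borel_measurable M" "h \<in> ideal_space M N"
        "\<And>n x. x \<in> space M \<Longrightarrow> \<bar>u n x\<bar> \<le> h x" "\<And>x. x \<in> space M \<Longrightarrow> (\<lambda>n. u n x) \<longlonglongrightarrow> 0"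
      for u :: "nat \<Rightarrow> 'a \<Rightarrow> real" and h
      using that by (rule composite_order_continuous)
    show "\<exists>w\<in>ideal_space M N. \<forall>x\<in>space M. 0 < w x" by (rule composite_weak_unit)
  qed
qed

lemma nn_integral_product_pieces:
  assumes [measurable]: "f \<in> borel_measurable M" "g \<in> borel_measurable M"
  shows "(\<integral>\<^sup>+x. ennreal \<bar>f x * g x\<bar> \<partial>M)
    = (\<integral>\<^sup>+k. (\<integral>\<^sup>+x. ennreal \<bar>cut k f x * cut k g x\<bar> \<partial>L k) \<partial>count_space idx)"
  by (subst nn_integral_pieces[OF \<Omega>]) (auto intro!: nn_integral_cong)

lemma composite_integral_le:
  assumes f: "f \<in> borel_measurable M" and g: "g \<in> borel_measurable M"
  shows "(\<integral>\<^sup>+x. ennreal \<bar>f x * g x\<bar> \<partial>M) \<le> N f * Z g"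
proof -
  have "(\<integral>\<^sup>+x. ennreal \<bar>f x * g x\<bar> \<partial>M) \<le> (\<integral>\<^sup>+k. X k (cut k f) * Y k (cut k g) \<partial>count_space idx)"
    unfolding nn_integral_product_pieces[OF f g]
    by (intro nn_integral_mono local_Hoelder measurable_piece_part f g) simp
  also have "\<dots> \<le> N f * Z g"
    unfolding N_eq[OF f] Z_eq[OF g] by (rule lq_functional_Hoelder[OF q])
  finally show ?thesis .
qed

lemma composite_koethe_upper:
  assumes g: "g \<in> borel_measurable M"
  shows "koethe_norm M N g \<le> Z g"
  unfolding koethe_norm_def
proof (rule SUP_least)
  fix f assume f: "f \<in> {f \<in> ideal_space M N. N f \<le> 1}"
  then have "(\<integral>\<^sup>+x. ennreal \<bar>f x * g x\<bar> \<partial>M) \<le> N f * Z g"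
    using g by (intro composite_integral_le) (auto simp: ideal_space_def)
  also have "\<dots> \<le> 1 * Z g" using f by (intro mult_right_mono) auto
  finally show "(\<integral>\<^sup>+x. ennreal \<bar>f x * g x\<bar> \<partial>M) \<le> Z g" by simp
qed

text \<open>
  The functions \<open>f\<^sub>k\<close> of the local unit balls are glued with coefficients \<open>l\<^sub>k\<close> into one test function
  for the composite norm.
\<close>

lemma koethe_finite_test:
  assumes J: "finite J" "J \<subseteq> idx" and g[measurable]: "g \<in> borel_measurable M"
    and K: "koethe_norm M N g = ennreal \<kappa>" "0 \<le> \<kappa>"
    and f: "\<And>k. k \<in> J \<Longrightarrow> f k \<in> ideal_space (L k) (X k)" "\<And>k. k \<in> J \<Longrightarrow> X k (f k) \<le> 1"
    and \<eta>: "\<And>k. k \<in> J \<Longrightarrow> 0 \<le> \<eta> k"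
      "\<And>k. k \<in> J \<Longrightarrow> ennreal (\<eta> k) \<le> (\<integral>\<^sup>+x. ennreal \<bar>f k x * cut k g x\<bar> \<partial>L k)"
    and l: "\<And>k. k \<in> J \<Longrightarrow> 0 \<le> l k"
  shows "(\<Sum>k\<in>J. l k * \<eta> k) \<le> \<kappa> * (\<Sum>k\<in>J. (2 powr (real_of_int k * a) * l k) powr q) powr (1 / q)"
proof -
  interpret ideal_norm M N by (rule composite_ideal_norm)
  define F where "F = glue (\<lambda>k x. if k \<in> J then l k * f k x else 0)"
  have fm[measurable]: "f k \<in> borel_measurable (L k)" if "k \<in> J" for k
    using f(1)[OF that] by (simp add: ideal_space_def)
  have Fm[measurable]: "F \<in> borel_measurable M"
    unfolding F_def
  proof (rule measurable_glue[OF \<Omega>])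
    show "(\<lambda>x. if k \<in> J then l k * f k x else 0) \<in> borel_measurable (L k)" for k
      using fm[of k] by (cases "k \<in> J") auto
  qed
  have XF: "X k (cut k F) \<le> ennreal (if k \<in> J then l k else 0)" if k: "k \<in> idx" for k
  proof (cases "k \<in> J")
    case True
    have "X k (cut k F) \<le> X k (\<lambda>x. l k * f k x)"
    proof (rule local_monotone[OF k measurable_piece_part[OF Fm]])
      show "AE x in L k. \<bar>cut k F x\<bar> \<le> \<bar>l k * f k x\<bar>"
        using k True by (intro AE_I2) (auto simp: F_def glue_def piece_index_eq)
    qed (use fm[OF True] in measurable)
    also have "\<dots> = ennreal (l k) * X k (f k)"
      using local_homogeneous[OF k fm[OF True], of "l k"] l[OF True] by simp
    also have "\<dots> \<le> ennreal (l k) * 1" using f(2)[OF True] by (intro mult_left_mono) auto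
    finally show ?thesis using True by simp
  next
    case False
    have "X k (cut k F) = 0"
    proof (rule ideal_norm.N_eq_0_AE[OF local_ideal[OF k] measurable_piece_part[OF Fm]])
      show "AE x in L k. cut k F x = 0"
        using k False by (intro AE_I2) (auto simp: F_def glue_def piece_index_eq)
    qed
    then show ?thesis by simp
  qed
  let ?S = "\<Sum>k\<in>J. (2 powr (real_of_int k * a) * l k) powr q"
  have "N F \<le> lq_functional a q (\<lambda>k. ennreal (if k \<in> J then l k else 0))"
    using q XF by (subst N_eq[OF Fm]) (intro lq_functional_mono, auto)
  also have "\<dots> = epowr (\<Sum>k\<in>J. epowr (ennreal (2 powr (real_of_int k * a)) * ennreal (if k \<in> J then l k else 0)) q) (1 / q)"
    unfolding lq_functional_def using J by (subst nn_integral_count_space') auto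
  also have "\<dots> = epowr (\<Sum>k\<in>J. ennreal ((2 powr (real_of_int k * a) * l k) powr q)) (1 / q)"
    using l by (intro arg_cong2[where f = epowr] sum.cong refl) (auto simp: epowr_ennreal simp flip: ennreal_mult)
  also have "\<dots> = ennreal (?S powr (1 / q))"
    by (simp add: epowr_ennreal sum_nonneg)
  finally have NF: "N F \<le> ennreal (?S powr (1 / q))" .
  then have FX: "F \<in> ideal_space M N"
    using Fm by (auto simp: ideal_space_def intro: le_less_trans)
  have "ennreal (\<Sum>k\<in>J. l k * \<eta> k) = (\<Sum>k\<in>J. ennreal (l k) * ennreal (\<eta> k))"
    using l \<eta>(1) by (rule ennreal_sum_mult)
  also have "\<dots> \<le> (\<Sum>k\<in>J. \<integral>\<^sup>+x. ennreal \<bar>cut k F x * cut k g x\<bar> \<partial>L k)"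
  proof (intro sum_mono)
    fix k assume k: "k \<in> J"
    have "ennreal (l k) * ennreal (\<eta> k) \<le> ennreal (l k) * (\<integral>\<^sup>+x. ennreal \<bar>f k x * cut k g x\<bar> \<partial>L k)"
      using \<eta>(2)[OF k] by (intro mult_left_mono) auto
    also have "\<dots> = (\<integral>\<^sup>+x. ennreal (l k) * ennreal \<bar>f k x * cut k g x\<bar> \<partial>L k)"
      by (intro nn_integral_cmult[symmetric] measurable_compose[OF _ measurable_ennreal]
          borel_measurable_abs borel_measurable_times fm[OF k] measurable_piece_part g)
    also have "\<dots> = (\<integral>\<^sup>+x. ennreal \<bar>cut k F x * cut k g x\<bar> \<partial>L k)"
    proof (intro nn_integral_cong)
      fix x assume "x \<in> space (L k)"
      then have "cut k F x = l k * f k x"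
        using k J by (auto simp: F_def glue_def piece_index_eq subset_iff)
      then show "ennreal (l k) * ennreal \<bar>f k x * cut k g x\<bar> = ennreal \<bar>cut k F x * cut k g x\<bar>"
        using l[OF k] by (simp add: abs_mult mult.assoc ennreal_mult)
    qed
    finally show "ennreal (l k) * ennreal (\<eta> k) \<le> (\<integral>\<^sup>+x. ennreal \<bar>cut k F x * cut k g x\<bar> \<partial>L k)" .
  qed
  also have "\<dots> = (\<integral>\<^sup>+k. (\<integral>\<^sup>+x. ennreal \<bar>cut k F x * cut k g x\<bar> \<partial>L k) * indicator J k \<partial>count_space idx)"
    using J by (subst nn_integral_count_space'[of J]) auto
  also have "\<dots> \<le> (\<integral>\<^sup>+k. (\<integral>\<^sup>+x. ennreal \<bar>cut k F x * cut k g x\<bar> \<partial>L k) \<partial>count_space idx)"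
    by (intro nn_integral_mono) (auto simp: indicator_def)
  also have "\<dots> = (\<integral>\<^sup>+x. ennreal \<bar>F x * g x\<bar> \<partial>M)"
    by (rule nn_integral_product_pieces[OF Fm g, symmetric])
  also have "\<dots> \<le> N F * K g"
    using FX g by (rule koethe_Hoelder) (simp add: K)
  also have "\<dots> \<le> ennreal (?S powr (1 / q)) * ennreal \<kappa>"
    unfolding K by (intro mult_right_mono NF) simp
  finally show ?thesis
    using K(2) by (simp add: mult.commute flip: ennreal_mult)
qed

text \<open>
  Test functions that reach half of the local Koethe norms \<open>K'\<close> turn \<open>koethe_finite_test\<close> into the
  hypothesis of \<open>finite_lq_converse\<close>.  Taking half of the supremum, which need not be attained, costs
  the factor \<open>2\<close>.
\<close>

lemma composite_koethe_lower:
  assumes g: "g \<in> borel_measurable M"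
  shows "Z g \<le> ennreal (2 * C) * koethe_norm M N g"
proof (cases "koethe_norm M N g")
  case top
  then show ?thesis using C by (simp add: ennreal_mult_top)
next
  case (real \<kappa>)
  define K' where "K' k = koethe_norm (L k) (X k) (cut k g)" for k
  have attain: "\<exists>f. f \<in> ideal_space (L k) (X k) \<and> X k f \<le> 1 \<and> ennreal y \<le> (\<integral>\<^sup>+x. ennreal \<bar>f x * cut k g x\<bar> \<partial>L k)"
    if "ennreal y < K' k" for k y
    using that unfolding K'_def koethe_norm_def less_SUP_iff by (auto intro: less_imp_le)
  \<comment> \<open>A test on the single index \<open>k\<close> shows that the local Koethe norms are finite.\<close>
  have le: "K' k \<le> ennreal (\<kappa> * 2 powr (real_of_int k * a))" if k: "k \<in> idx" for k
  proof (rule ennreal_le_of_less)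
    fix y :: real assume y: "0 \<le> y" "ennreal y < K' k"
    from attain[OF y(2)] obtain f where "f \<in> ideal_space (L k) (X k)" "X k f \<le> 1"
      "ennreal y \<le> (\<integral>\<^sup>+x. ennreal \<bar>f x * cut k g x\<bar> \<partial>L k)" by blast
    then have "(\<Sum>k\<in>{k}. 1 * y) \<le> \<kappa> * (\<Sum>k\<in>{k}. (2 powr (real_of_int k * a) * 1) powr q) powr (1 / q)"
      using k y real by (intro koethe_finite_test[of "{k}" g \<kappa> "\<lambda>_. f"] g) auto
    then show "ennreal y \<le> ennreal (\<kappa> * 2 powr (real_of_int k * a))"
      using q by (intro ennreal_leI) (simp add: powr_powr)
  qed
  define \<eta> where "\<eta> k = enn2real (K' k) / 2" for k
  have fin: "K' k = ennreal (2 * \<eta> k)" if "k \<in> idx" for k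
    using le_less_trans[OF le[OF that]] by (simp add: \<eta>_def)
  have \<eta>0: "0 \<le> \<eta> k" for k by (simp add: \<eta>_def)
  have "\<exists>f. f \<in> ideal_space (L k) (X k) \<and> X k f \<le> 1 \<and> ennreal (\<eta> k) \<le> (\<integral>\<^sup>+x. ennreal \<bar>f x * cut k g x\<bar> \<partial>L k)"
    if k: "k \<in> idx" for k
  proof (cases "\<eta> k = 0")
    case True
    interpret ideal_norm "L k" "X k" by (rule local_ideal[OF k])
    show ?thesis using True by (intro exI[of _ "\<lambda>x. 0"]) simp
  next
    case False
    with \<eta>0[of k] have "ennreal (\<eta> k) < K' k"
      unfolding fin[OF k] by (intro ennreal_lessI) auto
    then show ?thesis by (rule attain)
  qed
  then have "\<forall>k\<in>idx. \<exists>f. f \<in> ideal_space (L k) (X k) \<and> X k f \<le> 1 \<and>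
      ennreal (\<eta> k) \<le> (\<integral>\<^sup>+x. ennreal \<bar>f x * cut k g x\<bar> \<partial>L k)"
    by (rule ballI)
  from bchoice[OF this] obtain f where "\<forall>k\<in>idx. f k \<in> ideal_space (L k) (X k) \<and> X k (f k) \<le> 1 \<and>
      ennreal (\<eta> k) \<le> (\<integral>\<^sup>+x. ennreal \<bar>f k x * cut k g x\<bar> \<partial>L k)" ..
  then have f: "f k \<in> ideal_space (L k) (X k)" "X k (f k) \<le> 1"
    "ennreal (\<eta> k) \<le> (\<integral>\<^sup>+x. ennreal \<bar>f k x * cut k g x\<bar> \<partial>L k)" if "k \<in> idx" for k
    using that by auto
  have "(\<integral>\<^sup>+k. epowr (ennreal (2 powr (real_of_int k * - a)) * ennreal (\<eta> k)) q' \<partial>count_space idx) \<le> ennreal (\<kappa> powr q')"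
  proof (rule nn_integral_idx_le)
    fix J assume J: "finite J" "J \<subseteq> idx"
    have "(\<Sum>k\<in>J. (\<eta> k / 2 powr (real_of_int k * a)) powr q') \<le> \<kappa> powr q'"
    proof (rule finite_lq_converse[OF q])
      fix l :: "int \<Rightarrow> real" assume "\<And>k. k \<in> J \<Longrightarrow> 0 \<le> l k"
      then show "(\<Sum>k\<in>J. l k * \<eta> k) \<le> \<kappa> * (\<Sum>k\<in>J. (2 powr (real_of_int k * a) * l k) powr q) powr (1 / q)"
        using J f \<eta>0 real by (intro koethe_finite_test[of J g \<kappa> f] g) auto
    qed (use \<eta>0 real in auto)
    moreover have "epowr (ennreal (2 powr (real_of_int k * - a)) * ennreal (\<eta> k)) q'
      = ennreal ((\<eta> k / 2 powr (real_of_int k * a)) powr q')" for k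
    proof -
      have "2 powr (real_of_int k * - a) * \<eta> k = \<eta> k / 2 powr (real_of_int k * a)"
        by (simp add: powr_minus divide_inverse)
      then show ?thesis
        using \<eta>0[of k] by (simp add: epowr_ennreal flip: ennreal_mult)
    qed
    ultimately show "(\<Sum>k\<in>J. epowr (ennreal (2 powr (real_of_int k * - a)) * ennreal (\<eta> k)) q') \<le> ennreal (\<kappa> powr q')"
      by (simp add: ennreal_leI)
  qed
  then have "lq_functional (- a) q' (\<lambda>k. ennreal (\<eta> k)) \<le> epowr (ennreal (\<kappa> powr q')) (1 / q')"
    unfolding lq_functional_def using q by (intro epowr_mono) auto
  also have "\<dots> = ennreal \<kappa>"
    using q real by (simp add: epowr_ennreal powr_powr)
  finally have low: "lq_functional (- a) q' (\<lambda>k. ennreal (\<eta> k)) \<le> ennreal \<kappa>" .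
  have "Y k (cut k g) \<le> ennreal (2 * C) * ennreal (\<eta> k)" if k: "k \<in> idx" for k
  proof -
    have "Y k (cut k g) \<le> ennreal C * K' k"
      unfolding K'_def by (intro local_lower[OF k] measurable_piece_part g)
    also have "\<dots> = ennreal (2 * C) * ennreal (\<eta> k)"
      using C \<eta>0[of k] by (simp add: fin[OF k] mult_ac flip: ennreal_mult)
    finally show ?thesis .
  qed
  then have "Z g \<le> lq_functional (- a) q' (\<lambda>k. ennreal (2 * C) * ennreal (\<eta> k))"
    using q by (subst Z_eq[OF g]) (intro lq_functional_mono, auto)
  also have "\<dots> = ennreal (2 * C) * lq_functional (- a) q' (\<lambda>k. ennreal (\<eta> k))"
    using q by (intro lq_functional_cmult) auto
  also have "\<dots> \<le> ennreal (2 * C) * koethe_norm M N g"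
    using low real by (intro mult_left_mono) auto
  finally show ?thesis .
qed

theorem composite_koethe_equivalent: "equal_spaces_equiv_norms M (koethe_norm M N) Z"
  unfolding equal_spaces_equiv_norms_def
proof (intro conjI)
  have "koethe_norm M N g < \<infinity> \<longleftrightarrow> Z g < \<infinity>" if "g \<in> borel_measurable M" for g
    using composite_koethe_upper[OF that] composite_koethe_lower[OF that]
    by (auto intro: le_less_trans simp: ennreal_mult_less_top)
  then show "ideal_space M (koethe_norm M N) = ideal_space M Z"
    by (auto simp: ideal_space_def)
  show "\<exists>c C'. 0 < c \<and> 0 < C' \<and>
    (\<forall>g\<in>ideal_space M Z. ennreal c * Z g \<le> koethe_norm M N g \<and> koethe_norm M N g \<le> ennreal C' * Z g)"
  proof (rule exI[of _ "1 / (2 * C)"], rule exI[of _ 1], intro conjI ballI)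
    show "0 < 1 / (2 * C)" using C by simp
    fix g assume "g \<in> ideal_space M Z"
    then have g: "g \<in> borel_measurable M" by (simp add: ideal_space_def)
    have "ennreal (1 / (2 * C)) * Z g \<le> ennreal (1 / (2 * C)) * (ennreal (2 * C) * koethe_norm M N g)"
      by (intro mult_left_mono composite_koethe_lower g) simp
    also have "\<dots> = koethe_norm M N g"
      using C by (simp add: mult.assoc[symmetric] flip: ennreal_mult)
    finally show "ennreal (1 / (2 * C)) * Z g \<le> koethe_norm M N g" .
    show "koethe_norm M N g \<le> ennreal 1 * Z g"
      using composite_koethe_upper[OF g] by simp
  qed simp
qed

theorem composite_dual_koethe: "dual_equals M N (koethe_norm M N)"
  by (rule order_continuous_ideal_norm.dual_equals_koethe[OF composite_order_continuous_ideal_norm])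

theorem composite_dual: "dual_equals M N Z"
  by (rule dual_equals_equiv_norms[OF composite_dual_koethe composite_koethe_equivalent])

text \<open>
  This is \<open>koethe_Hoelder\<close> twice: for the functions on each piece, and then for the sequences of their
  norms.
\<close>

theorem composite_Hoelder: "hoelder_inequality (weighted_lq_norm a q) X \<Omega>"
  unfolding hoelder_inequality_def
proof (intro ballI)
  fix f g
  assume f: "f \<in> ideal_space M N"
    and g: "g \<in> ideal_space M (composite_koethe_norm (weighted_lq_norm a q) X \<Omega>)"
  let ?E = "weighted_lq_norm a q"
  let ?x = "\<lambda>k. enn2real (X k (cut k f))" and ?y = "\<lambda>k. enn2real (koethe_norm (L k) (X k) (cut k g))"
  interpret E: ideal_norm "count_space idx" ?E using q by (intro ideal_norm_weighted_lq) auto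
  have [measurable]: "f \<in> borel_measurable M" "g \<in> borel_measurable M"
    using f g by (auto simp: ideal_space_def)
  have Nf: "N f = ?E ?x" "\<And>k. k \<in> idx \<Longrightarrow> cut k f \<in> ideal_space (L k) (X k)"
    using f by (auto simp: ideal_space_def composite_norm_def split: if_splits)
  have Kg: "composite_koethe_norm ?E X \<Omega> g = E.K ?y"
    "\<And>k. k \<in> idx \<Longrightarrow> cut k g \<in> ideal_space (L k) (koethe_norm (L k) (X k))"
    using g by (auto simp: ideal_space_def composite_koethe_norm_def composite_norm_def split: if_splits)
  have "(\<integral>\<^sup>+x. ennreal \<bar>f x * g x\<bar> \<partial>M) \<le> (\<integral>\<^sup>+k. ennreal \<bar>?x k * ?y k\<bar> \<partial>count_space idx)"
    unfolding nn_integral_product_pieces[OF \<open>f \<in> borel_measurable M\<close> \<open>g \<in> borel_measurable M\<close>]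
  proof (intro nn_integral_mono)
    fix k assume "k \<in> space (count_space idx)"
    then have k: "k \<in> idx" by simp
    have "(\<integral>\<^sup>+x. ennreal \<bar>cut k f x * cut k g x\<bar> \<partial>L k) \<le> X k (cut k f) * koethe_norm (L k) (X k) (cut k g)"
      using Nf(2)[OF k] Kg(2)[OF k]
      by (intro ideal_norm.koethe_Hoelder[OF local_ideal[OF k]]) (auto simp: ideal_space_def)
    also have "\<dots> = ennreal \<bar>?x k * ?y k\<bar>"
      using Nf(2)[OF k] Kg(2)[OF k] by (simp add: ideal_space_def abs_mult ennreal_mult)
    finally show "(\<integral>\<^sup>+x. ennreal \<bar>cut k f x * cut k g x\<bar> \<partial>L k) \<le> ennreal \<bar>?x k * ?y k\<bar>" .
  qed
  also have "\<dots> \<le> ?E ?x * E.K ?y"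
  proof (rule E.koethe_Hoelder)
    show "?x \<in> ideal_space (count_space idx) ?E"
      using f Nf(1) by (simp add: ideal_space_def)
    show "E.K ?y < \<infinity>" using g Kg(1) by (simp add: ideal_space_def)
  qed simp
  finally have le: "(\<integral>\<^sup>+x. ennreal \<bar>f x * g x\<bar> \<partial>M) \<le> N f * composite_koethe_norm ?E X \<Omega> g"
    by (simp only: Nf(1) Kg(1))
  also have "\<dots> < \<infinity>"
    using f g by (auto simp: ideal_space_def ennreal_mult_less_top)
  finally have int: "integrable M (\<lambda>x. f x * g x)"
    by (simp add: integrable_iff_bounded)
  then have "ennreal (\<integral>x. \<bar>f x * g x\<bar> \<partial>M) = (\<integral>\<^sup>+x. ennreal \<bar>f x * g x\<bar> \<partial>M)"
    by (intro nn_integral_eq_integral[symmetric] integrable_abs) auto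
  with int le show "integrable M (\<lambda>x. f x * g x) \<and>
    ennreal (\<integral>x. \<bar>f x * g x\<bar> \<partial>M) \<le> N f * composite_koethe_norm ?E X \<Omega> g"
    by simp
qed

end

section \<open>Duality of the Herz--Lorentz spaces\<close>

theorem corollary3p1p7:
  fixes \<Omega> :: "'a::euclidean_space set"
    and p r p' r' :: ennreal
    and a q q' :: real
  assumes "\<Omega> \<in> sets lebesgue"
    and "1 \<le> r" "r < \<infinity>" "p < \<infinity>" "1 < q"
    and "1 / p + 1 / p' = 1" "1 / r + 1 / r' = 1" "1 / q + 1 / q' = 1"
  shows
    "(1 < p \<and> (\<forall>k\<in>idx. nontrivial_space (lebesgue_on (piece \<Omega> k)) (lorentz_avg_norm p r (piece \<Omega> k))) \<longrightarrow>
        dual_equals (lebesgue_on \<Omega>) (HL_avg_norm p r a q \<Omega>)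
          (koethe_norm (lebesgue_on \<Omega>) (HL_avg_norm p r a q \<Omega>)) \<and>
        equal_spaces_equiv_norms (lebesgue_on \<Omega>)
          (koethe_norm (lebesgue_on \<Omega>) (HL_avg_norm p r a q \<Omega>)) (HL_avg_norm p' r' (-a) q' \<Omega>) \<and>
        dual_equals (lebesgue_on \<Omega>) (HL_avg_norm p r a q \<Omega>) (HL_avg_norm p' r' (-a) q' \<Omega>) \<and>
        hoelder_inequality (weighted_lq_norm a q) (\<lambda>k. lorentz_avg_norm p r (piece \<Omega> k)) \<Omega>) \<and>
     (r \<le> p \<and> (\<forall>k\<in>idx. nontrivial_space (lebesgue_on (piece \<Omega> k)) (lorentz_norm p r (piece \<Omega> k))) \<longrightarrow>
        dual_equals (lebesgue_on \<Omega>) (HL_norm p r a q \<Omega>)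
          (koethe_norm (lebesgue_on \<Omega>) (HL_norm p r a q \<Omega>)) \<and>
        equal_spaces_equiv_norms (lebesgue_on \<Omega>)
          (koethe_norm (lebesgue_on \<Omega>) (HL_norm p r a q \<Omega>)) (HL_norm p' r' (-a) q' \<Omega>) \<and>
        dual_equals (lebesgue_on \<Omega>) (HL_norm p r a q \<Omega>) (HL_norm p' r' (-a) q' \<Omega>) \<and>
        hoelder_inequality (weighted_lq_norm a q) (\<lambda>k. lorentz_norm p r (piece \<Omega> k)) \<Omega>)"
proof -
  have q': "1 < q'"
  proof -
    have "0 < 1 / q" "1 / q < 1" using assms(5) by auto
    then have "0 < 1 / q'" "1 / q' < 1" using assms(8) by linarith+
    then show ?thesis by (simp add: field_simps split: if_splits)
  qed
  have div: "divisible_measure (lebesgue_on (piece \<Omega> k))" if "k \<in> idx" for k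
    by (intro divisible_lebesgue_on piece_lmeasurable assms(1) that)
  let ?C = "2 * hardy_const (enn2real (1 / p)) (enn2real r) + 1"
  have C: "0 < ?C" by (simp add: hardy_const_def add_nonneg_pos)
  have avg: "local_duality \<Omega> (\<lambda>k. lorentz_avg_norm p r (piece \<Omega> k)) (\<lambda>k. lorentz_avg_norm p' r' (piece \<Omega> k)) q q' ?C"
    if p: "1 < p"
  proof (rule local_duality.intro)
    fix k assume k: "k \<in> idx"
    interpret divisible_measure "lebesgue_on (piece \<Omega> k)" by (rule div[OF k])
    show "order_continuous_ideal_norm (lebesgue_on (piece \<Omega> k)) (lorentz_avg_norm p r (piece \<Omega> k))"
      unfolding lorentz_avg_norm_def using p assms by (intro order_continuous_lorentz_avg) auto
    fix f g :: "'a \<Rightarrow> real"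
    assume g: "g \<in> borel_measurable (lebesgue_on (piece \<Omega> k))"
    then show "lorentz_avg_norm p' r' (piece \<Omega> k) g
      \<le> ennreal ?C * koethe_norm (lebesgue_on (piece \<Omega> k)) (lorentz_avg_norm p r (piece \<Omega> k)) g"
      unfolding lorentz_avg_norm_def using p assms by (intro koethe_lorentz_avg_lower) auto
    assume "f \<in> borel_measurable (lebesgue_on (piece \<Omega> k))"
    with g show "(\<integral>\<^sup>+x. ennreal \<bar>f x * g x\<bar> \<partial>lebesgue_on (piece \<Omega> k))
      \<le> lorentz_avg_norm p r (piece \<Omega> k) f * lorentz_avg_norm p' r' (piece \<Omega> k) g"
      unfolding lorentz_avg_norm_def using p assms by (intro lorentz_avg_integral_le) auto
  qed (use assms q' C in auto)
  have star: "local_duality \<Omega> (\<lambda>k. lorentz_norm p r (piece \<Omega> k)) (\<lambda>k. lorentz_norm p' r' (piece \<Omega> k)) q q' ?C"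
    if r: "r \<le> p"
  proof (rule local_duality.intro)
    fix k assume k: "k \<in> idx"
    interpret divisible_measure "lebesgue_on (piece \<Omega> k)" by (rule div[OF k])
    show "order_continuous_ideal_norm (lebesgue_on (piece \<Omega> k)) (lorentz_norm p r (piece \<Omega> k))"
      unfolding lorentz_norm_def using r assms by (intro order_continuous_lorentz) auto
    fix f g :: "'a \<Rightarrow> real"
    assume g: "g \<in> borel_measurable (lebesgue_on (piece \<Omega> k))"
    then show "lorentz_norm p' r' (piece \<Omega> k) g
      \<le> ennreal ?C * koethe_norm (lebesgue_on (piece \<Omega> k)) (lorentz_norm p r (piece \<Omega> k)) g"
      unfolding lorentz_norm_def using r assms by (intro koethe_lorentz_lower) auto
    assume "f \<in> borel_measurable (lebesgue_on (piece \<Omega> k))"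
    with g show "(\<integral>\<^sup>+x. ennreal \<bar>f x * g x\<bar> \<partial>lebesgue_on (piece \<Omega> k))
      \<le> lorentz_norm p r (piece \<Omega> k) f * lorentz_norm p' r' (piece \<Omega> k) g"
      unfolding lorentz_norm_def using r assms by (intro lorentz_integral_le) auto
  qed (use assms q' C in auto)
  show ?thesis
    unfolding HL_avg_norm_def HL_norm_def
    using local_duality.composite_dual_koethe[OF avg] local_duality.composite_koethe_equivalent[OF avg]
      local_duality.composite_dual[OF avg] local_duality.composite_Hoelder[OF avg]
      local_duality.composite_dual_koethe[OF star] local_duality.composite_koethe_equivalent[OF star]
      local_duality.composite_dual[OF star] local_duality.composite_Hoelder[OF star]
    by blast
qed

end
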